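(* Let $n\ge2$. For $(\alpha,\beta;\sigma;s,r)\in\{\pm\}^2\times\mathrm{Irr}(SL(n-1,\mathbb R))_{\mathrm{fin}}\times\mathbb C^2$ we have $$\operatorname{Hom}_{\mathfrak g,P}(M_{\mathfrak p}(\sigma,r)^\beta,M_{\mathfrak p}(\mathrm{triv},s)^\alpha)=\begin{cases}\mathbb C\,\mathrm{id}&\text{if }(\beta,\sigma,r)=(\alpha,\mathrm{triv},s),\\ \mathbb C\,\varphi_k&\text{if }(\alpha,\beta;\sigma;s,r)\in\Lambda^n_{(\mathfrak g,P)},\\ \{0\}&\text{otherwise,}\end{cases}$$ where in the second case $k\in\mathbb Z_{\ge0}$ is the integer with $s=k-1$ and $r=-(1+\frac{k}{n-1})$.
   Context: Groups. Let $n\ge2$, $G=SL(n,\mathbb R)$, $\mathfrak g=\mathfrak{sl}(n,\mathbb C)$; $E_{i,j}$ are the matrix units, $N_j^+=E_{1,j+1}$, $N_j^-=E_{j+1,1}$ for $1\le j\le n-1$, $\mathfrak n_-=\mathrm{span}_{\mathbb C}\{N_j^-\}$, and $\widetilde H_0=\frac1{n-1}\mathrm{diag}(n-1,-1,\dots,-1)$. $P=MAN_+$ is the maximal parabolic subgroup of block upper triangular matrices in $G$ for the partition $n=1+(n-1)$, with $M=\{\mathrm{diag}(\det(g)^{-1},g): g\in SL^{\pm}(n-1,\mathbb R)\}\cong SL^\pm(n-1,\mathbb R)$, $A=\exp(\mathbb R\widetilde H_0)$, $N_+=\exp(\mathrm{span}_{\mathbb R}\{N_j^+\})$; $\mathfrak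 p$ is the complexified Lie algebra of $P$. Here $SL^\pm(m,\mathbb R)$ is the group of real $m\times m$ matrices of determinant $\pm1$; $SL^\pm(1,\mathbb R)=\{\pm1\}$ and $SL(1,\mathbb R)=\{1\}$. Representations. For $\lambda\in\mathbb C$, $\mathbb C_\lambda$ is the character $\exp(t\widetilde H_0)\mapsto e^{\lambda t}$ of $A$. For $\alpha\in\{\pm\}$, $\mathbb C_\alpha$ is the character of $M$ sending $\mathrm{diag}(\det(g)^{-1},g)$ to $1$ if $\alpha=+$ and to $\mathrm{sgn}(\det g)$ if $\alpha=-$. $\mathrm{Irr}(SL(n-1,\mathbb R))_{\mathrm{fin}}$ is the set of equivalence classes of finite-dimensional irreducible complex representations of $SL(n-1,\mathbb R)$, and $\mathrm{triv}$ is the trivial one. The irreducible finite-dimensional representations of $M$ are written $\mathbb C_\alpha\otimes\sigma$ with $\alpha\in\{\pm\}$ and $\sigma\in\mathrm{Irr}(SL(n-1,\mathbb R))_{\mathrm{fin}}$; for $n\ge3$ the representation $\mathrm{sym}^k_{n-1}$ below is here extended to $SL^\pm(n-1,\mathbb R)$ by the natural action on $S^k(\mathbb C^{n-1})$ (for other $\sigma$ fix any extension). Generalized Verma modules. $M_{\mathfrak p}(\sigma,\lambda)^\alpha=\mathcal U(\mathfrak g)\otimes_{\mathcal U(\mathfrak p)}W$, where $W$ is the space of the $P$-representation $(\mathbb C_\alpha\otimes\sigma)\boxtimes\mathbb C_\lambda\boxtimes\mathrm{triv}$ of $P=MAN_+$, is regarded as a $(\mathfrak g,P)$-module with $P$ acting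 diagonally, $p\cdot(u\otimes w)=\mathrm{Ad}(p)u\otimes pw$. $\operatorname{Hom}_{\mathfrak g,P}$ denotes linear maps commuting with $\mathfrak g$ and $P$. Parameters. For $\alpha\in\{\pm\}\equiv\{\pm1\}$ and $k\in\mathbb Z_{\ge0}$, $\alpha+k\in\{\pm\}$ is $+$ if $\alpha=(-1)^k$ and $-$ if $\alpha=(-1)^{k+1}$. $\mathrm{sym}^k_{n-1}$ is the irreducible representation of $SL(n-1,\mathbb R)$ on $S^k(\mathbb C^{n-1})$; $\mathrm{sym}^k_1$ is regarded as $\mathrm{triv}$ for all $k\in\mathbb Z_{\ge0}$. For $n\ge2$, $\Lambda^n_{(\mathfrak g,P)}=\{(\alpha,\alpha+k;\mathrm{sym}^k_{n-1};k-1,-(1+\frac{k}{n-1})):\alpha\in\{\pm\},\,k\in\mathbb Z_{\ge0}\}$. The map $\varphi_k$. Let $e_1,\dots,e_{n-1}$ be the standard basis of $\mathbb C^{n-1}$. Let $\Xi_k=\{\mathbf k=(k_1,\dots,k_{n-1})\in(\mathbb Z_{\ge0})^{n-1}:\sum_jk_j=k\}$, $e_{\mathbf k}=e_1^{k_1}\cdots e_{n-1}^{k_{n-1}}\in S^k(\mathbb C^{n-1})$ and $N^-_{\mathbf k}=(N_1^-)^{k_1}\cdots(N_{n-1}^-)^{k_{n-1}}\in S^k(\mathfrak n_-)$. As linear spaces $M_{\mathfrak p}(\mathrm{triv},s)^\alpha\cong S(\mathfrak n_-)$, via $u\mapsto u\otimes1$ ($\mathfrak n_-$ is abelian, so $\mathcal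 U(\mathfrak n_-)=S(\mathfrak n_-)$). Define the linear map $\varphi_k=\sum_{\mathbf k\in\Xi_k}N^-_{\mathbf k}\otimes(e_{\mathbf k})^\vee\colon S^k(\mathbb C^{n-1})\to S^k(\mathfrak n_-)\subset M_{\mathfrak p}(\mathrm{triv},k-1)^\alpha$, where $\{(e_{\mathbf k})^\vee\}$ is the basis dual to $\{e_{\mathbf k}\}$, i.e. $\varphi_k(e_{\mathbf k})=N_{\mathbf k}^-$. The same symbol denotes the map $M_{\mathfrak p}(\mathrm{sym}^k_{n-1},-(1+\frac k{n-1}))^{\alpha+k}\to M_{\mathfrak p}(\mathrm{triv},k-1)^\alpha$ given by $\varphi_k(u\otimes w)=u\,\varphi_k(w)$ for $u\in\mathcal U(\mathfrak g)$, $w\in S^k(\mathbb C^{n-1})$.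
   Formalization: For n=2, sym^k_1 (k from s=k-1, r=-(1+k)) is extended to SL^±(1,R)={±1} by (-1)^k, not trivially: with the trivial extension -I acts by β on the source and α on the target, so for odd k the claim fails. *)

theory Defs
  imports "HOL-Analysis.Analysis" "HOL-Library.Poly_Mapping"
begin

text \<open>
  Conventions. A finite type \<open>'m\<close> plays the role of the index set
  \<open>{1,...,n-1}\<close>, so \<open>n - 1 = CARD('m)\<close> and every \<open>n \<ge> 2\<close> occurs.  The index set \<open>{1,...,n}\<close> is
  \<open>'m option\<close>: \<open>None\<close> is the index 1 and \<open>Some j\<close> is the index \<open>j + 1\<close>.  Signs are the
  integers 1 and -1.
\<close>


section \<open>The Lie algebra and its universal enveloping algebra\<close>

typedef (overloaded) ('m::finite) sl =
  "{X :: complex^('m option)^('m option). trace X = 0}"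
  morphisms mat_of_sl Abs_sl
  by (rule exI[of _ 0]) (simp add: trace_def)

setup_lifting type_definition_sl

lift_definition sl_add :: "'m::finite sl \<Rightarrow> 'm sl \<Rightarrow> 'm sl" is "(+)"
  by (simp add: trace_add)

lift_definition sl_scale :: "complex \<Rightarrow> 'm::finite sl \<Rightarrow> 'm sl" is
  "\<lambda>c X. \<chi> i j. c * X $ i $ j"
  by (simp add: trace_def sum_distrib_left[symmetric])

lift_definition sl_bracket :: "'m::finite sl \<Rightarrow> 'm sl \<Rightarrow> 'm sl" is
  "\<lambda>X Y. X ** Y - Y ** X"
  by (metis trace_sub trace_mul_sym right_minus_eq)

text \<open>Lists under concatenation are the free monoid, so that \<open>'g list \<Rightarrow>\<^sub>0 complex\<close>, with the
  convolution product of \<^theory>\<open>HOL-Library.Poly_Mapping\<close>, is the free associative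
  algebra on \<open>'g\<close>.\<close>

instantiation list :: (type) monoid_add
begin
definition zero_list :: "'a list" where "zero_list = []"
definition plus_list :: "'a list \<Rightarrow> 'a list \<Rightarrow> 'a list" where "plus_list = (@)"
instance by standard (simp_all add: zero_list_def plus_list_def)
end

type_synonym 'm free_alg = "'m sl list \<Rightarrow>\<^sub>0 complex"

definition letter :: "'m::finite sl \<Rightarrow> 'm free_alg" where
  "letter X = Poly_Mapping.single [X] 1"

inductive_set uea_ideal :: "('m::finite) free_alg set" where
  uea_add: "letter (sl_add X Y) - letter X - letter Y \<in> uea_ideal"
| uea_scale: "letter (sl_scale c X) - Poly_Mapping.single 0 c * letter X \<in> uea_ideal"
| uea_bracket: "letter X * letter Y - letter Y * letter X - letter (sl_bracket X Y) \<in> uea_ideal"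
| uea_sum: "a \<in> uea_ideal \<Longrightarrow> b \<in> uea_ideal \<Longrightarrow> a + b \<in> uea_ideal"
| uea_mult: "a \<in> uea_ideal \<Longrightarrow> p * a * q \<in> uea_ideal"

lemma uea_ideal_zero: "0 \<in> uea_ideal"
  using uea_mult[OF uea_add, of 0] by simp

lemma uea_ideal_lmult: "a \<in> uea_ideal \<Longrightarrow> p * a \<in> uea_ideal"
  using uea_mult[of a p 1] by simp

lemma uea_ideal_rmult: "a \<in> uea_ideal \<Longrightarrow> a * q \<in> uea_ideal"
  using uea_mult[of a 1 q] by simp

lemma uea_ideal_uminus: "a \<in> uea_ideal \<Longrightarrow> - a \<in> uea_ideal"
  using uea_ideal_lmult[of a "-1"] by simp

definition uea_rel :: "('m::finite) free_alg \<Rightarrow> 'm free_alg \<Rightarrow> bool" where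
  "uea_rel a b \<longleftrightarrow> a - b \<in> uea_ideal"

quotient_type (overloaded) 'm uea = "('m::finite) free_alg" / uea_rel
  morphisms rep_uea abs_uea
proof (rule equivpI)
  show "reflp (uea_rel :: 'm free_alg \<Rightarrow> _)"
    by (simp add: reflp_def uea_rel_def uea_ideal_zero)
  show "symp (uea_rel :: 'm free_alg \<Rightarrow> _)"
    unfolding symp_def uea_rel_def using uea_ideal_uminus by fastforce
  show "transp (uea_rel :: 'm free_alg \<Rightarrow> _)"
    unfolding transp_def uea_rel_def using uea_sum by fastforce
qed

lemma lookup_mult_list_zero:
  "Poly_Mapping.lookup (a * b) 0 = Poly_Mapping.lookup a 0 * Poly_Mapping.lookup b 0"
  for a b :: "'g list \<Rightarrow>\<^sub>0 complex"
proof -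
  have *: "(0::'g list) = l + q \<longleftrightarrow> l = 0 \<and> q = 0" for l q
    by (auto simp: zero_list_def plus_list_def)
  have "(Sum_any (\<lambda>q. Poly_Mapping.lookup b q when 0 = l + q)) = (Poly_Mapping.lookup b 0 when l = 0)" for l
  proof (cases "l = 0")
    case False
    then have "\<not> (0 = l + q)" for q using * by blast
    then show ?thesis using False by simp
  qed simp
  then show ?thesis
    by (simp add: lookup_mult mult_when)
qed

lemma lookup_letter_zero: "Poly_Mapping.lookup (letter X) 0 = 0"
  by (simp add: letter_def lookup_single zero_list_def)

lemma uea_ideal_lookup_zero: "a \<in> uea_ideal \<Longrightarrow> Poly_Mapping.lookup a 0 = 0"
proof (induction rule: uea_ideal.induct)
qed (simp_all add: lookup_minus lookup_add lookup_mult_list_zero lookup_letter_zero)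

instantiation uea :: (finite) ring_1
begin

lift_definition zero_uea :: "'a uea" is 0 .
lift_definition one_uea :: "'a uea" is 1 .

lift_definition plus_uea :: "'a uea \<Rightarrow> 'a uea \<Rightarrow> 'a uea" is "(+)"
  unfolding uea_rel_def by (metis add_diff_add uea_sum)

lift_definition uminus_uea :: "'a uea \<Rightarrow> 'a uea" is uminus
  unfolding uea_rel_def by (metis minus_diff_minus uea_ideal_uminus)

lift_definition minus_uea :: "'a uea \<Rightarrow> 'a uea \<Rightarrow> 'a uea" is "(-)"
  unfolding uea_rel_def
  by (metis (no_types, opaque_lifting) add_diff_add minus_diff_minus uea_ideal_uminus uea_sum
      diff_conv_add_uminus)

lift_definition times_uea :: "'a uea \<Rightarrow> 'a uea \<Rightarrow> 'a uea" is "(*)"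
proof -
  fix a b c d :: "'a free_alg"
  assume "uea_rel a b" "uea_rel c d"
  moreover have "a * c - b * d = (a - b) * c + b * (c - d)" by (simp add: algebra_simps)
  ultimately show "uea_rel (a * c) (b * d)"
    unfolding uea_rel_def by (metis uea_sum uea_ideal_lmult uea_ideal_rmult)
qed

instance
proof
  show "(0::'a uea) \<noteq> 1"
  proof (transfer, unfold uea_rel_def, rule notI)
    assume "(0::'a free_alg) - 1 \<in> uea_ideal"
    from uea_ideal_lookup_zero[OF this] show False by (simp add: lookup_one lookup_minus)
  qed
qed (transfer; simp add: uea_rel_def uea_ideal_zero algebra_simps)+

end

definition uea_of :: "'m::finite sl \<Rightarrow> 'm uea" where
  "uea_of X = abs_uea (letter X)"

definition uea_const :: "complex \<Rightarrow> 'm::finite uea" where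
  "uea_const c = abs_uea (Poly_Mapping.single 0 c)"


section \<open>The adjoint action of real matrices\<close>

definition cmat :: "real^'n^'k \<Rightarrow> complex^'n^'k" where
  "cmat A = (\<chi> i j. complex_of_real (A $ i $ j))"

definition Re_mat :: "complex^'n^'k \<Rightarrow> real^'n^'k" where
  "Re_mat X = (\<chi> i j. Re (X $ i $ j))"

definition Im_mat :: "complex^'n^'k \<Rightarrow> real^'n^'k" where
  "Im_mat X = (\<chi> i j. Im (X $ i $ j))"

lemma cmat_mult: "cmat (A ** B) = cmat A ** cmat B"
  by (simp add: cmat_def matrix_matrix_mult_def)

lemma cmat_one: "cmat (mat 1) = mat 1"
  by (simp add: cmat_def mat_def vec_eq_iff)

lemma cmat_inv:
  assumes "invertible p"
  shows "cmat (matrix_inv p) ** cmat p = mat 1"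
proof -
  have "\<exists>q. p ** q = mat 1 \<and> q ** p = mat 1" using assms by (simp add: invertible_def)
  then have "matrix_inv p ** p = mat 1" unfolding matrix_inv_def by (metis (mono_tags, lifting) someI_ex)
  then show ?thesis by (metis cmat_mult cmat_one)
qed

lemma matrix_add_rdistrib: "(A + B) ** C = A ** C + B ** C" for A B :: "complex^'n^'k"
  by (simp add: matrix_matrix_mult_def vec_eq_iff sum.distrib distrib_right)

lemma matrix_diff_ldistrib: "A ** (B - C) = A ** B - A ** C" for B C :: "complex^'n^'k"
  by (simp add: matrix_matrix_mult_def vec_eq_iff sum_subtractf right_diff_distrib)

lemma matrix_diff_rdistrib: "(A - B) ** C = A ** C - B ** C" for A B :: "complex^'n^'k"
  by (simp add: matrix_matrix_mult_def vec_eq_iff sum_subtractf left_diff_distrib)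

text \<open>Only invertible \<open>p\<close> matter; the identity is a dummy value for the others.\<close>

lift_definition Ad_sl :: "real^('m option)^('m option) \<Rightarrow> 'm::finite sl \<Rightarrow> 'm sl" is
  "\<lambda>p X. if invertible p then cmat p ** X ** cmat (matrix_inv p) else X"
proof -
  fix p :: "real^('m::finite option)^('m option)" and X :: "complex^('m option)^('m option)"
  assume X: "trace X = 0"
  have "trace (cmat p ** X ** cmat (matrix_inv p)) = 0" if "invertible p"
  proof -
    have "trace (cmat p ** X ** cmat (matrix_inv p)) = trace (cmat (matrix_inv p) ** cmat p ** X)"
      by (subst trace_mul_sym) (simp only: matrix_mul_assoc)
    also have "\<dots> = 0" by (simp only: cmat_inv[OF that] matrix_mul_lid X)
    finally show ?thesis .
  qed
  then show "trace (if invertible p then cmat p ** X ** cmat (matrix_inv p) else X) = 0"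
    using X by (cases "invertible p") simp_all
qed

lemma Ad_sl_add: "Ad_sl p (sl_add X Y) = sl_add (Ad_sl p X) (Ad_sl p Y)"
  by transfer (simp add: matrix_add_ldistrib matrix_add_rdistrib)

lemma Ad_sl_scale: "Ad_sl p (sl_scale c X) = sl_scale c (Ad_sl p X)"
proof transfer
  fix p :: "real^('m::finite option)^('m option)" and c and X :: "complex^('m option)^('m option)"
  have l: "A ** (\<chi> i j. c * B $ i $ j) = (\<chi> i j. c * (A ** B) $ i $ j)"
    for A B :: "complex^('m option)^('m option)"
    by (simp add: matrix_matrix_mult_def vec_eq_iff sum_distrib_left mult.left_commute)
  have r: "(\<chi> i j. c * B $ i $ j) ** A = (\<chi> i j. c * (B ** A) $ i $ j)"
    for A B :: "complex^('m option)^('m option)"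
    by (simp add: matrix_matrix_mult_def vec_eq_iff sum_distrib_left mult.assoc)
  show "(if invertible p then cmat p ** (\<chi> i j. c * X $ i $ j) ** cmat (matrix_inv p)
      else \<chi> i j. c * X $ i $ j) =
    (\<chi> i j. c * (if invertible p then cmat p ** X ** cmat (matrix_inv p) else X) $ i $ j)"
    by (cases "invertible p") (simp_all only: l r if_True if_False)
qed

lemma Ad_sl_bracket: "Ad_sl p (sl_bracket X Y) = sl_bracket (Ad_sl p X) (Ad_sl p Y)"
proof (transfer, clarsimp)
  fix p :: "real^('m::finite option)^('m option)" and X Y :: "complex^('m option)^('m option)"
  assume p: "invertible p"
  let ?p = "cmat p" and ?q = "cmat (matrix_inv p)"
  have *: "?p ** A ** ?q ** (?p ** B ** ?q) = ?p ** (A ** B) ** ?q" for A B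
  proof -
    have "?p ** A ** ?q ** (?p ** B ** ?q) = ?p ** A ** (?q ** ?p) ** B ** ?q"
      by (simp only: matrix_mul_assoc)
    also have "\<dots> = ?p ** (A ** B) ** ?q"
      by (simp only: cmat_inv[OF p] matrix_mul_rid matrix_mul_assoc)
    finally show ?thesis .
  qed
  show "?p ** (X ** Y - Y ** X) ** ?q =
      ?p ** X ** ?q ** (?p ** Y ** ?q) - ?p ** Y ** ?q ** (?p ** X ** ?q)"
    by (simp only: * matrix_diff_ldistrib matrix_diff_rdistrib)
qed

definition free_map :: "('g \<Rightarrow> 'h) \<Rightarrow> ('g list \<Rightarrow>\<^sub>0 complex) \<Rightarrow> ('h list \<Rightarrow>\<^sub>0 complex)" where
  "free_map f a =
    (\<Sum>xs\<in>Poly_Mapping.keys a. Poly_Mapping.single (map f xs) (Poly_Mapping.lookup a xs))"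

lemma free_map_superset:
  assumes "finite S" "Poly_Mapping.keys a \<subseteq> S"
  shows "free_map f a = (\<Sum>xs\<in>S. Poly_Mapping.single (map f xs) (Poly_Mapping.lookup a xs))"
  unfolding free_map_def
  by (rule sum.mono_neutral_left) (use assms in \<open>auto simp: in_keys_iff\<close>)

lemma free_map_zero [simp]: "free_map f 0 = 0"
  by (simp add: free_map_def)

lemma free_map_single [simp]:
  "free_map f (Poly_Mapping.single xs c) = Poly_Mapping.single (map f xs) c"
  by (simp add: free_map_superset[of "{xs}"])

lemma free_map_add: "free_map f (a + b) = free_map f a + free_map f b"
proof -
  let ?S = "Poly_Mapping.keys a \<union> Poly_Mapping.keys b"
  have "Poly_Mapping.keys (a + b) \<subseteq> ?S" by (rule keys_add)
  then show ?thesis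
    by (simp add: free_map_superset[of ?S] lookup_add single_add sum.distrib)
qed

lemma free_map_uminus: "free_map f (- a) = - free_map f a"
proof -
  have "free_map f a + free_map f (- a) = 0"
    by (simp flip: free_map_add)
  then show ?thesis by (simp only: eq_neg_iff_add_eq_0 add.commute)
qed

lemma free_map_diff: "free_map f (a - b) = free_map f a - free_map f b"
  using free_map_add[of f a "- b"] by (simp add: free_map_uminus)

lemma free_map_sum: "free_map f (sum g S) = (\<Sum>x\<in>S. free_map f (g x))"
  by (induction S rule: infinite_finite_induct) (simp_all add: free_map_add)

lemma free_map_mult: "free_map f (a * b) = free_map f a * free_map f b"
proof -
  have *: "a = (\<Sum>xs\<in>Poly_Mapping.keys a. Poly_Mapping.single xs (Poly_Mapping.lookup a xs))"
    for a :: "'g list \<Rightarrow>\<^sub>0 complex"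
    by (rule poly_mapping_eqI) (auto simp: lookup_sum lookup_single when_def in_keys_iff)
  have "free_map f (a * b) = (\<Sum>xs\<in>Poly_Mapping.keys a. \<Sum>ys\<in>Poly_Mapping.keys b.
      Poly_Mapping.single (map f (xs + ys)) (Poly_Mapping.lookup a xs * Poly_Mapping.lookup b ys))"
    by (subst (1) *[of a], subst (1) *[of b])
      (simp add: sum_product free_map_sum mult_single)
  also have "\<dots> = free_map f a * free_map f b"
    by (simp add: free_map_def sum_product mult_single plus_list_def)
  finally show ?thesis .
qed

lemma free_map_Ad_ideal: "a \<in> uea_ideal \<Longrightarrow> free_map (Ad_sl p) a \<in> uea_ideal"
proof (induction rule: uea_ideal.induct)
  case (uea_add X Y)
  show ?case using uea_ideal.uea_add[of "Ad_sl p X" "Ad_sl p Y"]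
    by (simp add: letter_def free_map_diff Ad_sl_add)
next
  case (uea_scale c X)
  show ?case using uea_ideal.uea_scale[of c "Ad_sl p X"]
    by (simp add: letter_def free_map_diff free_map_mult Ad_sl_scale zero_list_def)
next
  case (uea_bracket X Y)
  show ?case using uea_ideal.uea_bracket[of "Ad_sl p X" "Ad_sl p Y"]
    by (simp add: letter_def free_map_diff free_map_mult Ad_sl_bracket)
next
  case (uea_sum a b)
  then show ?case by (simp add: free_map_add uea_ideal.uea_sum)
next
  case (uea_mult a p' q)
  then show ?case by (simp add: free_map_mult uea_ideal.uea_mult)
qed

text \<open>The extension of \<open>Ad p\<close> to an algebra automorphism of the enveloping algebra.\<close>

lift_definition Ad_uea :: "real^('m option)^('m option) \<Rightarrow> 'm::finite uea \<Rightarrow> 'm uea" is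
  "\<lambda>p. free_map (Ad_sl p)"
  by (simp add: uea_rel_def free_map_Ad_ideal flip: free_map_diff)


section \<open>The parabolic subgroup and its Lie algebra\<close>

primrec mat_power :: "real^'n^'n \<Rightarrow> nat \<Rightarrow> real^'n^'n" where
  "mat_power X 0 = mat 1"
| "mat_power X (Suc k) = X ** mat_power X k"

definition mat_exp :: "real^'n^'n \<Rightarrow> real^'n^'n" where
  "mat_exp X = suminf (\<lambda>k. (1 / fact k) *\<^sub>R mat_power X k)"

definition SL :: "(real^'m^'m) set" where
  "SL = {g. det g = 1}"

definition SLpm :: "(real^'m^'m) set" where
  "SLpm = {g. det g = 1 \<or> det g = -1}"

definition unit_mat :: "'n \<Rightarrow> 'n \<Rightarrow> 'a::zero_neq_one^'n^'n" where
  "unit_mat i j = (\<chi> a b. if a = i \<and> b = j then 1 else 0)"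

definition M_elem :: "real^'m^'m \<Rightarrow> real^('m option)^('m option)" where
  "M_elem g = (\<chi> i j. case (i, j) of
      (None, None) \<Rightarrow> inverse (det g)
    | (Some a, Some b) \<Rightarrow> g $ a $ b
    | _ \<Rightarrow> 0)"

definition H0 :: "real^('m option)^('m::finite option)" where
  "H0 = (1 / real CARD('m)) *\<^sub>R
    (\<chi> i j. if i \<noteq> j then 0 else if i = None then real CARD('m) else -1)"

definition A_elem :: "real \<Rightarrow> real^('m option)^('m::finite option)" where
  "A_elem t = mat_exp (t *\<^sub>R H0)"

definition N_elem :: "real^'m \<Rightarrow> real^('m option)^('m::finite option)" where
  "N_elem x = mat_exp (\<Sum>j\<in>UNIV. (x $ j) *\<^sub>R unit_mat None (Some j))"

definition P_grp :: "(real^('m option)^('m::finite option)) set" where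
  "P_grp = {M_elem g ** A_elem t ** N_elem x | g t x. g \<in> SLpm}"

definition real_lie_P :: "(real^('m option)^('m::finite option)) set" where
  "real_lie_P = {X. \<forall>t. mat_exp (t *\<^sub>R X) \<in> P_grp}"

definition lie_p :: "'m::finite sl set" where
  "lie_p = {X. Re_mat (mat_of_sl X) \<in> real_lie_P \<and> Im_mat (mat_of_sl X) \<in> real_lie_P}"


section \<open>Finite-dimensional representations\<close>

text \<open>
  A finite-dimensional complex vector space with a basis indexed by the finite set \<open>I\<close> is
  represented as the space of all \<open>w :: 'i \<Rightarrow>\<^sub>0 complex\<close> supported on \<open>I\<close>;
  \<^term>\<open>Poly_Mapping.single i 1\<close> is the basis vector with index \<open>i\<close>.
\<close>

definition coord_space :: "'i set \<Rightarrow> ('i \<Rightarrow>\<^sub>0 'b::zero) set" where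
  "coord_space I = {w. Poly_Mapping.keys w \<subseteq> I}"

definition cscale :: "complex \<Rightarrow> ('i \<Rightarrow>\<^sub>0 complex) \<Rightarrow> ('i \<Rightarrow>\<^sub>0 complex)" where
  "cscale c = Poly_Mapping.map ((*) c)"

definition clinear_on :: "('i \<Rightarrow>\<^sub>0 complex) set \<Rightarrow> (('i \<Rightarrow>\<^sub>0 complex) \<Rightarrow> ('j \<Rightarrow>\<^sub>0 complex)) \<Rightarrow> bool" where
  "clinear_on W T \<longleftrightarrow> (\<forall>v\<in>W. \<forall>w\<in>W. T (v + w) = T v + T w) \<and>
    (\<forall>c. \<forall>w\<in>W. T (cscale c w) = cscale c (T w))"

definition fd_rep ::
  "(real^'m^'m) set \<Rightarrow> (real^'m^'m \<Rightarrow> ('i \<Rightarrow>\<^sub>0 complex) \<Rightarrow> ('i \<Rightarrow>\<^sub>0 complex)) \<Rightarrow> 'i set \<Rightarrow> bool"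
where
  "fd_rep H \<sigma> I \<longleftrightarrow> finite I \<and>
    (\<forall>g\<in>H. \<sigma> g ` coord_space I \<subseteq> coord_space I \<and> clinear_on (coord_space I) (\<sigma> g)) \<and>
    (\<forall>w\<in>coord_space I. \<sigma> (mat 1) w = w) \<and>
    (\<forall>g\<in>H. \<forall>h\<in>H. \<forall>w\<in>coord_space I. \<sigma> (g ** h) w = \<sigma> g (\<sigma> h w)) \<and>
    (\<forall>w\<in>coord_space I. \<forall>i\<in>I. continuous_on H (\<lambda>g. Poly_Mapping.lookup (\<sigma> g w) i))"

definition irreducible_rep ::
  "(real^'m^'m) set \<Rightarrow> (real^'m^'m \<Rightarrow> ('i \<Rightarrow>\<^sub>0 complex) \<Rightarrow> ('i \<Rightarrow>\<^sub>0 complex)) \<Rightarrow> 'i set \<Rightarrow> bool"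
where
  "irreducible_rep H \<sigma> I \<longleftrightarrow> fd_rep H \<sigma> I \<and> I \<noteq> {} \<and>
    (\<forall>S. S \<subseteq> coord_space I \<and> module.subspace cscale S \<and> (\<forall>g\<in>H. \<sigma> g ` S \<subseteq> S) \<longrightarrow>
      S = {0} \<or> S = coord_space I)"

definition rep_equiv ::
  "(real^'m^'m) set \<Rightarrow> (real^'m^'m \<Rightarrow> ('i \<Rightarrow>\<^sub>0 complex) \<Rightarrow> ('i \<Rightarrow>\<^sub>0 complex)) \<Rightarrow> 'i set \<Rightarrow>
    (real^'m^'m \<Rightarrow> ('j \<Rightarrow>\<^sub>0 complex) \<Rightarrow> ('j \<Rightarrow>\<^sub>0 complex)) \<Rightarrow> 'j set \<Rightarrow> bool"
where
  "rep_equiv H \<sigma> I \<tau> J \<longleftrightarrow> (\<exists>T. clinear_on (coord_space I) T \<and>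
    bij_betw T (coord_space I) (coord_space J) \<and>
    (\<forall>g\<in>H. \<forall>w\<in>coord_space I. T (\<sigma> g w) = \<tau> g (T w)))"

definition triv_rep :: "real^'m^'m \<Rightarrow> (unit \<Rightarrow>\<^sub>0 complex) \<Rightarrow> (unit \<Rightarrow>\<^sub>0 complex)" where
  "triv_rep g w = w"

text \<open>
  \<open>('m \<Rightarrow>\<^sub>0 nat) \<Rightarrow>\<^sub>0 complex\<close> is the polynomial ring in variables \<open>e\<^sub>j\<close>, that is, the symmetric
  algebra of \<open>\<complex>\<^sup>n\<^sup>-\<^sup>1\<close>; its part of degree \<open>k\<close> is \<open>coord_space (Xi k)\<close>.  A matrix acts by
  the algebra endomorphism \<open>e\<^sub>j \<mapsto> g e\<^sub>j\<close>.  On \<^const>\<open>SLpm\<close> this is the natural action, for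
  \<open>n = 2\<close> too, where -1 acts on the line \<open>S\<^sup>k(\<complex>)\<close> by \<open>(-1)\<^sup>k\<close>; its restriction to the trivial
  group \<^const>\<open>SL\<close> is then trivial.
\<close>

definition Xi :: "nat \<Rightarrow> ('m::finite \<Rightarrow>\<^sub>0 nat) set" where
  "Xi k = {\<kappa>. (\<Sum>j\<in>UNIV. Poly_Mapping.lookup \<kappa> j) = k}"

definition sym_rep ::
  "real^'m^'m \<Rightarrow> (('m::finite \<Rightarrow>\<^sub>0 nat) \<Rightarrow>\<^sub>0 complex) \<Rightarrow> (('m \<Rightarrow>\<^sub>0 nat) \<Rightarrow>\<^sub>0 complex)"
where
  "sym_rep g w = (\<Sum>\<kappa>\<in>Poly_Mapping.keys w.
    cscale (Poly_Mapping.lookup w \<kappa>)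
      (\<Prod>j\<in>UNIV. (\<Sum>i\<in>UNIV. Poly_Mapping.single (Poly_Mapping.single i 1)
        (complex_of_real (g $ i $ j))) ^ Poly_Mapping.lookup \<kappa> j))"

definition sign_char :: "int \<Rightarrow> real^'m^'m \<Rightarrow> complex" where
  "sign_char \<alpha> g = (if \<alpha> = 1 then 1 else complex_of_real (sgn (det g)))"

text \<open>The representation of \<open>P = M A N\<^sub>+\<close> attached to \<open>(\<alpha>, \<sigma>, \<nu>)\<close>; the factors \<open>g\<close>, \<open>t\<close>, \<open>x\<close>
  of an element of \<open>P\<close> are unique.\<close>

definition P_rep ::
  "int \<Rightarrow> (real^'m^'m \<Rightarrow> ('i \<Rightarrow>\<^sub>0 complex) \<Rightarrow> ('i \<Rightarrow>\<^sub>0 complex)) \<Rightarrow> complex \<Rightarrow>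
    real^('m option)^('m::finite option) \<Rightarrow> ('i \<Rightarrow>\<^sub>0 complex) \<Rightarrow> ('i \<Rightarrow>\<^sub>0 complex)"
where
  "P_rep \<alpha> \<sigma> \<nu> p w = (THE v. \<exists>g t x. g \<in> SLpm \<and> p = M_elem g ** A_elem t ** N_elem x \<and>
    v = cscale (sign_char \<alpha> g * exp (\<nu> * complex_of_real t)) (\<sigma> g w))"

text \<open>The differential of a representation \<open>\<pi>\<close> of \<open>P\<close>, computed coordinatewise, and its
  complex-linear extension to the complexified Lie algebra.\<close>

definition real_differential ::
  "(real^'n^'n \<Rightarrow> ('i \<Rightarrow>\<^sub>0 complex) \<Rightarrow> ('i \<Rightarrow>\<^sub>0 complex)) \<Rightarrow>
    real^'n^'n \<Rightarrow> ('i \<Rightarrow>\<^sub>0 complex) \<Rightarrow> ('i \<Rightarrow>\<^sub>0 complex)"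
where
  "real_differential \<pi> X w = Abs_poly_mapping (\<lambda>i.
    vector_derivative (\<lambda>t. Poly_Mapping.lookup (\<pi> (mat_exp (t *\<^sub>R X)) w) i) (at 0))"

definition differential ::
  "(real^('m option)^('m option) \<Rightarrow> ('i \<Rightarrow>\<^sub>0 complex) \<Rightarrow> ('i \<Rightarrow>\<^sub>0 complex)) \<Rightarrow>
    'm::finite sl \<Rightarrow> ('i \<Rightarrow>\<^sub>0 complex) \<Rightarrow> ('i \<Rightarrow>\<^sub>0 complex)"
where
  "differential \<pi> X w = real_differential \<pi> (Re_mat (mat_of_sl X)) w +
    cscale \<i> (real_differential \<pi> (Im_mat (mat_of_sl X)) w)"


section \<open>(g,P)-modules and generalized Verma modules\<close>

record ('m, 'v) gP_module =
  carr :: "'v set"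
  mzero :: "'v"
  madd :: "'v \<Rightarrow> 'v \<Rightarrow> 'v"
  mscale :: "complex \<Rightarrow> 'v \<Rightarrow> 'v"
  lie_act :: "'m sl \<Rightarrow> 'v \<Rightarrow> 'v"
  grp_act :: "real^('m option)^('m option) \<Rightarrow> 'v \<Rightarrow> 'v"

definition Hom_gP ::
  "('m::finite, 'v) gP_module \<Rightarrow> ('m, 'w) gP_module \<Rightarrow> ('v \<Rightarrow> 'w) set"
where
  "Hom_gP M N = {f \<in> carr M \<rightarrow>\<^sub>E carr N.
    (\<forall>x\<in>carr M. \<forall>y\<in>carr M. f (madd M x y) = madd N (f x) (f y)) \<and>
    (\<forall>c. \<forall>x\<in>carr M. f (mscale M c x) = mscale N c (f x)) \<and>
    (\<forall>X. \<forall>x\<in>carr M. f (lie_act M X x) = lie_act N X (f x)) \<and>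
    (\<forall>p\<in>P_grp. \<forall>x\<in>carr M. f (grp_act M p x) = grp_act N p (f x))}"

text \<open>
  With \<open>W = coord_space I\<close>, the tensor product \<open>U(g) \<otimes>\<^sub>\<complex> W\<close> is the space of
  \<open>x :: 'i \<Rightarrow>\<^sub>0 'm uea\<close> supported on \<open>I\<close>, where \<open>u \<otimes> w\<close> has coordinates \<open>w\<^sub>i u\<close>.
\<close>

definition uea_act :: "'m::finite uea \<Rightarrow> ('i \<Rightarrow>\<^sub>0 'm uea) \<Rightarrow> ('i \<Rightarrow>\<^sub>0 'm uea)" where
  "uea_act u = Poly_Mapping.map ((*) u)"

definition tensor :: "'m::finite uea \<Rightarrow> ('i \<Rightarrow>\<^sub>0 complex) \<Rightarrow> ('i \<Rightarrow>\<^sub>0 'm uea)" where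
  "tensor u w = Poly_Mapping.map (\<lambda>c. uea_const c * u) w"

text \<open>
  The kernel of \<open>U(g) \<otimes>\<^sub>\<complex> W \<rightarrow> U(g) \<otimes>\<^bsub>U(p)\<^esub> W\<close>: it is spanned by all \<open>u y \<otimes> w - u \<otimes> y w\<close> with
  \<open>y = X\<^sub>1 \<cdots> X\<^sub>l\<close> a product of elements of \<open>p\<close>; such products span \<open>U(p)\<close>.
\<close>

definition balance ::
  "(real^('m option)^('m option) \<Rightarrow> ('i \<Rightarrow>\<^sub>0 complex) \<Rightarrow> ('i \<Rightarrow>\<^sub>0 complex)) \<Rightarrow> 'i set \<Rightarrow>
    ('i \<Rightarrow>\<^sub>0 'm::finite uea) set"
where
  "balance \<pi> I = module.span (\<lambda>c. uea_act (uea_const c))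
    {tensor (u * prod_list (map uea_of Xs)) w - tensor u (foldr (differential \<pi>) Xs w)
      | u Xs w. set Xs \<subseteq> lie_p \<and> w \<in> coord_space I}"

text \<open>Elements of the quotient are cosets; \<open>coset_map R f\<close> is the map induced by \<open>f\<close> with values
  in the cosets of \<open>R\<close>.\<close>

definition coset_map :: "'b::plus set \<Rightarrow> ('a \<Rightarrow> 'b) \<Rightarrow> 'a set \<Rightarrow> 'b set" where
  "coset_map R f C = {f x + \<rho> | x \<rho>. x \<in> C \<and> \<rho> \<in> R}"

definition verma ::
  "(real^'m^'m \<Rightarrow> ('i \<Rightarrow>\<^sub>0 complex) \<Rightarrow> ('i \<Rightarrow>\<^sub>0 complex)) \<Rightarrow> 'i set \<Rightarrow> complex \<Rightarrow> int \<Rightarrow>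
    ('m::finite, ('i \<Rightarrow>\<^sub>0 'm uea) set) gP_module"
where
  "verma \<sigma> I \<nu> \<alpha> = (let \<pi> = P_rep \<alpha> \<sigma> \<nu>; R = balance \<pi> I in
    \<lparr>carr = {{x + \<rho> | \<rho>. \<rho> \<in> R} | x. x \<in> coord_space I},
     mzero = R,
     madd = (\<lambda>C D. {x + y | x y. x \<in> C \<and> y \<in> D}),
     mscale = (\<lambda>c. coset_map R (uea_act (uea_const c))),
     lie_act = (\<lambda>X. coset_map R (uea_act (uea_of X))),
     grp_act = (\<lambda>p. coset_map R (\<lambda>x. \<Sum>i\<in>I.
       tensor (Ad_uea p (Poly_Mapping.lookup x i)) (\<pi> p (Poly_Mapping.single i 1))))\<rparr>)"

abbreviation verma_triv ::
  "complex \<Rightarrow> int \<Rightarrow> ('m::finite, (unit \<Rightarrow>\<^sub>0 'm uea) set) gP_module" where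
  "verma_triv \<equiv> verma triv_rep UNIV"

abbreviation verma_sym ::
  "nat \<Rightarrow> complex \<Rightarrow> int \<Rightarrow> ('m::finite, (('m \<Rightarrow>\<^sub>0 nat) \<Rightarrow>\<^sub>0 'm uea) set) gP_module" where
  "verma_sym k \<equiv> verma sym_rep (Xi k)"

definition multiples ::
  "('m, 'v) gP_module \<Rightarrow> ('m, 'w) gP_module \<Rightarrow> ('v \<Rightarrow> 'w) \<Rightarrow> ('v \<Rightarrow> 'w) set" where
  "multiples M N f = {\<lambda>x\<in>carr M. mscale N c (f x) | c. True}"

definition zero_map ::
  "('m, 'v) gP_module \<Rightarrow> ('m, 'w) gP_module \<Rightarrow> ('v \<Rightarrow> 'w)" where
  "zero_map M N = (\<lambda>x\<in>carr M. mzero N)"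


section \<open>The parameters and the map \<open>\<phi>\<^sub>k\<close>\<close>

definition sign_add :: "int \<Rightarrow> nat \<Rightarrow> int" where
  "sign_add \<alpha> k = (if \<alpha> = (-1) ^ k then 1 else -1)"

definition in_Lambda ::
  "nat \<Rightarrow> int \<Rightarrow> int \<Rightarrow> (real^'m^'m \<Rightarrow> ('i \<Rightarrow>\<^sub>0 complex) \<Rightarrow> ('i \<Rightarrow>\<^sub>0 complex)) \<Rightarrow> 'i set \<Rightarrow>
    complex \<Rightarrow> complex \<Rightarrow> bool"
where
  "in_Lambda k \<alpha> \<beta> \<sigma> I s r \<longleftrightarrow>
    \<beta> = sign_add \<alpha> k \<and>
    rep_equiv SL \<sigma> I (sym_rep :: real^'m^'m \<Rightarrow> _) (Xi k) \<and>
    s = of_nat k - 1 \<and>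
    r = - (1 + of_nat k / of_nat CARD('m::finite))"

text \<open>
  A representation \<open>\<sigma>\<close> of \<^const>\<open>SL\<close> enters the Verma module through an extension to
  \<^const>\<open>SLpm\<close>.  The extension is arbitrary, except that that of \<open>sym\<^sup>k\<close>, in particular
  that of \<open>triv = sym\<^sup>0\<close>, is the natural one.  For \<open>n = 2\<close> the group \<^const>\<open>SL\<close> is trivial and
  all \<open>sym\<^sup>k\<close> are \<open>triv\<close> on it, while their natural extensions depend on the parity of \<open>k\<close>;
  there the pair \<open>(s, r)\<close> tells which \<open>k\<close> is meant.
\<close>

definition extension_convention ::
  "(real^'m^'m \<Rightarrow> ('i \<Rightarrow>\<^sub>0 complex) \<Rightarrow> ('i \<Rightarrow>\<^sub>0 complex)) \<Rightarrow> 'i set \<Rightarrow> complex \<Rightarrow> complex \<Rightarrow> bool"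
where
  "extension_convention \<sigma> I s r \<longleftrightarrow>
    (rep_equiv SL \<sigma> I triv_rep UNIV \<and> (CARD('m::finite) = 1 \<longrightarrow> r = s) \<longrightarrow>
      rep_equiv SLpm \<sigma> I triv_rep UNIV) \<and>
    (\<forall>k. rep_equiv SL \<sigma> I (sym_rep :: real^'m^'m \<Rightarrow> _) (Xi k) \<and>
        (CARD('m) = 1 \<longrightarrow> s = of_nat k - 1 \<and> r = - (1 + of_nat k / of_nat CARD('m))) \<longrightarrow>
      rep_equiv SLpm \<sigma> I (sym_rep :: real^'m^'m \<Rightarrow> _) (Xi k))"

text \<open>The \<open>N\<^sub>j\<^sup>-\<close> commute, so the order of the factors in \<open>N_pow\<close> is immaterial.\<close>

lift_definition N_minus :: "'m::finite \<Rightarrow> 'm sl" is "\<lambda>j. unit_mat (Some j) None"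
  by (auto simp: unit_mat_def trace_def intro!: sum.neutral)

definition N_pow :: "('m::finite \<Rightarrow>\<^sub>0 nat) \<Rightarrow> 'm uea" where
  "N_pow \<kappa> = prod_list (map (\<lambda>j. uea_of (N_minus j) ^ Poly_Mapping.lookup \<kappa> j)
    (SOME js. distinct js \<and> set js = UNIV))"

text \<open>\<open>phi k \<alpha>\<close> is the map \<open>u \<otimes> e\<^sub>\<kappa> \<mapsto> u N\<^sub>\<kappa>\<^sup>- \<otimes> 1\<close>.\<close>

definition phi ::
  "nat \<Rightarrow> int \<Rightarrow> (('m::finite \<Rightarrow>\<^sub>0 nat) \<Rightarrow>\<^sub>0 'm uea) set \<Rightarrow> (unit \<Rightarrow>\<^sub>0 'm uea) set"
where
  "phi k \<alpha> =
    (\<lambda>C\<in>carr (verma_sym k (- (1 + of_nat k / of_nat CARD('m))) (sign_add \<alpha> k)).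
      coset_map (balance (P_rep \<alpha> triv_rep (of_nat k - 1)) UNIV)
        (\<lambda>x. \<Sum>\<kappa>\<in>Xi k. tensor (Poly_Mapping.lookup x \<kappa> * N_pow \<kappa>) (Poly_Mapping.single () 1)) C)"

end

theory Submission
  imports Defs
begin

text \<open>Put \<open>m = n - 1\<close>.  As \<open>n\<^sub>-\<close> is abelian, \<open>M(triv, s)\<close> is the polynomial ring
  \<open>\<complex>[x\<^sub>1,...,x\<^sub>m]\<close>, with \<open>N\<^sub>j\<^sup>-\<close> acting as multiplication by \<open>x\<^sub>j\<close> and the rest of the Lie algebra by
  differential operators: \<open>N\<^sub>j\<^sup>+\<close> is \<open>(s - E) \<partial>\<^sub>j\<close> with the Euler operator \<open>E\<close>, and the Levi
  factor acts by linear vector fields and scalars.  The lemma \<open>rho_bracket\<close> says that these formulas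
  define a representation, and \<open>balance_triv_iff\<close> that \<open>u \<otimes> 1 \<mapsto> u \<cdot> 1\<close> identifies the Verma
  module with it.

  A homomorphism out of \<open>M(\<sigma>, r)\<close> is determined by its restriction \<open>\<phi>\<close> to \<open>1 \<otimes> W\<close>, a
  \<open>P\<close>-equivariant map into the polynomial ring, and \<open>\<phi>\<close> is very restricted:

  \<^item> \<open>A\<close> acts on polynomials of degree \<open>d\<close> with the weight \<open>s - d (1 + 1/m)\<close>.  These weights are
    distinct, so \<open>\<phi>\<close> has values in a single degree \<open>d\<close>, and \<open>r\<close> is the weight
    (\<open>phi_weight\<close>).
  \<^item> \<open>n\<^sub>+\<close> acts by zero on \<open>W\<close>, so \<open>(s - E) \<partial>\<^sub>j \<phi>(w) = 0\<close> for all \<open>j\<close>.  As \<open>\<partial>\<^sub>j \<phi>(w)\<close> has degree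
    \<open>d - 1\<close>, either \<open>d = 0\<close> or \<open>s = d - 1\<close> (\<open>phi_degree\<close>).
  \<^item> The polynomials of degree \<open>d\<close> are the irreducible representation \<open>sym\<^sup>d\<close> of \<open>SL(m, \<real>)\<close>
    (\<open>sym_irreducible\<close>), so a nonzero \<open>\<phi>\<close> is an isomorphism \<open>\<sigma> \<cong> sym\<^sup>d\<close> (\<open>phi_equiv\<close>), unique up
    to a scalar by Schur's lemma (\<open>sym_schur\<close>).  The elements of \<open>M\<close> with \<open>det g = -1\<close> then fix
    the relation between \<open>\<alpha>\<close> and \<open>\<beta>\<close> (\<open>phi_sign\<close>).

  The case \<open>d = 0\<close> gives the multiples of the identity, and \<open>d = k \<ge> 1\<close> gives exactly the
  parameters in \<open>\<Lambda>\<close> with that \<open>k\<close>; for \<open>k = 0\<close> the two descriptions agree.  Conversely, if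
  \<open>s = k - 1\<close> then \<open>N\<^sub>+\<close> fixes all polynomials of degree \<open>k\<close>, so the inclusion of \<open>S\<^sup>k\<close> into the
  polynomial ring is \<open>P\<close>-equivariant (\<open>phi_equivariant\<close>) and induces \<open>\<phi>\<^sub>k\<close>.

  Two ingredients are of a different nature.  The group \<open>P\<close> acts through automorphisms of the
  enveloping algebra, and its unipotent part has to be recognised as the exponential of the Lie
  algebra action (\<open>uact_Ad_unipotent\<close>).  Moreover \<open>\<sigma>\<close> is only assumed continuous; that it can be
  differentiated (\<open>one_parameter_group_differentiable\<close>) is what makes the action of \<open>P\<close> on
  \<open>M(\<sigma>, r)\<close> well defined (\<open>ind_act_balance\<close>).\<close>

section \<open>Polynomials\<close>

alias lookup = Poly_Mapping.lookup
alias single = Poly_Mapping.single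
alias keys = Poly_Mapping.keys

type_synonym 'm pol = "('m \<Rightarrow>\<^sub>0 nat) \<Rightarrow>\<^sub>0 complex"

lemma lookup_cscale [simp]: "lookup (cscale c w) i = c * lookup w i"
  by (simp add: cscale_def Poly_Mapping.map.rep_eq when_def)

lemma lookup_single_mult:
  fixes f :: "('m \<Rightarrow>\<^sub>0 nat) \<Rightarrow>\<^sub>0 complex"
  shows "lookup (single a c * f) (a + q) = c * lookup f q"
  by (simp add: lookup_mult lookup_single when_mult)

lemma lookup_single_mult_other:
  fixes f :: "('m \<Rightarrow>\<^sub>0 nat) \<Rightarrow>\<^sub>0 complex"
  assumes "\<And>q. \<kappa> \<noteq> a + q"
  shows "lookup (single a c * f) \<kappa> = 0"
  using assms by (simp add: lookup_mult lookup_single when_mult)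

definition uexp :: "'m \<Rightarrow> ('m \<Rightarrow>\<^sub>0 nat)" where
  "uexp i = single i 1"

lemma lookup_uexp: "lookup (uexp i) j = (if i = j then 1 else 0)"
  by (simp add: uexp_def lookup_single when_def)

lemma lookup_uexp_same [simp]: "lookup (uexp i) i = 1"
  by (simp add: lookup_uexp)

definition xvar :: "'m \<Rightarrow> 'm pol" where
  "xvar i = single (uexp i) 1"

lemma unit_exponent_decomp:
  "lookup \<kappa> i \<noteq> 0 \<Longrightarrow> uexp i + (\<kappa> - uexp i) = (\<kappa> :: 'm \<Rightarrow>\<^sub>0 nat)"
  by (rule poly_mapping_eqI) (auto simp: lookup_add lookup_minus lookup_uexp)

lemma lookup_xvar_mult:
  "lookup (xvar i * f) \<kappa> =
    (if lookup \<kappa> i = 0 then 0 else lookup f (\<kappa> - uexp i))"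
proof (cases "lookup \<kappa> i = 0")
  case True
  then have "\<kappa> \<noteq> uexp i + q" for q
    by (auto simp: lookup_add)
  then show ?thesis using True by (simp add: xvar_def lookup_single_mult_other)
next
  case False
  then show ?thesis
    using lookup_single_mult[of "uexp i" 1 f "\<kappa> - uexp i"]
    unfolding unit_exponent_decomp[OF False] xvar_def[symmetric] by (simp add: False)
qed

lemma konst_mult: "single 0 c * f = cscale c f" for f :: "'m pol"
  using lookup_single_mult[of 0 c f] by (intro poly_mapping_eqI) simp

lemma cscale_single: "cscale c (single k d) = single k (c * d)"
  by (rule poly_mapping_eqI) (simp add: lookup_single when_def)

lemma cscale_add: "cscale c (v + w) = cscale c v + cscale c w"
  by (rule poly_mapping_eqI) (simp add: lookup_add algebra_simps)

lemma cscale_diff: "cscale c (v - w) = cscale c v - cscale c w"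
  by (rule poly_mapping_eqI) (simp add: lookup_minus algebra_simps)

lemma cscale_sum: "cscale c (sum f S) = (\<Sum>x\<in>S. cscale c (f x))"
  by (rule poly_mapping_eqI) (simp add: lookup_sum sum_distrib_left)

lemma cscale_add_left: "cscale (c + d) w = cscale c w + cscale d w"
  by (rule poly_mapping_eqI) (simp add: lookup_add algebra_simps)

lemma cscale_sum_left: "cscale (sum c S) w = (\<Sum>x\<in>S. cscale (c x) w)"
  by (rule poly_mapping_eqI) (simp add: lookup_sum sum_distrib_right)

lemma cscale_cscale [simp]: "cscale c (cscale d w) = cscale (c * d) w"
  by (rule poly_mapping_eqI) simp

lemma cscale_simps [simp]: "cscale 0 w = 0" "cscale 1 w = w" "cscale c 0 = 0"
  by (rule poly_mapping_eqI; simp)+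

lemma mult_cscale: "f * cscale c g = cscale c (f * g)" "cscale c f * g = cscale c (f * g)"
  for f g :: "'m pol"
  by (simp_all add: konst_mult[symmetric] algebra_simps)

lemma poly_mapping_sum_single:
  "w = (\<Sum>k\<in>keys (w :: 'a \<Rightarrow>\<^sub>0 'b::comm_monoid_add). single k (lookup w k))"
  by (rule poly_mapping_eqI) (auto simp: lookup_sum lookup_single when_def in_keys_iff)

lemma poly_mapping_induct_single [case_names zero single add]:
  assumes "P 0" "\<And>k c. P (single k c)" "\<And>v w. P v \<Longrightarrow> P w \<Longrightarrow> P (v + w)"
  shows "P (w :: 'a \<Rightarrow>\<^sub>0 'b::comm_monoid_add)"
proof -
  have "P (\<Sum>k\<in>S. single k (lookup w k))" if "finite S" for S
    using that by induction (auto intro: assms)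
  then show ?thesis using poly_mapping_sum_single[of w] by (metis finite_keys)
qed

definition mdeg :: "('m::finite \<Rightarrow>\<^sub>0 nat) \<Rightarrow> nat" where
  "mdeg \<kappa> = (\<Sum>j\<in>UNIV. lookup \<kappa> j)"

lemma mdeg_add: "mdeg (\<kappa> + \<mu>) = mdeg \<kappa> + mdeg \<mu>"
  by (simp add: mdeg_def lookup_add sum.distrib)

lemma mdeg_single [simp]: "mdeg (single i n) = n"
  by (simp add: mdeg_def lookup_single when_def)

lemma mdeg_uexp [simp]: "mdeg (uexp i) = 1"
  by (simp add: uexp_def)

lemma mdeg_zero [simp]: "mdeg 0 = 0"
  by (simp add: mdeg_def)

lemma mdeg_eq_0_iff: "mdeg \<kappa> = 0 \<longleftrightarrow> \<kappa> = 0"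
  by (auto simp: mdeg_def intro!: poly_mapping_eqI)

lemma Xi_eq: "Xi k = {\<kappa>. mdeg \<kappa> = k}"
  by (simp add: Xi_def mdeg_def)

lemma mdeg_minus: "lookup \<kappa> i \<noteq> 0 \<Longrightarrow> Suc (mdeg (\<kappa> - uexp i)) = mdeg \<kappa>"
  using mdeg_add[of "uexp i" "\<kappa> - uexp i"] by (simp add: unit_exponent_decomp)

lemma finite_Xi: "finite (Xi k :: ('m::finite \<Rightarrow>\<^sub>0 nat) set)"
proof (induction k)
  case 0
  have "Xi 0 = {0 :: 'm \<Rightarrow>\<^sub>0 nat}" by (auto simp: Xi_eq mdeg_eq_0_iff)
  then show ?case by simp
next
  case (Suc k)
  have "Xi (Suc k) \<subseteq> (\<lambda>(i, \<kappa>). uexp i + \<kappa>) ` (UNIV \<times> (Xi k :: ('m \<Rightarrow>\<^sub>0 nat) set))"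
  proof
    fix \<kappa> :: "'m \<Rightarrow>\<^sub>0 nat" assume "\<kappa> \<in> Xi (Suc k)"
    then have k: "mdeg \<kappa> = Suc k" by (simp add: Xi_eq)
    then obtain i where i: "lookup \<kappa> i \<noteq> 0"
      by (metis mdeg_def sum.neutral nat.distinct(1))
    then have "\<kappa> - uexp i \<in> Xi k"
      using mdeg_minus[OF i] k by (simp add: Xi_eq)
    then show "\<kappa> \<in> (\<lambda>(i, \<kappa>). uexp i + \<kappa>) ` (UNIV \<times> Xi k)"
      using unit_exponent_decomp[OF i] by (intro image_eqI[of _ _ "(i, _)"]) auto
  qed
  then show ?case using Suc finite_subset by fastforce
qed

lemma exponent_induct [case_names zero step]:
  fixes \<kappa> :: "'m::finite \<Rightarrow>\<^sub>0 nat"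
  assumes "P 0" "\<And>i \<kappa>. P \<kappa> \<Longrightarrow> P (uexp i + \<kappa>)"
  shows "P \<kappa>"
proof (induction "mdeg \<kappa>" arbitrary: \<kappa>)
  case 0
  then show ?case using assms(1) by (simp add: mdeg_eq_0_iff)
next
  case (Suc k)
  then obtain i where i: "lookup \<kappa> i \<noteq> 0"
    by (metis mdeg_def sum.neutral nat.distinct(1))
  have "P (\<kappa> - uexp i)"
    using Suc mdeg_minus[OF i] by auto
  from assms(2)[OF this, of i] show ?case by (simp only: unit_exponent_decomp[OF i])
qed

lemma pol_induct [case_names const xvar add]:
  fixes f :: "'m::finite pol"
  assumes "\<And>c. P (single 0 c)" "\<And>i f. P f \<Longrightarrow> P (xvar i * f)"
    "\<And>f g. P f \<Longrightarrow> P g \<Longrightarrow> P (f + g)"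
  shows "P f"
proof (induction f rule: poly_mapping_induct_single)
  case zero
  then show ?case using assms(1)[of 0] by simp
next
  case (single k c)
  show ?case
  proof (induction k rule: exponent_induct)
    case (step i \<kappa>)
    then show ?case using assms(2)[OF step, of i] by (simp add: xvar_def mult_single)
  qed (rule assms)
qed (rule assms)

lift_definition pdiff :: "'m \<Rightarrow> 'm pol \<Rightarrow> 'm pol" is
  "\<lambda>j f \<kappa>. of_nat (lookup \<kappa> j + 1) * f (\<kappa> + uexp j)"
proof -
  fix j :: 'm and f :: "('m \<Rightarrow>\<^sub>0 nat) \<Rightarrow> complex" assume f: "finite {x. f x \<noteq> 0}"
  have "finite ((\<lambda>\<kappa>. \<kappa> + uexp j) -` {x. f x \<noteq> 0})"
    by (intro finite_vimageI f injI) simp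
  then show "finite {\<kappa>. of_nat (lookup \<kappa> j + 1) * f (\<kappa> + uexp j) \<noteq> 0}"
    by (rule rev_finite_subset) auto
qed

text \<open>This is \<open>s - E\<close>, where \<open>E = \<Sum>\<^sub>j x\<^sub>j \<partial>\<^sub>j\<close> is the Euler operator.\<close>

lift_definition deg_op :: "complex \<Rightarrow> 'm::finite pol \<Rightarrow> 'm pol" is
  "\<lambda>s f \<kappa>. (s - of_nat (mdeg \<kappa>)) * f \<kappa>"
  by (rule rev_finite_subset) auto

lemma pdiff_add: "pdiff j (f + g) = pdiff j f + pdiff j g"
  by (rule poly_mapping_eqI) (simp add: pdiff.rep_eq lookup_add algebra_simps)

lemma pdiff_cscale: "pdiff j (cscale c f) = cscale c (pdiff j f)"
  by (rule poly_mapping_eqI) (simp add: pdiff.rep_eq algebra_simps)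

lemma pdiff_const [simp]: "pdiff j (single 0 c) = 0"
  by (rule poly_mapping_eqI) (auto simp: pdiff.rep_eq lookup_single when_def lookup_add dest: arg_cong[of _ _ "\<lambda>x. lookup x j"])

lemma deg_op_add: "deg_op s (f + g) = deg_op s f + deg_op s g"
  by (rule poly_mapping_eqI) (simp add: deg_op.rep_eq lookup_add algebra_simps)

lemma deg_op_cscale: "deg_op s (cscale c f) = cscale c (deg_op s f)"
  by (rule poly_mapping_eqI) (simp add: deg_op.rep_eq algebra_simps)

lemma deg_op_const: "deg_op s (single 0 c) = single 0 (s * c)"
  by (rule poly_mapping_eqI) (auto simp: deg_op.rep_eq lookup_single when_def)

lemma pdiff_xvar: "pdiff j (xvar i * f) = xvar i * pdiff j f + (if i = j then f else 0)"
proof (rule poly_mapping_eqI)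
  fix \<kappa> :: "'a \<Rightarrow>\<^sub>0 nat"
  have 1: "(\<kappa> + uexp j) - uexp i =
      (if i = j then \<kappa> else (\<kappa> - uexp i) + uexp j)"
    if "i = j \<or> lookup \<kappa> i \<noteq> 0"
    using that by (intro poly_mapping_eqI) (auto simp: lookup_add lookup_minus lookup_uexp)
  show "lookup (pdiff j (xvar i * f)) \<kappa> =
      lookup (xvar i * pdiff j f + (if i = j then f else 0)) \<kappa>"
  proof (cases "i = j")
    case True
    have "\<kappa> - uexp i + uexp i = \<kappa>" if "lookup \<kappa> i \<noteq> 0"
      using unit_exponent_decomp[OF that] by (simp only: add.commute)
    then show ?thesis using 1 True
      by (auto simp: pdiff.rep_eq lookup_xvar_mult lookup_add lookup_minus lookup_uexp distrib_right left_diff_distrib of_nat_diff)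
  next
    case False
    then show ?thesis using 1
      by (auto simp: pdiff.rep_eq lookup_xvar_mult lookup_add lookup_minus lookup_uexp)
  qed
qed

lemma deg_op_xvar: "deg_op s (xvar i * f) = xvar i * deg_op s f - xvar i * f"
proof (rule poly_mapping_eqI)
  fix \<kappa>
  show "lookup (deg_op s (xvar i * f)) \<kappa> =
      lookup (xvar i * deg_op s f - xvar i * f) \<kappa>"
    using mdeg_minus[of \<kappa> i, symmetric]
    by (auto simp: deg_op.rep_eq lookup_xvar_mult lookup_minus left_diff_distrib distrib_right)
qed

lemma deg_op_pdiff: "pdiff j (deg_op s f) = deg_op s (pdiff j f) - pdiff j f"
  by (rule poly_mapping_eqI)
    (auto simp: deg_op.rep_eq pdiff.rep_eq lookup_minus mdeg_add algebra_simps)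

lemma pdiff_commute: "pdiff i (pdiff j f) = pdiff j (pdiff i f)"
  by (rule poly_mapping_eqI)
    (auto simp: pdiff.rep_eq lookup_add lookup_uexp algebra_simps)

section \<open>Symmetric powers of the standard representation\<close>

text \<open>The image of \<open>x\<^sub>j\<close> under the substitution \<open>sym_rep g\<close>.\<close>

definition lin_form :: "real^'m^'m \<Rightarrow> 'm::finite \<Rightarrow> 'm pol" where
  "lin_form g j = (\<Sum>i\<in>UNIV. cscale (complex_of_real (g $ i $ j)) (xvar i))"

lemma sym_rep_superset:
  assumes "finite S" "keys w \<subseteq> S"
  shows "sym_rep g w = (\<Sum>\<kappa>\<in>S. cscale (lookup w \<kappa>)
    (\<Prod>j\<in>UNIV. lin_form g j ^ lookup \<kappa> j))"
proof -
  have "lin_form g j = (\<Sum>i\<in>UNIV. single (single i 1)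
        (complex_of_real (g $ i $ j)))" for j
    by (simp add: lin_form_def xvar_def uexp_def cscale_single)
  then show ?thesis
    unfolding sym_rep_def
    by (simp, intro sum.mono_neutral_left) (use assms in \<open>auto simp: in_keys_iff\<close>)
qed

lemma sym_rep_add: "sym_rep g (v + w) = sym_rep g v + sym_rep g w"
proof -
  let ?S = "keys v \<union> keys w"
  have "keys (v + w) \<subseteq> ?S" by (rule keys_add)
  then show ?thesis
    by (simp add: sym_rep_superset[of ?S] lookup_add cscale_add_left sum.distrib)
qed

lemma sym_rep_single:
  "sym_rep g (single \<kappa> c) = cscale c (\<Prod>j\<in>UNIV. lin_form g j ^ lookup \<kappa> j)"
  by (simp add: sym_rep_superset[of "{\<kappa>}"])

lemma sym_rep_const [simp]: "sym_rep g (single 0 c) = single 0 c"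
  using cscale_single[of c 0 1] by (simp add: sym_rep_single)

lemma sym_rep_0 [simp]: "sym_rep g 0 = 0"
  by (simp add: sym_rep_def)

lemma sym_rep_cscale: "sym_rep g (cscale c w) = cscale c (sym_rep g w)"
proof (induction w rule: poly_mapping_induct_single)
  case zero
  then show ?case by simp
next
  case (single k d)
  show ?case by (simp add: cscale_single sym_rep_single)
qed (simp add: cscale_add sym_rep_add)

lemma sym_rep_sum: "sym_rep g (sum f S) = (\<Sum>x\<in>S. sym_rep g (f x))"
  by (induction S rule: infinite_finite_induct) (simp_all add: sym_rep_add)

lemma sym_rep_xvar: "sym_rep g (xvar i * f) = lin_form g i * sym_rep g f"
proof (induction f rule: poly_mapping_induct_single)
  case zero
  then show ?case by simp
next
  case (single \<kappa> c)
  have "(\<Prod>j\<in>UNIV. lin_form g j ^ lookup (uexp i) j) = (\<Prod>j\<in>UNIV. if i = j then lin_form g j else 1)"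
    by (rule prod.cong) (simp_all add: lookup_uexp)
  also have "\<dots> = lin_form g i" by simp
  finally show ?case
    by (simp add: xvar_def mult_single sym_rep_single lookup_add power_add prod.distrib mult_cscale)
qed (simp add: distrib_left sym_rep_add)

lemma sym_rep_comp: "sym_rep g (sym_rep h f) = sym_rep (g ** h) f"
proof (induction f rule: pol_induct)
  case (xvar i f)
  have "lin_form (g ** h) i = (\<Sum>a\<in>UNIV. cscale (complex_of_real (h $ a $ i)) (lin_form g a))"
    unfolding lin_form_def cscale_sum
    by (subst sum.swap, rule sum.cong, simp)
      (rule poly_mapping_eqI, simp add: matrix_matrix_mult_def lookup_sum sum_distrib_left sum_distrib_right algebra_simps)
  moreover have "sym_rep g (lin_form h i * F) =
      (\<Sum>a\<in>UNIV. cscale (complex_of_real (h $ a $ i)) (lin_form g a)) * sym_rep g F" for F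
    by (simp add: lin_form_def[of h] sum_distrib_right sym_rep_sum mult_cscale sym_rep_cscale sym_rep_xvar)
  ultimately show ?case using xvar by (simp add: sym_rep_xvar)
qed (simp_all add: sym_rep_add)

definition diagm :: "('m \<Rightarrow> real) \<Rightarrow> real^'m^'m::finite" where
  "diagm t = (\<chi> i j. if i = j then t i else 0)"

lemma det_diagm: "det (diagm t) = (\<Prod>i\<in>UNIV. t i)"
  by (subst det_diagonal) (simp_all add: diagm_def)

lemma lin_form_diagm: "lin_form (diagm t) j = cscale (complex_of_real (t j)) (xvar j)"
proof -
  have "lin_form (diagm t) j = (\<Sum>i\<in>UNIV. if i = j then cscale (complex_of_real (t j)) (xvar j) else 0)"
    unfolding lin_form_def by (rule sum.cong) (auto simp: diagm_def)
  then show ?thesis by simp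
qed

definition wt :: "('m::finite \<Rightarrow> real) \<Rightarrow> ('m \<Rightarrow>\<^sub>0 nat) \<Rightarrow> complex" where
  "wt t \<kappa> = (\<Prod>j\<in>UNIV. complex_of_real (t j) ^ lookup \<kappa> j)"

lemma wt_zero [simp]: "wt t 0 = 1"
  by (simp add: wt_def)

lemma wt_uexp: "wt t (uexp i) = complex_of_real (t i)"
proof -
  have "wt t (uexp i) = (\<Prod>j\<in>UNIV. if i = j then complex_of_real (t j) else 1)"
    unfolding wt_def by (rule prod.cong) (simp_all add: lookup_uexp)
  then show ?thesis by simp
qed

lemma wt_add: "wt t (\<kappa> + \<mu>) = wt t \<kappa> * wt t \<mu>"
  by (simp add: wt_def lookup_add power_add prod.distrib)

lemma wt_const: "wt (\<lambda>_. c) \<kappa> = complex_of_real c ^ mdeg \<kappa>"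
  by (simp add: wt_def mdeg_def power_sum)

lemma sym_rep_diagm: "lookup (sym_rep (diagm t) f) \<kappa> = wt t \<kappa> * lookup f \<kappa>"
proof (induction f arbitrary: \<kappa> rule: pol_induct)
  case (const c)
  then show ?case by (auto simp: lookup_single when_def)
next
  case (xvar i f)
  have "wt t \<kappa> = complex_of_real (t i) * wt t (\<kappa> - uexp i)" if "lookup \<kappa> i \<noteq> 0"
    using wt_add[of t "uexp i" "\<kappa> - uexp i"] unfolding unit_exponent_decomp[OF that] wt_uexp .
  then show ?case
    by (auto simp: sym_rep_xvar lin_form_diagm mult_cscale lookup_xvar_mult xvar)
qed (simp add: sym_rep_add lookup_add distrib_left)

lemma sym_rep_one [simp]: "sym_rep (mat 1) f = (f :: 'm::finite pol)"
proof -
  have "(mat 1 :: real^'m^'m) = diagm (\<lambda>_. 1)" by (simp add: mat_def diagm_def)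
  then show ?thesis by (intro poly_mapping_eqI) (simp only: sym_rep_diagm wt_const, simp)
qed

lemma coord_space_iff: "w \<in> coord_space I \<longleftrightarrow> (\<forall>i. lookup w i \<noteq> 0 \<longrightarrow> i \<in> I)"
  by (auto simp: coord_space_def in_keys_iff)

lemma Pol_iff: "f \<in> coord_space (Xi k) \<longleftrightarrow> (\<forall>\<kappa>. lookup f \<kappa> \<noteq> 0 \<longrightarrow> mdeg \<kappa> = k)"
  by (simp add: coord_space_iff Xi_eq)

lemma scaleR_eq_diagm: "c *\<^sub>R g = g ** diagm (\<lambda>_. c)" "c *\<^sub>R g = diagm (\<lambda>_. c) ** g"
proof -
  have "(\<Sum>k\<in>UNIV. g $ i $ k * (if k = j then c else 0)) = (\<Sum>k\<in>UNIV. if k = j then c * g $ i $ j else 0)" for i j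
    by (rule sum.cong) auto
  moreover have "(\<Sum>k\<in>UNIV. (if i = k then c else 0) * g $ k $ j) = (\<Sum>k\<in>UNIV. if i = k then c * g $ i $ j else 0)" for i j
    by (rule sum.cong) auto
  ultimately show "c *\<^sub>R g = g ** diagm (\<lambda>_. c)" "c *\<^sub>R g = diagm (\<lambda>_. c) ** g"
    by (simp_all add: vec_eq_iff matrix_matrix_mult_def diagm_def)
qed

lemma sym_rep_scaleR:
  assumes "f \<in> coord_space (Xi k)"
  shows "sym_rep (c *\<^sub>R g) f = cscale (complex_of_real c ^ k) (sym_rep g f)"
proof -
  have "sym_rep (diagm (\<lambda>_. c)) f = cscale (complex_of_real c ^ k) f"
    using assms by (intro poly_mapping_eqI) (auto simp: sym_rep_diagm wt_const Pol_iff)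
  then show ?thesis
    unfolding scaleR_eq_diagm(1) sym_rep_comp[symmetric] by (simp only: sym_rep_cscale)
qed

text \<open>Scalar matrices commute with \<open>g\<close>, and the matrix \<open>2\<close> acts on a monomial of degree \<open>k\<close> by
  \<open>2\<^sup>k\<close>, so its eigenspaces are the homogeneous parts.\<close>

lemma sym_rep_Pol:
  assumes "f \<in> coord_space (Xi k)"
  shows "sym_rep g f \<in> coord_space (Xi k)"
  unfolding Pol_iff
proof (intro allI impI)
  fix \<kappa> assume nz: "lookup (sym_rep g f) \<kappa> \<noteq> 0"
  have "sym_rep (diagm (\<lambda>_. 2)) (sym_rep g f) = cscale (complex_of_real 2 ^ k) (sym_rep g f)"
    using sym_rep_scaleR[OF assms, of 2 g] unfolding sym_rep_comp scaleR_eq_diagm(2)[of 2 g] .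
  then have "lookup (sym_rep (diagm (\<lambda>_. 2)) (sym_rep g f)) \<kappa> =
      complex_of_real 2 ^ k * lookup (sym_rep g f) \<kappa>" by simp
  then have "complex_of_real 2 ^ mdeg \<kappa> = complex_of_real 2 ^ k"
    using nz by (simp add: sym_rep_diagm wt_const)
  then have "(2::real) ^ mdeg \<kappa> = 2 ^ k"
    unfolding of_real_power[symmetric] of_real_eq_iff .
  then show "mdeg \<kappa> = k" by simp
qed

text \<open>The linear vector field \<open>\<Sum> D\<^sub>i\<^sub>j x\<^sub>i \<partial>\<^sub>j\<close>, by which the matrix \<open>D\<close> acts infinitesimally.\<close>

definition lin_vf :: "complex^'m^'m \<Rightarrow> 'm::finite pol \<Rightarrow> 'm pol" where
  "lin_vf D f = (\<Sum>i\<in>UNIV. \<Sum>j\<in>UNIV. cscale (D $ i $ j) (xvar i * pdiff j f))"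

lemma lin_vf_xvar:
  "lin_vf D (xvar k * f) = xvar k * lin_vf D f + (\<Sum>i\<in>UNIV. cscale (D $ i $ k) (xvar i * f))"
proof -
  have "lin_vf D (xvar k * f) = (\<Sum>i\<in>UNIV. \<Sum>j\<in>UNIV. xvar k * cscale (D $ i $ j) (xvar i * pdiff j f)
      + (if k = j then cscale (D $ i $ j) (xvar i * f) else 0))"
    unfolding lin_vf_def
    by (intro sum.cong refl) (auto simp: pdiff_xvar distrib_left cscale_add mult_cscale mult.left_commute)
  also have "\<dots> = xvar k * lin_vf D f + (\<Sum>i\<in>UNIV. cscale (D $ i $ k) (xvar i * f))"
    by (simp add: sum.distrib lin_vf_def sum_distrib_left)
  finally show ?thesis .
qed

text \<open>Both sides are compatible with sums and with products by a variable, the derivative by the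
  Leibniz rule and the vector field because it is a derivation; on constants both vanish.\<close>

lemma sym_rep_derivative:
  fixes A :: "real \<Rightarrow> real^'m^'m::finite"
  assumes A: "\<And>i j. ((\<lambda>t. A t $ i $ j) has_real_derivative D $ i $ j) (at 0)" and A0: "A 0 = mat 1"
  shows "((\<lambda>t. lookup (sym_rep (A t) f) \<kappa>) has_vector_derivative
    lookup (lin_vf (cmat D) f) \<kappa>) (at 0)"
proof (induction f arbitrary: \<kappa> rule: pol_induct)
  case (const c)
  show ?case by (simp add: lin_vf_def)
next
  case (add f g)
  have "lin_vf D' (f + g) = lin_vf D' f + lin_vf D' g" for D'
    by (simp add: lin_vf_def pdiff_add distrib_left cscale_add sum.distrib)
  then show ?case
    using has_vector_derivative_add[OF add] by (simp add: sym_rep_add lookup_add)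
next
  case (xvar k f)
  have lk: "lookup (lin_form g k * F) \<kappa> = (\<Sum>i\<in>UNIV. complex_of_real (g $ i $ k) *
      (if lookup \<kappa> i = 0 then 0 else lookup F (\<kappa> - uexp i)))" for g F
    by (simp add: lin_form_def sum_distrib_right mult_cscale lookup_sum lookup_xvar_mult)
  let ?G = "\<lambda>i t. if lookup \<kappa> i = 0 then 0 else lookup (sym_rep (A t) f) (\<kappa> - uexp i)"
  let ?G' = "\<lambda>i. if lookup \<kappa> i = 0 then 0 else lookup (lin_vf (cmat D) f) (\<kappa> - uexp i)"
  let ?H = "\<lambda>i. if lookup \<kappa> i = 0 then 0 else lookup f (\<kappa> - uexp i)"
  have G0: "?G i 0 = ?H i" for i by (simp add: A0)
  have "((\<lambda>t. \<Sum>i\<in>UNIV. complex_of_real (A t $ i $ k) * ?G i t) has_vector_derivative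
      (\<Sum>i\<in>UNIV. complex_of_real (A 0 $ i $ k) * ?G' i + complex_of_real (D $ i $ k) * ?H i)) (at 0)"
    unfolding G0[symmetric]
  proof (intro has_vector_derivative_sum has_vector_derivative_mult)
    fix i
    show "((\<lambda>t. complex_of_real (A t $ i $ k)) has_vector_derivative complex_of_real (D $ i $ k)) (at 0)"
      using A[of i k] by (intro has_vector_derivative_of_real) (simp add: has_real_derivative_iff_has_vector_derivative)
    show "(?G i has_vector_derivative ?G' i) (at 0)"
      using xvar by auto
  qed
  moreover have "(\<Sum>i\<in>UNIV. complex_of_real (A 0 $ i $ k) * ?G' i) =
      lookup (xvar k * lin_vf (cmat D) f) \<kappa>"
  proof -
    have "(\<Sum>i\<in>UNIV. complex_of_real (A 0 $ i $ k) * ?G' i) = (\<Sum>i\<in>UNIV. if i = k then ?G' i else 0)"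
      by (rule sum.cong) (auto simp: A0 mat_def)
    then show ?thesis by (simp add: lookup_xvar_mult)
  qed
  moreover have "(\<Sum>i\<in>UNIV. complex_of_real (D $ i $ k) * ?H i) =
      lookup (\<Sum>i\<in>UNIV. cscale (cmat D $ i $ k) (xvar i * f)) \<kappa>"
    by (simp add: lookup_sum lookup_xvar_mult cmat_def)
  ultimately show ?case
    unfolding sym_rep_xvar lk lin_vf_xvar lookup_add sum.distrib by (simp only:)
qed

section \<open>Irreducibility of the symmetric powers\<close>

text \<open>Two distinct exponents of the same degree differ in opposite directions at two indices \<open>i\<close> and
  \<open>j\<close>; the diagonal matrix with \<open>2\<close> at \<open>i\<close> and \<open>1/2\<close> at \<open>j\<close> tells them apart.\<close>

definition torus2 :: "'m \<Rightarrow> 'm \<Rightarrow> 'm::finite \<Rightarrow> real" where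
  "torus2 i j l = (if l = i then 2 else 1) * (if l = j then 1/2 else 1)"

lemma torus2_SL: "diagm (torus2 i j) \<in> SL"
  by (simp add: SL_def det_diagm torus2_def prod.distrib)

lemma wt_torus2: "wt (torus2 i j) \<kappa> =
  complex_of_real (2 ^ lookup \<kappa> i * (1/2) ^ lookup \<kappa> j)"
proof -
  have "wt (torus2 i j) \<kappa> = complex_of_real (\<Prod>l\<in>UNIV.
      (if l = i then 2 ^ lookup \<kappa> l else 1) * (if l = j then (1/2) ^ lookup \<kappa> l else 1))"
    unfolding wt_def torus2_def of_real_prod
    by (rule prod.cong) (auto simp: power_mult_distrib)
  then show ?thesis by (simp add: prod.distrib)
qed

lemma torus_separates:
  assumes "mdeg \<kappa> = mdeg \<mu>" "\<kappa> \<noteq> \<mu>"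
  obtains t where "diagm t \<in> SL" "wt t \<kappa> \<noteq> wt t \<mu>"
proof -
  have *: "\<exists>i. lookup \<kappa> i > lookup \<mu> i" if "mdeg \<kappa> = mdeg \<mu>" "\<kappa> \<noteq> \<mu>" for \<kappa> \<mu> :: "'a \<Rightarrow>\<^sub>0 nat"
  proof (rule ccontr)
    assume "\<not> ?thesis"
    then have le: "lookup \<kappa> i \<le> lookup \<mu> i" for i
      by (meson not_le)
    have "lookup \<kappa> i = lookup \<mu> i" for i
    proof (rule ccontr)
      assume "lookup \<kappa> i \<noteq> lookup \<mu> i"
      then have "lookup \<kappa> i < lookup \<mu> i" using le[of i] by linarith
      then have "mdeg \<kappa> < mdeg \<mu>"
        unfolding mdeg_def by (intro sum_strict_mono_ex1) (use le in auto)
      then show False using that(1) by simp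
    qed
    then show False using that(2) by (auto intro: poly_mapping_eqI)
  qed
  obtain i j where i: "lookup \<kappa> i > lookup \<mu> i"
      and j: "lookup \<mu> j > lookup \<kappa> j"
    using *[OF assms] *[of \<mu> \<kappa>] assms by auto
  have "(2::real) ^ lookup \<mu> i * (1/2) ^ lookup \<mu> j <
      2 ^ lookup \<kappa> i * (1/2) ^ lookup \<kappa> j"
    using i j by (intro mult_strict_mono power_strict_increasing power_strict_decreasing) auto
  then have "wt (torus2 i j) \<kappa> \<noteq> wt (torus2 i j) \<mu>"
    unfolding wt_torus2 of_real_eq_iff by linarith
  then show ?thesis using that torus2_SL by blast
qed

definition shear :: "'m \<Rightarrow> 'm \<Rightarrow> real \<Rightarrow> real^'m^'m::finite" where
  "shear i j t = (\<chi> k l. (if k = l then 1 else 0) + (if k = i \<and> l = j then t else 0))"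

lemma shear_SL: "i \<noteq> j \<Longrightarrow> shear i j t \<in> SL"
proof -
  assume "i \<noteq> j"
  moreover have "shear i j t = (\<chi> k. if k = i then row i (mat 1) + t *s row j (mat 1) else row k (mat 1))"
    by (auto simp: shear_def vec_eq_iff row_def mat_def)
  ultimately show ?thesis
    by (simp add: SL_def det_row_operation)
qed

text \<open>The allowed moves replace one factor \<open>x\<^sub>j\<close> of a monomial by \<open>x\<^sub>i\<close>; changing the factors one at a time
  reaches every monomial of the same degree.\<close>

lemma exponents_connected:
  assumes "\<And>i j \<mu>. uexp j + \<mu> \<in> K \<Longrightarrow> uexp i + \<mu> \<in> K" "\<kappa> \<in> K" "mdeg \<kappa> = d" "mdeg \<kappa>' = d"
  shows "\<kappa>' \<in> K"
  using assms
proof (induction d arbitrary: K \<kappa> \<kappa>')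
  case 0
  then show ?case by (simp add: mdeg_eq_0_iff)
next
  case (Suc d)
  obtain i j where i: "lookup \<kappa>' i \<noteq> 0" and j: "lookup \<kappa> j \<noteq> 0"
    using Suc.prems(3,4) by (metis mdeg_def sum.neutral nat.distinct(1))
  have "\<kappa>' - uexp i \<in> {\<nu>. uexp i + \<nu> \<in> K}"
  proof (rule Suc.IH)
    show "\<kappa> - uexp j \<in> {\<nu>. uexp i + \<nu> \<in> K}"
      using Suc.prems(1)[of j "\<kappa> - uexp j" i] Suc.prems(2) unit_exponent_decomp[OF j] by simp
    show "mdeg (\<kappa> - uexp j) = d" "mdeg (\<kappa>' - uexp i) = d"
      using mdeg_minus[OF i] mdeg_minus[OF j] Suc.prems by auto
    show "uexp a + \<mu> \<in> {\<nu>. uexp i + \<nu> \<in> K}" if "uexp b + \<mu> \<in> {\<nu>. uexp i + \<nu> \<in> K}" for a b \<mu>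
      using that Suc.prems(1)[of b "uexp i + \<mu>" a] by (simp add: add.left_commute)
  qed
  then show ?case using unit_exponent_decomp[OF i] by simp
qed

text \<open>If \<open>f\<close> has another monomial \<open>\<mu>\<close> of the same degree, a diagonal matrix \<open>t\<close> acts on \<open>\<kappa>\<close> and
  \<open>\<mu>\<close> by different weights; then \<open>t \<cdot> f - wt\<^sub>t(\<mu>) f\<close> still contains \<open>\<kappa>\<close>, but has lost \<open>\<mu>\<close>.
  Induction on the number of monomials leaves \<open>\<kappa>\<close> alone.\<close>

lemma invariant_monomials:
  assumes sub: "module.subspace cscale S" and inv: "\<And>g f. g \<in> SL \<Longrightarrow> f \<in> S \<Longrightarrow> sym_rep g f \<in> S"
    and f: "f \<in> S" "f \<in> coord_space (Xi d)" "\<kappa> \<in> keys f"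
  shows "single \<kappa> 1 \<in> S"
proof -
  interpret m: module "cscale :: complex \<Rightarrow> 'a pol \<Rightarrow> _"
    by standard (auto simp: cscale_add cscale_add_left)
  note sub = sub[unfolded m.subspace_def]
  show ?thesis using f
  proof (induction "card (keys f)" arbitrary: f rule: less_induct)
    case less
    show ?case
    proof (cases "keys f \<subseteq> {\<kappa>}")
      case True
      then have "single \<kappa> 1 = cscale (1 / lookup f \<kappa>) f"
        using less.prems(3) by (intro poly_mapping_eqI) (auto simp: lookup_single when_def in_keys_iff)
      then show ?thesis using sub less.prems by auto
    next
      case False
      then obtain \<mu> where \<mu>: "\<mu> \<in> keys f" "\<mu> \<noteq> \<kappa>" by auto
      then have "mdeg \<kappa> = mdeg \<mu>" using less.prems by (auto simp: coord_space_def Xi_eq)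
      then obtain t where t: "diagm t \<in> SL" "wt t \<kappa> \<noteq> wt t \<mu>"
        using torus_separates \<mu>(2) by metis
      define h where "h = sym_rep (diagm t) f + cscale (- wt t \<mu>) f"
      have lk: "lookup h \<nu> = (wt t \<nu> - wt t \<mu>) * lookup f \<nu>" for \<nu>
        unfolding h_def lookup_add sym_rep_diagm lookup_cscale by (simp only: left_diff_distrib) simp
      show ?thesis
      proof (rule less.hyps[of h])
        have "keys h \<subseteq> keys f - {\<mu>}"
          by (auto simp: in_keys_iff lk)
        then show "card (keys h) < card (keys f)"
          using \<mu> by (meson card_Diff1_less card_mono finite_Diff finite_keys le_less_trans)
        show "h \<in> S" unfolding h_def using sub inv t less.prems by blast
        show "h \<in> coord_space (Xi d)"
          using less.prems(2) by (auto simp: coord_space_iff lk)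
        show "\<kappa> \<in> keys h"
          using less.prems(3) t(2) by (simp add: in_keys_iff lk)
      qed
    qed
  qed
qed

text \<open>The set \<open>K\<close> of monomials in \<open>S\<close> is closed under replacing \<open>x\<^sub>j\<close> by \<open>x\<^sub>i\<close>: the orbit of a monomial
  \<open>x\<^sub>j \<mu>\<close> under the shears \<open>1 + t E\<^sub>i\<^sub>j\<close> has the derivative \<open>x\<^sub>i \<partial>\<^sub>j (x\<^sub>j \<mu>)\<close>, whose coefficient at
  \<open>x\<^sub>i \<mu>\<close> is not zero, while along the orbit that coefficient would vanish if \<open>x\<^sub>i \<mu>\<close> were
  missing from \<open>K\<close>.\<close>

lemma sym_irreducible:
  assumes sub: "module.subspace cscale S" and inv: "\<And>g f. g \<in> SL \<Longrightarrow> f \<in> S \<Longrightarrow> sym_rep g f \<in> S"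
    and S: "S \<subseteq> coord_space (Xi d)" "f0 \<in> S" "f0 \<noteq> (0 :: 'm::finite pol)"
  shows "S = coord_space (Xi d)"
proof -
  interpret m: module "cscale :: complex \<Rightarrow> 'm pol \<Rightarrow> _"
    by standard (auto simp: cscale_add cscale_add_left)
  define K where "K = {\<kappa>. single \<kappa> 1 \<in> S}"
  have mono: "\<kappa> \<in> K" if "f \<in> S" "lookup f \<kappa> \<noteq> 0" for f \<kappa>
    using invariant_monomials[OF sub inv that(1), of d \<kappa>] S that by (auto simp: K_def in_keys_iff)
  obtain \<kappa>0 where k0: "\<kappa>0 \<in> K" using S(2,3) mono by (metis poly_mapping_eqI lookup_zero)
  have degK: "mdeg \<kappa> = d" if "\<kappa> \<in> K" for \<kappa>
    using that S(1) by (auto simp: K_def Pol_iff subset_iff)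
  have "uexp i + \<mu> \<in> K" if K: "uexp j + \<mu> \<in> K" for i j \<mu>
  proof (rule ccontr)
    assume nK: "uexp i + \<mu> \<notin> K"
    then have ij: "i \<noteq> j" using K by auto
    let ?f = "single (uexp j + \<mu>) 1 :: 'm pol"
    let ?D = "(\<chi> k l. if k = i \<and> l = j then 1 else 0) :: real^'m^'m"
    have "((\<lambda>t. lookup (sym_rep (shear i j t) ?f) (uexp i + \<mu>)) has_vector_derivative
      lookup (lin_vf (cmat ?D) ?f) (uexp i + \<mu>)) (at 0)"
    proof (rule sym_rep_derivative)
      show "((\<lambda>t. shear i j t $ a $ b) has_real_derivative ?D $ a $ b) (at 0)" for a b
        by (cases "a = i \<and> b = j") (use ij in \<open>auto simp: shear_def intro!: derivative_eq_intros\<close>)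
    qed (simp add: shear_def mat_def)
    moreover have "(\<lambda>t. lookup (sym_rep (shear i j t) ?f) (uexp i + \<mu>)) = (\<lambda>t. 0)"
    proof
      fix t
      have "sym_rep (shear i j t) ?f \<in> S" using K shear_SL[OF ij] inv by (simp add: K_def)
      then show "lookup (sym_rep (shear i j t) ?f) (uexp i + \<mu>) = 0"
        using mono nK by blast
    qed
    ultimately have "lookup (lin_vf (cmat ?D) ?f) (uexp i + \<mu>) = 0"
      using vector_derivative_unique_at[OF _ has_vector_derivative_const] by fastforce
    moreover have "lin_vf (cmat ?D) ?f = xvar i * pdiff j ?f"
    proof -
      have "lin_vf (cmat ?D) ?f = (\<Sum>a\<in>UNIV. \<Sum>b\<in>UNIV. if a = i then (if b = j then xvar a * pdiff b ?f else 0) else 0)"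
        unfolding lin_vf_def by (intro sum.cong refl) (auto simp: cmat_def)
      also have "\<dots> = (\<Sum>a\<in>UNIV. if a = i then xvar a * pdiff j ?f else 0)"
        by (intro sum.cong refl) simp
      finally show ?thesis by simp
    qed
    moreover have "lookup (xvar i * pdiff j ?f) (uexp i + \<mu>) = of_nat (lookup \<mu> j + 1)"
      by (simp add: lookup_xvar_mult lookup_add pdiff.rep_eq add.commute lookup_single)
    ultimately show False by (metis of_nat_eq_0_iff add_is_0 one_neq_zero)
  qed
  then have KX: "\<kappa> \<in> K" if "mdeg \<kappa> = d" for \<kappa>
    using exponents_connected[of K \<kappa>0 d \<kappa>] k0 degK that by blast
  have "f \<in> S" if "f \<in> coord_space (Xi d)" for f
  proof -
    have "(\<Sum>k\<in>keys f. cscale (lookup f k) (single k 1)) \<in> S"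
      using sub KX that by (intro m.subspace_sum m.subspace_scale) (auto simp: K_def coord_space_def Xi_eq)
    then show ?thesis using poly_mapping_sum_single[of f] by (simp add: cscale_single)
  qed
  then show ?thesis using S(1) by blast
qed

text \<open>The monomial \<open>x\<^sub>i\<^sup>d\<close> is determined up to a scalar by its weights for the diagonal matrices, so \<open>A\<close>
  has it as an eigenvector.  The eigenspace is invariant, hence everything.\<close>

lemma sym_schur:
  fixes A :: "'m::finite pol \<Rightarrow> 'm pol"
  assumes lin: "clinear_on (coord_space (Xi d)) A" and into: "\<And>w. w \<in> coord_space (Xi d) \<Longrightarrow> A w \<in> coord_space (Xi d)"
    and comm: "\<And>g w. g \<in> SL \<Longrightarrow> w \<in> coord_space (Xi d) \<Longrightarrow> A (sym_rep g w) = sym_rep g (A w)"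
  obtains c where "\<And>w. w \<in> coord_space (Xi d) \<Longrightarrow> A w = cscale c w"
proof -
  interpret m: module "cscale :: complex \<Rightarrow> 'm pol \<Rightarrow> _"
    by standard (auto simp: cscale_add cscale_add_left)
  define \<kappa> where "\<kappa> = single (undefined :: 'm) d"
  let ?f = "single \<kappa> 1 :: 'm pol"
  have f: "?f \<in> coord_space (Xi d)" by (simp add: Pol_iff lookup_single when_def \<kappa>_def)
  have A0: "lookup (A ?f) \<mu> = 0" if ne: "\<mu> \<noteq> \<kappa>" for \<mu>
  proof (rule ccontr)
    assume nz: "lookup (A ?f) \<mu> \<noteq> 0"
    then have "mdeg \<kappa> = mdeg \<mu>" using into[OF f] by (auto simp: Pol_iff \<kappa>_def)
    then obtain t where t: "diagm t \<in> SL" "wt t \<kappa> \<noteq> wt t \<mu>"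
      by (rule torus_separates[of \<kappa> \<mu>]) (use ne in auto)
    have "sym_rep (diagm t) ?f = cscale (wt t \<kappa>) ?f"
      by (rule poly_mapping_eqI) (simp add: sym_rep_diagm lookup_single when_def)
    then have "sym_rep (diagm t) (A ?f) = cscale (wt t \<kappa>) (A ?f)"
      using comm[OF t(1) f] lin f by (simp add: clinear_on_def)
    then have "wt t \<mu> * lookup (A ?f) \<mu> = wt t \<kappa> * lookup (A ?f) \<mu>"
      by (metis lookup_cscale sym_rep_diagm)
    then show False using nz t by simp
  qed
  define c where "c = lookup (A ?f) \<kappa>"
  have Af: "A ?f = cscale c ?f"
    by (rule poly_mapping_eqI) (use A0 in \<open>auto simp: lookup_single when_def c_def\<close>)
  define S where "S = {w \<in> coord_space (Xi d). A w = cscale c w}"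
  have "S = coord_space (Xi d)"
  proof (rule sym_irreducible)
    have "A 0 = 0" using lin f unfolding clinear_on_def by (metis cscale_simps(1))
    moreover have "v + w \<in> coord_space (Xi d)" if "v \<in> coord_space (Xi d)" "w \<in> coord_space (Xi d)" for v w :: "'m pol"
      using that keys_add[of v w] by (auto simp: coord_space_def)
    moreover have "cscale a w \<in> coord_space (Xi d)" if "w \<in> coord_space (Xi d)" for a and w :: "'m pol"
      using that by (auto simp: coord_space_iff)
    ultimately show "module.subspace cscale S"
      using lin unfolding m.subspace_def S_def clinear_on_def
      by (auto simp: cscale_add mult.commute coord_space_def)
    show "sym_rep g w \<in> S" if "g \<in> SL" "w \<in> S" for g w
      using that by (auto simp: S_def sym_rep_Pol comm sym_rep_cscale)
    show "?f \<in> S" using f Af by (simp add: S_def)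
    show "?f \<noteq> 0" by (metis lookup_single_eq lookup_zero one_neq_zero)
  qed (auto simp: S_def)
  then show ?thesis using that by (auto simp: S_def)
qed

section \<open>A representation by differential operators\<close>

text \<open>The matrix unit \<open>E\<^sub>a\<^sub>b\<close> acts by \<open>P\<^sub>a Q\<^sub>b\<close>.  This is the action \<open>\<Sum> A\<^sub>a\<^sub>b X\<^sub>a \<partial>/\<partial>X\<^sub>b\<close> on
  homogeneous functions of degree \<open>s\<close> in the coordinates \<open>X\<^sub>0, X\<^sub>1,...,X\<^sub>m\<close>, written in the affine chart
  \<open>X\<^sub>0 = 1\<close>, up to one change: the factor \<open>s - E\<close>, which represents \<open>\<partial>/\<partial>X\<^sub>0\<close> there, is moved from
  \<open>Q\<^sub>0\<close> to \<open>P\<^sub>0\<close>.  The commutation relations survive, and \<open>E\<^sub>i\<^sub>0\<close> becomes multiplication by \<open>x\<^sub>i\<close>, so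
  that \<open>1\<close> generates all polynomials for every \<open>s\<close>.\<close>

fun P_op :: "complex \<Rightarrow> 'm::finite option \<Rightarrow> 'm pol \<Rightarrow> 'm pol" where
  "P_op s None f = deg_op s f"
| "P_op s (Some i) f = xvar i * f"

fun Q_op :: "'m option \<Rightarrow> 'm pol \<Rightarrow> 'm pol" where
  "Q_op None f = f"
| "Q_op (Some j) f = pdiff j f"

definition rho :: "complex \<Rightarrow> complex^('m option)^('m option) \<Rightarrow> 'm::finite pol \<Rightarrow> 'm pol" where
  "rho s A f = (\<Sum>a\<in>UNIV. \<Sum>b\<in>UNIV. cscale (A $ a $ b) (P_op s a (Q_op b f)))"

lemma P_op_add: "P_op s a (f + g) = P_op s a f + P_op s a g"
  by (cases a) (simp_all add: deg_op_add distrib_left)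

lemma P_op_cscale: "P_op s a (cscale c f) = cscale c (P_op s a f)"
  by (cases a) (simp_all add: deg_op_cscale mult_cscale)

lemma Q_op_add: "Q_op a (f + g) = Q_op a f + Q_op a g"
  by (cases a) (simp_all add: pdiff_add)

lemma Q_op_cscale: "Q_op a (cscale c f) = cscale c (Q_op a f)"
  by (cases a) (simp_all add: pdiff_cscale)

lemma deg_op_diff: "deg_op s (f - g) = deg_op s f - deg_op s g"
  by (metis add_diff_cancel_right' diff_add_cancel deg_op_add)

lemma deg_op_0 [simp]: "deg_op s 0 = 0"
  using deg_op_cscale[of s 0 0] by simp

text \<open>These are the commutation relations of matrix units, so \<open>rho\<close> is a representation of all of
  \<open>gl(n)\<close>.  They come down to \<open>[\<partial>\<^sub>j, x\<^sub>i] = \<delta>\<^sub>i\<^sub>j\<close> and to \<open>x\<^sub>i\<close> raising and \<open>\<partial>\<^sub>j\<close> lowering the degree.\<close>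

lemma PQ_commutator:
  "P_op s a (Q_op b (P_op s c (Q_op d f))) - P_op s c (Q_op d (P_op s a (Q_op b f))) =
    (if b = c then P_op s a (Q_op d f) else 0) - (if d = a then P_op s c (Q_op b f) else 0)"
  by (cases a; cases b; cases c; cases d)
    (simp_all add: pdiff_xvar deg_op_xvar deg_op_pdiff pdiff_commute pdiff_add
      deg_op_diff deg_op_add right_diff_distrib distrib_left mult.left_commute)

lemma rho_add: "rho s A (f + g) = rho s A f + rho s A g"
  by (simp add: rho_def Q_op_add P_op_add cscale_add sum.distrib)

lemma rho_cscale: "rho s A (cscale c f) = cscale c (rho s A f)"
  by (simp add: rho_def Q_op_cscale P_op_cscale cscale_sum mult.commute)

lemma rho_add_mat: "rho s (A + B) f = rho s A f + rho s B f"
  by (simp add: rho_def cscale_add_left sum.distrib)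

lemma rho_scale_mat: "rho s (\<chi> i j. c * A $ i $ j) f = cscale c (rho s A f)"
  by (simp add: rho_def cscale_sum)

lemma rho_minus_mat: "rho s (A - B) f = rho s A f - rho s B f"
  by (metis add_diff_cancel_right' diff_add_cancel rho_add_mat)

lemma sum_swap_pairs:
  "(\<Sum>c\<in>C. \<Sum>d\<in>D. \<Sum>a\<in>A. \<Sum>b\<in>B. F a b c d) = (\<Sum>a\<in>A. \<Sum>b\<in>B. \<Sum>c\<in>C. \<Sum>d\<in>D. F a b c d)"
proof -
  have "(\<Sum>c\<in>C. \<Sum>d\<in>D. \<Sum>a\<in>A. \<Sum>b\<in>B. F a b c d) = (\<Sum>c\<in>C. \<Sum>a\<in>A. \<Sum>d\<in>D. \<Sum>b\<in>B. F a b c d)"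
    by (intro sum.cong refl sum.swap)
  also have "\<dots> = (\<Sum>a\<in>A. \<Sum>c\<in>C. \<Sum>d\<in>D. \<Sum>b\<in>B. F a b c d)"
    by (rule sum.swap)
  also have "\<dots> = (\<Sum>a\<in>A. \<Sum>c\<in>C. \<Sum>b\<in>B. \<Sum>d\<in>D. F a b c d)"
    by (intro sum.cong refl sum.swap)
  also have "\<dots> = (\<Sum>a\<in>A. \<Sum>b\<in>B. \<Sum>c\<in>C. \<Sum>d\<in>D. F a b c d)"
    by (intro sum.cong refl sum.swap)
  finally show ?thesis .
qed

lemma rho_bracket: "rho s (A ** B - B ** A) f = rho s A (rho s B f) - rho s B (rho s A f)"
proof -
  let ?R = "\<lambda>a b f. P_op s a (Q_op b f)"
  have R_sum: "?R a b (sum F S) = (\<Sum>x\<in>S. ?R a b (F x))" for a b and F :: "_ \<Rightarrow> 'a pol" and S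
  proof (induction S rule: infinite_finite_induct)
    case (infinite S)
    then show ?case using P_op_cscale[of s a 0 0] Q_op_cscale[of b 0 0] by simp
  next
    case empty
    then show ?case using P_op_cscale[of s a 0 0] Q_op_cscale[of b 0 0] by simp
  qed (simp add: P_op_add Q_op_add)
  have prod: "rho s A (rho s B f) = (\<Sum>a\<in>UNIV. \<Sum>b\<in>UNIV. \<Sum>c\<in>UNIV. \<Sum>d\<in>UNIV.
      cscale (A $ a $ b * B $ c $ d) (?R a b (?R c d f)))" for A B
    by (simp add: rho_def R_sum cscale_sum P_op_cscale Q_op_cscale)
  have prod': "rho s B (rho s A f) = (\<Sum>a\<in>UNIV. \<Sum>b\<in>UNIV. \<Sum>c\<in>UNIV. \<Sum>d\<in>UNIV.
      cscale (A $ a $ b * B $ c $ d) (?R c d (?R a b f)))"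
  proof -
    have "rho s B (rho s A f) = (\<Sum>c\<in>UNIV. \<Sum>d\<in>UNIV. \<Sum>a\<in>UNIV. \<Sum>b\<in>UNIV.
        cscale (A $ a $ b * B $ c $ d) (?R c d (?R a b f)))"
      unfolding prod[of B A] by (simp only: mult.commute)
    also have "\<dots> = (\<Sum>a\<in>UNIV. \<Sum>b\<in>UNIV. \<Sum>c\<in>UNIV. \<Sum>d\<in>UNIV.
        cscale (A $ a $ b * B $ c $ d) (?R c d (?R a b f)))"
      by (rule sum_swap_pairs)
    finally show ?thesis .
  qed
  have "rho s A (rho s B f) - rho s B (rho s A f) = (\<Sum>a\<in>UNIV. \<Sum>b\<in>UNIV. \<Sum>c\<in>UNIV. \<Sum>d\<in>UNIV.
      (if b = c then cscale (A $ a $ b * B $ c $ d) (?R a d f) else 0)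
      - (if d = a then cscale (A $ a $ b * B $ c $ d) (?R c b f) else 0))"
    unfolding prod[of A B] prod' sum_subtractf[symmetric] cscale_diff[symmetric] PQ_commutator
    by (intro sum.cong refl) (auto simp: cscale_diff)
  also have "\<dots> = (\<Sum>a\<in>UNIV. \<Sum>b\<in>UNIV. \<Sum>d\<in>UNIV. cscale (A $ a $ b * B $ b $ d) (?R a d f))
      - (\<Sum>a\<in>UNIV. \<Sum>b\<in>UNIV. \<Sum>c\<in>UNIV. cscale (A $ a $ b * B $ c $ a) (?R c b f))"
  proof -
    have "(\<Sum>c\<in>UNIV. \<Sum>d\<in>UNIV. if b = c then cscale (A $ a $ b * B $ c $ d) (?R a d f) else 0) =
        (\<Sum>d\<in>UNIV. cscale (A $ a $ b * B $ b $ d) (?R a d f))" for a b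
      by (subst sum.swap) simp
    then show ?thesis by (simp add: sum_subtractf)
  qed
  also have "(\<Sum>a\<in>UNIV. \<Sum>b\<in>UNIV. \<Sum>d\<in>UNIV. cscale (A $ a $ b * B $ b $ d) (?R a d f)) = rho s (A ** B) f"
    unfolding rho_def matrix_matrix_mult_def
    by (rule sum.cong, rule refl, subst sum.swap) (simp add: cscale_sum_left)
  also have "(\<Sum>a\<in>UNIV. \<Sum>b\<in>UNIV. \<Sum>c\<in>UNIV. cscale (A $ a $ b * B $ c $ a) (?R c b f)) = rho s (B ** A) f"
  proof -
    have "(\<Sum>a\<in>UNIV. \<Sum>b\<in>UNIV. \<Sum>c\<in>UNIV. cscale (A $ a $ b * B $ c $ a) (?R c b f)) =
       (\<Sum>a\<in>UNIV. \<Sum>c\<in>UNIV. \<Sum>b\<in>UNIV. cscale (A $ a $ b * B $ c $ a) (?R c b f))"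
      by (intro sum.cong refl sum.swap)
    also have "\<dots> = (\<Sum>c\<in>UNIV. \<Sum>a\<in>UNIV. \<Sum>b\<in>UNIV. cscale (A $ a $ b * B $ c $ a) (?R c b f))"
      by (rule sum.swap)
    also have "\<dots> = (\<Sum>c\<in>UNIV. \<Sum>b\<in>UNIV. \<Sum>a\<in>UNIV. cscale (A $ a $ b * B $ c $ a) (?R c b f))"
      by (intro sum.cong refl sum.swap)
    finally show ?thesis
      unfolding rho_def matrix_matrix_mult_def by (simp add: cscale_sum_left mult.commute)
  qed
  finally show ?thesis by (simp add: rho_minus_mat)
qed

lemma sum_option_UNIV: "(\<Sum>a\<in>UNIV. F a) = F None + (\<Sum>i\<in>UNIV. F (Some i))"
  for F :: "'m::finite option \<Rightarrow> 'a::comm_monoid_add"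
  by (simp add: UNIV_option_conv sum.reindex)

text \<open>The four summands are the contributions of the blocks of \<open>A\<close>, with the lower left block belonging
  to \<open>n\<^sub>-\<close> and the upper right block to \<open>n\<^sub>+\<close>.\<close>

lemma rho_expand: "rho s A f = cscale (A $ None $ None) (deg_op s f)
    + (\<Sum>j\<in>UNIV. cscale (A $ None $ Some j) (deg_op s (pdiff j f)))
    + (\<Sum>i\<in>UNIV. cscale (A $ Some i $ None) (xvar i * f))
    + lin_vf (\<chi> i j. A $ Some i $ Some j) f"
  by (simp add: rho_def sum_option_UNIV sum.distrib lin_vf_def algebra_simps)

lemma rho_const: "rho s A (single 0 c) = cscale (s * A $ None $ None) (single 0 c)
    + (\<Sum>i\<in>UNIV. cscale (A $ Some i $ None) (xvar i * single 0 c))"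
  by (simp add: rho_expand deg_op_const lin_vf_def cscale_single mult_ac)

section \<open>The enveloping algebra acting on polynomials\<close>

lemma uea_eqI: "a - b \<in> uea_ideal \<Longrightarrow> abs_uea a = abs_uea b"
  by (simp add: uea.abs_eq_iff uea_rel_def)

lemma uea_of_add: "uea_of (sl_add X Y) = uea_of X + uea_of Y"
  unfolding uea_of_def plus_uea.abs_eq by (rule uea_eqI) (use uea_add[of X Y] in \<open>simp add: diff_diff_add\<close>)

lemma uea_of_scale: "uea_of (sl_scale c X) = uea_const c * uea_of X"
  unfolding uea_of_def uea_const_def times_uea.abs_eq by (rule uea_eqI) (rule uea_scale)

lemma uea_of_bracket: "uea_of X * uea_of Y = uea_of Y * uea_of X + uea_of (sl_bracket X Y)"
proof -
  have "uea_of X * uea_of Y - uea_of Y * uea_of X = uea_of (sl_bracket X Y)"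
    unfolding uea_of_def times_uea.abs_eq minus_uea.abs_eq by (rule uea_eqI) (rule uea_bracket)
  then show ?thesis by (simp add: algebra_simps)
qed

lemma uea_const_add: "uea_const (c + d) = uea_const c + uea_const d"
  by (simp add: uea_const_def plus_uea.abs_eq single_add)

lemma uea_const_mult: "uea_const (c * d) = uea_const c * uea_const d"
  by (simp add: uea_const_def times_uea.abs_eq mult_single)

lemma uea_const_1 [simp]: "uea_const 1 = 1"
  by (simp add: uea_const_def one_uea.abs_eq)

lemma uea_const_0 [simp]: "uea_const 0 = 0"
  by (simp add: uea_const_def zero_uea.abs_eq)

lemma free_const_central: "single 0 c * a = a * single 0 c"
  for a :: "'g list \<Rightarrow>\<^sub>0 complex"
  by (induction a rule: poly_mapping_induct_single) (simp_all add: mult_single algebra_simps)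

lemma uea_const_central: "uea_const c * u = u * uea_const c"
  unfolding uea_const_def
  by (induction u rule: uea.abs_induct) (simp add: times_uea.abs_eq free_const_central)

lemma uea_const_left_commute: "u * (uea_const c * v) = uea_const c * (u * v)"
  by (metis mult.assoc uea_const_central)

lemma uea_induct [case_names const of add]:
  fixes u :: "'m::finite uea"
  assumes const: "\<And>c. P (uea_const c)" and of: "\<And>X u. P u \<Longrightarrow> P (uea_of X * u)"
    and add: "\<And>u v. P u \<Longrightarrow> P v \<Longrightarrow> P (u + v)"
  shows "P u"
proof (induction u rule: uea.abs_induct)
  fix a :: "'m free_alg"
  show "P (abs_uea a)"
  proof (induction a rule: poly_mapping_induct_single)
    case zero
    then show ?case using const[of 0] by (simp add: zero_uea.abs_eq)
  next
    case (single xs c)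
    show ?case
    proof (induction xs)
      case Nil
      then show ?case using const[of c] by (simp add: uea_const_def zero_list_def)
    next
      case (Cons X xs)
      have "single (X # xs) c = letter X * single xs c"
        by (simp add: letter_def mult_single plus_list_def)
      then show ?case using of[OF Cons, of X] by (simp add: uea_of_def times_uea.abs_eq)
    qed
  next
    case (add v w)
    then show ?case using assms(3) by (simp add: plus_uea.abs_eq[symmetric])
  qed
qed

text \<open>The action of the free algebra on polynomials; it factors through the enveloping algebra as \<open>uact\<close>.\<close>

definition free_act :: "complex \<Rightarrow> 'm::finite free_alg \<Rightarrow> 'm pol \<Rightarrow> 'm pol" where
  "free_act s a f = (\<Sum>xs\<in>keys a. cscale (lookup a xs)
    (foldr (\<lambda>X. rho s (mat_of_sl X)) xs f))"

lemma free_act_superset: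
  assumes "finite S" "keys a \<subseteq> S"
  shows "free_act s a f = (\<Sum>xs\<in>S. cscale (lookup a xs)
    (foldr (\<lambda>X. rho s (mat_of_sl X)) xs f))"
  unfolding free_act_def
  by (rule sum.mono_neutral_left) (use assms in \<open>auto simp: in_keys_iff\<close>)

lemma free_act_0 [simp]: "free_act s 0 f = 0"
  by (simp add: free_act_def)

lemma free_act_single: "free_act s (single xs c) f = cscale c (foldr (\<lambda>X. rho s (mat_of_sl X)) xs f)"
  by (simp add: free_act_superset[of "{xs}"])

lemma free_act_add: "free_act s (a + b) f = free_act s a f + free_act s b f"
proof -
  let ?S = "keys a \<union> keys b"
  have "keys (a + b) \<subseteq> ?S" by (rule keys_add)
  then show ?thesis
    by (simp add: free_act_superset[of ?S] lookup_add cscale_add_left sum.distrib)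
qed

lemma free_act_diff: "free_act s (a - b) f = free_act s a f - free_act s b f"
  by (metis add_diff_cancel_right' diff_add_cancel free_act_add)

lemma foldr_rho_add:
  "foldr (\<lambda>X. rho s (mat_of_sl X)) xs (f + g) =
    foldr (\<lambda>X. rho s (mat_of_sl X)) xs f + foldr (\<lambda>X. rho s (mat_of_sl X)) xs g"
  by (induction xs) (simp_all add: rho_add)

lemma foldr_rho_cscale:
  "foldr (\<lambda>X. rho s (mat_of_sl X)) xs (cscale c f) = cscale c (foldr (\<lambda>X. rho s (mat_of_sl X)) xs f)"
  by (induction xs) (simp_all add: rho_cscale)

lemma free_act_add_right: "free_act s a (f + g) = free_act s a f + free_act s a g"
  by (simp add: free_act_def foldr_rho_add cscale_add sum.distrib)

lemma free_act_cscale: "free_act s a (cscale c f) = cscale c (free_act s a f)"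
  by (simp add: free_act_def foldr_rho_cscale cscale_sum mult.commute)

lemma free_act_mult: "free_act s (a * b) f = free_act s a (free_act s b f)"
proof (induction a rule: poly_mapping_induct_single)
  case (single k c)
  show ?case
  proof (induction b rule: poly_mapping_induct_single)
    case zero
    then show ?case using free_act_cscale[of s _ 0 0] by simp
  next
    case (single l d)
    show ?case
      by (simp add: mult_single free_act_single free_act_cscale plus_list_def foldr_rho_cscale mult.commute)
  qed (simp add: distrib_left free_act_add free_act_add_right)
qed (simp_all add: distrib_right free_act_add)

lemma free_act_letter: "free_act s (letter X) f = rho s (mat_of_sl X) f"
  by (simp add: letter_def free_act_single)

lemma free_act_ideal: "a \<in> uea_ideal \<Longrightarrow> free_act s a f = 0"
proof (induction arbitrary: f rule: uea_ideal.induct)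
  case (uea_add X Y)
  then show ?case by (simp add: free_act_diff free_act_letter sl_add.rep_eq rho_add_mat)
next
  case (uea_scale c X)
  then show ?case
    by (simp add: free_act_diff free_act_letter free_act_mult free_act_single zero_list_def sl_scale.rep_eq rho_scale_mat)
next
  case (uea_bracket X Y)
  then show ?case by (simp add: free_act_diff free_act_letter free_act_mult sl_bracket.rep_eq rho_bracket)
next
  case (uea_mult a p q)
  then show ?case using free_act_cscale[of s p 0 0] by (simp add: free_act_mult)
qed (simp add: free_act_add)

lift_definition uact :: "complex \<Rightarrow> 'm::finite uea \<Rightarrow> 'm pol \<Rightarrow> 'm pol" is free_act
proof -
  fix s and a b :: "'m free_alg" assume "uea_rel a b"
  then have "free_act s a f - free_act s b f = 0" for f
    unfolding uea_rel_def free_act_diff[symmetric] by (rule free_act_ideal)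
  then show "free_act s a = free_act s b" by auto
qed

lemma uact_mult: "uact s (u * v) f = uact s u (uact s v f)"
  by transfer (rule free_act_mult)

lemma uact_add: "uact s (u + v) f = uact s u f + uact s v f"
  by transfer (rule free_act_add)

lemma uact_diff: "uact s (u - v) f = uact s u f - uact s v f"
  by (metis add_diff_cancel_right' diff_add_cancel uact_add)

lemma uact_of: "uact s (uea_of X) f = rho s (mat_of_sl X) f"
  by (simp add: uea_of_def uact.abs_eq free_act_letter)

lemma uact_const: "uact s (uea_const c) f = cscale c f"
  by (simp add: uea_const_def uact.abs_eq free_act_single zero_list_def)

lemma uact_zero [simp]: "uact s 0 f = 0"
  using uact_const[of s 0 f] by simp

lemma uact_one [simp]: "uact s 1 f = f"
  using uact_const[of s 1 f] by simp

lemma uact_add_right: "uact s u (f + g) = uact s u f + uact s u g"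
  by transfer (rule free_act_add_right)

lemma uact_cscale: "uact s u (cscale c f) = cscale c (uact s u f)"
  by transfer (rule free_act_cscale)

lemma uact_sum: "uact s (sum u S) f = (\<Sum>x\<in>S. uact s (u x) f)"
  by (induction S rule: infinite_finite_induct) (simp_all add: uact_add)

section \<open>The annihilator of the constant polynomial\<close>

lemma rho_N_minus: "rho s (mat_of_sl (N_minus j)) f = xvar j * f"
proof -
  have n: "mat_of_sl (N_minus j) $ None $ b = 0" "mat_of_sl (N_minus j) $ Some i $ Some k = 0"
      "mat_of_sl (N_minus j) $ Some i $ None = (if i = j then 1 else 0)" for b i k
    by (auto simp: N_minus.rep_eq unit_mat_def)
  have "(\<Sum>i\<in>UNIV. cscale (mat_of_sl (N_minus j) $ Some i $ None) (xvar i * f)) =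
      (\<Sum>i\<in>UNIV. if i = j then xvar i * f else 0)"
    by (rule sum.cong) (auto simp: n)
  then show ?thesis by (simp add: rho_expand n lin_vf_def)
qed

lemma N_minus_commute: "uea_of (N_minus i) * uea_of (N_minus j) = uea_of (N_minus j) * uea_of (N_minus i)"
proof -
  have "sl_bracket (N_minus i) (N_minus j) = sl_scale 0 (N_minus i)"
    by transfer (auto simp: unit_mat_def matrix_matrix_mult_def vec_eq_iff sum.neutral)
  then show ?thesis by (simp add: uea_of_bracket[of "N_minus i"] uea_of_scale)
qed

lemma N_pow_uexp: "N_pow (uexp j + \<kappa>) = uea_of (N_minus j) * N_pow \<kappa>"
proof -
  let ?N = "\<lambda>i. uea_of (N_minus i) :: 'a uea"
  have comm: "?N j * ?N i ^ k = ?N i ^ k * ?N j" for i k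
  proof (induction k)
    case (Suc k)
    have "?N j * ?N i ^ Suc k = ?N i * (?N j * ?N i ^ k)"
      by (simp add: N_minus_commute[of j i] flip: mult.assoc)
    then show ?case by (simp add: Suc mult.assoc)
  qed simp
  have "prod_list (map (\<lambda>i. ?N i ^ lookup (uexp j + \<kappa>) i) js) =
      (if j \<in> set js then ?N j else 1) * prod_list (map (\<lambda>i. ?N i ^ lookup \<kappa> i) js)"
    if "distinct js" for js
    using that
  proof (induction js)
    case (Cons i js)
    show ?case
    proof (cases "i = j")
      case False
      then have "?N i ^ k * (?N j * v) = ?N j * (?N i ^ k * v)" for k v
        using comm[of i k] by (simp only: flip: mult.assoc)
      then show ?thesis using Cons False by (simp add: lookup_add lookup_uexp mult.assoc)
    qed (use Cons in \<open>simp add: lookup_add lookup_uexp mult.assoc\<close>)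
  qed simp
  moreover have "\<exists>js :: 'a list. distinct js \<and> set js = UNIV"
    using finite_distinct_list[of "UNIV :: 'a set"] by auto
  then have "distinct (SOME js :: 'a list. distinct js \<and> set js = UNIV) \<and> set (SOME js :: 'a list. distinct js \<and> set js = UNIV) = UNIV"
    by (rule someI_ex)
  ultimately show ?thesis by (simp add: N_pow_def)
qed

lemma N_pow_zero: "N_pow 0 = 1"
  by (simp add: N_pow_def map_replicate_const)

text \<open>The identification of \<open>S(n\<^sub>-)\<close> with the subalgebra \<open>U(n\<^sub>-)\<close> of the enveloping algebra.\<close>

definition pol_to_uea :: "'m::finite pol \<Rightarrow> 'm uea" where
  "pol_to_uea f = (\<Sum>\<kappa>\<in>keys f. uea_const (lookup f \<kappa>) * N_pow \<kappa>)"

lemma pol_to_uea_superset: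
  assumes "finite S" "keys f \<subseteq> S"
  shows "pol_to_uea f = (\<Sum>\<kappa>\<in>S. uea_const (lookup f \<kappa>) * N_pow \<kappa>)"
  unfolding pol_to_uea_def
  by (rule sum.mono_neutral_left) (use assms in \<open>auto simp: in_keys_iff\<close>)

lemma pol_to_uea_single: "pol_to_uea (single \<kappa> c) = uea_const c * N_pow \<kappa>"
  by (simp add: pol_to_uea_superset[of "{\<kappa>}"])

lemma pol_to_uea_0 [simp]: "pol_to_uea 0 = 0"
  by (simp add: pol_to_uea_def)

lemma pol_to_uea_add: "pol_to_uea (f + g) = pol_to_uea f + pol_to_uea g"
proof -
  let ?S = "keys f \<union> keys g"
  have "keys (f + g) \<subseteq> ?S" by (rule keys_add)
  then show ?thesis
    by (simp add: pol_to_uea_superset[of ?S] lookup_add uea_const_add distrib_right sum.distrib)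
qed

lemma pol_to_uea_cscale: "pol_to_uea (cscale c f) = uea_const c * pol_to_uea f"
  by (induction f rule: poly_mapping_induct_single)
    (simp_all add: cscale_single pol_to_uea_single uea_const_mult mult.assoc cscale_add pol_to_uea_add distrib_left)

lemma pol_to_uea_sum: "pol_to_uea (sum f S) = (\<Sum>x\<in>S. pol_to_uea (f x))"
  by (induction S rule: infinite_finite_induct) (simp_all add: pol_to_uea_add)

lemma pol_to_uea_xvar: "pol_to_uea (xvar i * f) = uea_of (N_minus i) * pol_to_uea f"
  by (induction f rule: poly_mapping_induct_single)
    (simp_all add: xvar_def mult_single pol_to_uea_single N_pow_uexp uea_const_left_commute
       distrib_left pol_to_uea_add)

lemma pol_to_uea_const: "pol_to_uea (single 0 c) = uea_const c"
  by (simp add: pol_to_uea_single N_pow_zero)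

lemma uact_pol_to_uea: "uact s (pol_to_uea f) 1 = f"
proof (induction f rule: pol_induct)
  case (const c)
  show ?case using cscale_single[of c 0 1] by (simp add: pol_to_uea_const uact_const)
next
  case (xvar i f)
  then show ?case by (simp add: pol_to_uea_xvar uact_mult uact_of rho_N_minus)
qed (simp add: pol_to_uea_add uact_add)

definition block_up :: "'m::finite sl \<Rightarrow> bool" where
  "block_up X \<longleftrightarrow> (\<forall>j. mat_of_sl X $ Some j $ None = 0)"

text \<open>The left ideal generated by \<open>X - s X\<^sub>1\<^sub>1\<close>, where \<open>X\<close> runs through the block upper triangular
  matrices; \<open>X \<mapsto> s X\<^sub>1\<^sub>1\<close> is the differential of the character that \<open>M(triv, s)\<close> is induced from.\<close>

inductive_set vac_ideal :: "complex \<Rightarrow> 'm::finite uea set" for s where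
  zero: "0 \<in> vac_ideal s"
| add: "u \<in> vac_ideal s \<Longrightarrow> v \<in> vac_ideal s \<Longrightarrow> u + v \<in> vac_ideal s"
| gen: "block_up X \<Longrightarrow> u * (uea_of X - uea_const (s * mat_of_sl X $ None $ None)) \<in> vac_ideal s"

lemma vac_ideal_left: "u \<in> vac_ideal s \<Longrightarrow> v * u \<in> vac_ideal s"
proof (induction rule: vac_ideal.induct)
  case (gen X u)
  show ?case using vac_ideal.gen[OF gen, of "v * u" s] by (simp only: mult.assoc)
qed (simp_all add: distrib_left vac_ideal.zero vac_ideal.add)

lemma vac_ideal_kills: "u \<in> vac_ideal s \<Longrightarrow> uact s u 1 = 0"
proof (induction rule: vac_ideal.induct)
  case (gen X u)
  have "rho s (mat_of_sl X) 1 = cscale (s * mat_of_sl X $ None $ None) 1"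
    using rho_const[of s "mat_of_sl X" 1] gen by (simp add: block_up_def)
  then show ?case using uact_cscale[of s u 0 0] by (simp add: uact_mult uact_diff uact_of uact_const)
qed (simp_all add: uact_add)

text \<open>Subtracting a combination of the \<open>N\<^sub>j\<^sup>-\<close> makes \<open>X\<close> block upper triangular, where the generators of
  the ideal apply.  The induction clears the entries of the first column one by one.\<close>

lemma uea_of_vacuum:
  "uea_of X - (uea_const (s * mat_of_sl X $ None $ None)
    + (\<Sum>j\<in>UNIV. uea_const (mat_of_sl X $ Some j $ None) * uea_of (N_minus j))) \<in> vac_ideal s"
proof -
  have "uea_of X - (uea_const (s * mat_of_sl X $ None $ None)
    + (\<Sum>j\<in>S. uea_const (mat_of_sl X $ Some j $ None) * uea_of (N_minus j))) \<in> vac_ideal s"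
    if "finite S" "\<forall>j. j \<notin> S \<longrightarrow> mat_of_sl X $ Some j $ None = 0" for S and X :: "'a sl"
    using that
  proof (induction S arbitrary: X)
    case empty
    then show ?case using vac_ideal.gen[of X 1 s] by (simp add: block_up_def)
  next
    case (insert j S)
    define c where "c = mat_of_sl X $ Some j $ None"
    define Y where "Y = sl_add X (sl_scale (- c) (N_minus j))"
    have Y0: "mat_of_sl Y $ None $ None = mat_of_sl X $ None $ None"
      by (simp add: Y_def sl_add.rep_eq sl_scale.rep_eq N_minus.rep_eq unit_mat_def)
    have Yi: "mat_of_sl Y $ Some i $ None = (if i = j then 0 else mat_of_sl X $ Some i $ None)" for i
      by (simp add: Y_def sl_add.rep_eq sl_scale.rep_eq N_minus.rep_eq unit_mat_def c_def)
    have "uea_of X = uea_of Y + uea_const c * uea_of (N_minus j)"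
    proof -
      have "uea_const (- c) + uea_const c = (0 :: 'a uea)" using uea_const_add[of "- c" c] by simp
      then have "uea_const (- c) * uea_of (N_minus j) + uea_const c * uea_of (N_minus j) = (0 :: 'a uea)"
        by (simp flip: distrib_right)
      then show ?thesis by (simp add: Y_def uea_of_add uea_of_scale add.assoc)
    qed
    moreover have "(\<Sum>i\<in>S. uea_const (mat_of_sl Y $ Some i $ None) * uea_of (N_minus i)) =
        (\<Sum>i\<in>S. uea_const (mat_of_sl X $ Some i $ None) * uea_of (N_minus i) :: 'a uea)"
      using insert.hyps by (intro sum.cong) (auto simp: Yi)
    moreover have "uea_of Y - (uea_const (s * mat_of_sl Y $ None $ None)
      + (\<Sum>i\<in>S. uea_const (mat_of_sl Y $ Some i $ None) * uea_of (N_minus i))) \<in> vac_ideal s"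
      using insert by (intro insert.IH) (auto simp: Yi)
    ultimately show ?case using insert.hyps by (simp add: Y0 algebra_simps flip: c_def)
  qed
  from this[of UNIV X] show ?thesis by simp
qed

text \<open>Moving \<open>X\<close> to the right past the factors \<open>N\<^sub>j\<^sup>-\<close> costs the commutators \<open>[X, N\<^sub>j\<^sup>-]\<close>, in \<open>U(g)\<close> and in
  the polynomial model alike; so the induction on \<open>f\<close> has to be over all \<open>X\<close> at once.\<close>

lemma uea_of_pol_to_uea:
  "uea_of X * pol_to_uea f - pol_to_uea (rho s (mat_of_sl X) f) \<in> vac_ideal s"
proof (induction f arbitrary: X rule: pol_induct)
  case (const c)
  have shift: "uea_const d * uea_of Y * uea_const c = uea_const (c * d) * uea_of Y" for d and Y :: "'a sl"
    by (metis mult.assoc uea_const_central uea_const_mult)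
  have "uea_const c * (uea_of X - (uea_const (s * mat_of_sl X $ None $ None)
    + (\<Sum>j\<in>UNIV. uea_const (mat_of_sl X $ Some j $ None) * uea_of (N_minus j)))) \<in> vac_ideal s"
    by (intro vac_ideal_left uea_of_vacuum)
  also have "uea_const c * (uea_of X - (uea_const (s * mat_of_sl X $ None $ None)
    + (\<Sum>j\<in>UNIV. uea_const (mat_of_sl X $ Some j $ None) * uea_of (N_minus j)))) =
    uea_of X * pol_to_uea (single 0 c) - pol_to_uea (rho s (mat_of_sl X) (single 0 c))"
    unfolding rho_const pol_to_uea_add pol_to_uea_sum pol_to_uea_cscale pol_to_uea_xvar pol_to_uea_const
      right_diff_distrib distrib_left sum_distrib_left
    by (simp add: shift mult.commute[of s] uea_const_central[of c "uea_of X"] flip: uea_const_mult mult.assoc)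
      (simp add: mult_ac)
  finally show ?case .
next
  case (xvar j f)
  let ?N = "N_minus j" and ?r = "\<lambda>X. rho s (mat_of_sl X)"
  have "?r X (xvar j * f) = xvar j * ?r X f + ?r (sl_bracket X ?N) f"
    by (simp add: sl_bracket.rep_eq rho_bracket rho_N_minus)
  then have "uea_of X * pol_to_uea (xvar j * f) - pol_to_uea (?r X (xvar j * f)) =
     uea_of ?N * (uea_of X * pol_to_uea f - pol_to_uea (?r X f)) +
     (uea_of (sl_bracket X ?N) * pol_to_uea f - pol_to_uea (?r (sl_bracket X ?N) f))"
    using uea_of_bracket[of X ?N]
    by (simp add: pol_to_uea_xvar pol_to_uea_add right_diff_distrib distrib_right flip: mult.assoc)
  then show ?case
    using vac_ideal.add[OF vac_ideal_left[OF xvar[of X]] xvar[of "sl_bracket X ?N"]] by simp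
next
  case (add f g)
  then show ?case using vac_ideal.add[OF add(1)[of X] add(2)[of X]]
    by (simp add: rho_add pol_to_uea_add distrib_left algebra_simps)
qed

text \<open>Modulo the ideal, every element of the enveloping algebra lies in \<open>S(n\<^sub>-)\<close>, and the polynomial that
  represents it can be read off from the action on \<open>1\<close>.\<close>

lemma uea_reduce: "u - pol_to_uea (uact s u 1) \<in> vac_ideal s"
proof (induction u rule: uea_induct)
  case (const c)
  have "cscale c (1 :: 'a pol) = single 0 c" using cscale_single[of c 0 1] by simp
  then show ?case using vac_ideal.zero by (simp add: uact_const pol_to_uea_const)
next
  case (of X u)
  have "uea_of X * (u - pol_to_uea (uact s u 1)) +
     (uea_of X * pol_to_uea (uact s u 1) - pol_to_uea (rho s (mat_of_sl X) (uact s u 1))) \<in> vac_ideal s"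
    by (intro vac_ideal.add vac_ideal_left of uea_of_pol_to_uea)
  then show ?case by (simp add: uact_mult uact_of right_diff_distrib)
next
  case (add u v)
  then show ?case using vac_ideal.add[OF add] by (simp add: uact_add pol_to_uea_add algebra_simps)
qed

lemma vac_ideal_iff: "u \<in> vac_ideal s \<longleftrightarrow> uact s u 1 = 0"
  using uea_reduce[of u s] vac_ideal_kills[of u s] by auto

section \<open>The matrix exponential\<close>

lemma mat_power_bound:
  fixes X :: "real^'n^'n::finite"
  assumes "\<And>i j. \<bar>X $ i $ j\<bar> \<le> B"
  shows "\<bar>mat_power X k $ i $ j\<bar> \<le> (real CARD('n) * B) ^ k"
proof (induction k arbitrary: i j)
  case 0
  show ?case by (simp add: mat_def)
next
  case (Suc k)
  have B: "0 \<le> B" using assms[of i j] by linarith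
  have "\<bar>mat_power X (Suc k) $ i $ j\<bar> \<le> (\<Sum>l\<in>UNIV. \<bar>X $ i $ l\<bar> * \<bar>mat_power X k $ l $ j\<bar>)"
    by (simp add: matrix_matrix_mult_def flip: abs_mult)
  also have "\<dots> \<le> (\<Sum>l\<in>(UNIV::'n set). B * (real CARD('n) * B) ^ k)"
    by (intro sum_mono mult_mono assms Suc) (use B in auto)
  finally show ?case by simp
qed

lemma mat_power_scaleR: "mat_power (t *\<^sub>R X) k = t ^ k *\<^sub>R mat_power X k"
  by (induction k) (simp_all add: vec_eq_iff matrix_matrix_mult_def sum_distrib_left mult_ac)

lemma mat_power_norm_summable: "summable (\<lambda>k. norm (mat_power X k $ i $ j / fact k))"
proof -
  define B where "B = (\<Sum>i\<in>UNIV. \<Sum>j\<in>UNIV. \<bar>X $ i $ j\<bar>)"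
  have "\<bar>X $ i $ j\<bar> \<le> B" for i j
  proof -
    have "\<bar>X $ i $ j\<bar> \<le> (\<Sum>j\<in>UNIV. \<bar>X $ i $ j\<bar>)" by (rule member_le_sum) auto
    also have "\<dots> \<le> B" unfolding B_def
      by (rule member_le_sum[of i UNIV "\<lambda>i. \<Sum>j\<in>UNIV. \<bar>X $ i $ j\<bar>"]) (auto intro: sum_nonneg)
    finally show ?thesis .
  qed
  then have b: "\<bar>mat_power X k $ i $ j\<bar> \<le> (real CARD('a) * B) ^ k" for k
    by (rule mat_power_bound)
  show ?thesis
  proof (rule summable_comparison_test)
    show "summable (\<lambda>k. (real CARD('a) * B) ^ k / fact k)"
      using summable_exp[of "real CARD('a) * B"] by (simp add: field_simps)
    show "\<exists>N. \<forall>k\<ge>N. norm (norm (mat_power X k $ i $ j / fact k)) \<le> (real CARD('a) * B) ^ k / fact k"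
      using b by (auto intro!: divide_right_mono)
  qed
qed

lemma mat_power_summable: "summable (\<lambda>k. mat_power X k $ i $ j / fact k)"
  by (rule summable_norm_cancel[OF mat_power_norm_summable])

lemma mat_exp_sums:
  "(\<lambda>k. (1 / fact k) *\<^sub>R mat_power X k) sums (\<chi> i j. suminf (\<lambda>k. mat_power X k $ i $ j / fact k))"
  unfolding sums_def
proof (intro vec_tendstoI)
  fix i j
  show "((\<lambda>n. (\<Sum>k<n. (1 / fact k) *\<^sub>R mat_power X k) $ i $ j) \<longlongrightarrow>
      (\<chi> i j. suminf (\<lambda>k. mat_power X k $ i $ j / fact k)) $ i $ j) sequentially"
    using summable_LIMSEQ[OF mat_power_summable[of X i j]] by simp
qed

lemma mat_exp_nth: "mat_exp X $ i $ j = (suminf (\<lambda>k. mat_power X k $ i $ j / fact k))"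
  unfolding mat_exp_def using sums_unique[OF mat_exp_sums[of X]] by (metis (mono_tags, lifting) vec_lambda_beta)

lemma mat_exp_derivative_at:
  "((\<lambda>t. mat_exp (t *\<^sub>R X) $ i $ j) has_real_derivative
    suminf (\<lambda>k. diffs (\<lambda>k. mat_power X k $ i $ j / fact k) k * t ^ k)) (at t)"
proof -
  let ?c = "\<lambda>k. mat_power X k $ i $ j / fact k"
  have eq: "mat_exp (t *\<^sub>R X) $ i $ j = suminf (\<lambda>k. ?c k * t ^ k)" for t
    by (simp add: mat_exp_nth mat_power_scaleR mult.commute)
  show ?thesis unfolding eq
  proof (rule termdiffs_strong_converges_everywhere)
    fix t :: real
    show "summable (\<lambda>k. ?c k * t ^ k)"
      using mat_power_summable[of "t *\<^sub>R X" i j] by (simp add: mat_power_scaleR mult.commute)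
  qed
qed

lemma mat_exp_derivative: "((\<lambda>t. mat_exp (t *\<^sub>R X) $ i $ j) has_real_derivative X $ i $ j) (at 0)"
proof -
  have "suminf (\<lambda>k. diffs (\<lambda>k. mat_power X k $ i $ j / fact k) k * 0 ^ k) = X $ i $ j"
    by (subst powser_zero) (simp add: diffs_def)
  then show ?thesis using mat_exp_derivative_at[of X i j 0] by simp
qed

lemma mat_exp_continuous: "continuous_on UNIV (\<lambda>t. mat_exp (t *\<^sub>R X) $ i $ j)"
  using mat_exp_derivative_at by (intro continuous_at_imp_continuous_on ballI DERIV_isCont)

lemma mat_power_add: "mat_power X (a + b) = mat_power X a ** mat_power X b"
  by (induction a) (simp_all add: matrix_mul_assoc)

text \<open>The Cauchy product of the two exponential series, entry by entry, with the binomial theorem.\<close>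

lemma mat_exp_add: "mat_exp ((s + t) *\<^sub>R X) = mat_exp (s *\<^sub>R X) ** mat_exp (t *\<^sub>R X)"
proof -
  have "mat_exp ((s + t) *\<^sub>R X) $ i $ j = (mat_exp (s *\<^sub>R X) ** mat_exp (t *\<^sub>R X)) $ i $ j" for i j
  proof -
    let ?a = "\<lambda>l k. mat_power (s *\<^sub>R X) k $ i $ l / fact k"
    let ?b = "\<lambda>l k. mat_power (t *\<^sub>R X) k $ l $ j / fact k"
    have prod: "(\<Sum>l\<in>UNIV. ?a l n * ?b l (k - n)) = (of_nat (k choose n) * s ^ n * t ^ (k - n)) * (mat_power X k $ i $ j / fact k)"
      if "n \<le> k" for k n
    proof -
      have "mat_power X k $ i $ j = (\<Sum>l\<in>UNIV. mat_power X n $ i $ l * mat_power X (k - n) $ l $ j)"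
        using mat_power_add[of X n "k - n"] that by (simp add: matrix_matrix_mult_def)
      then have "(\<Sum>l\<in>UNIV. ?a l n * ?b l (k - n)) = s ^ n * t ^ (k - n) * mat_power X k $ i $ j / (fact n * fact (k - n))"
        by (simp add: mat_power_scaleR sum_distrib_left sum_divide_distrib mult_ac)
      then show ?thesis by (simp add: binomial_fact[OF that])
    qed
    have "(mat_exp (s *\<^sub>R X) ** mat_exp (t *\<^sub>R X)) $ i $ j = (\<Sum>l\<in>UNIV. suminf (?a l) * suminf (?b l))"
      by (simp add: matrix_matrix_mult_def mat_exp_nth)
    also have "\<dots> = (\<Sum>l\<in>UNIV. suminf (\<lambda>k. \<Sum>n\<le>k. ?a l n * ?b l (k - n)))"
      by (intro sum.cong refl Cauchy_product mat_power_norm_summable)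
    also have "\<dots> = suminf (\<lambda>k. \<Sum>l\<in>UNIV. \<Sum>n\<le>k. ?a l n * ?b l (k - n))"
      by (rule suminf_sum[symmetric]) (intro summable_Cauchy_product mat_power_norm_summable)
    also have "(\<lambda>k. \<Sum>l\<in>UNIV. \<Sum>n\<le>k. ?a l n * ?b l (k - n)) = (\<lambda>k. mat_power ((s + t) *\<^sub>R X) k $ i $ j / fact k)"
    proof
      fix k
      have "(\<Sum>l\<in>UNIV. \<Sum>n\<le>k. ?a l n * ?b l (k - n)) = (\<Sum>n\<le>k. \<Sum>l\<in>UNIV. ?a l n * ?b l (k - n))"
        by (rule sum.swap)
      also have "\<dots> = (\<Sum>n\<le>k. (of_nat (k choose n) * s ^ n * t ^ (k - n)) * (mat_power X k $ i $ j / fact k))"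
        by (intro sum.cong refl prod) simp
      also have "\<dots> = (s + t) ^ k * (mat_power X k $ i $ j / fact k)"
        by (simp only: binomial_ring[of s t k] sum_distrib_right)
      finally show "(\<Sum>l\<in>UNIV. \<Sum>n\<le>k. ?a l n * ?b l (k - n)) = mat_power ((s + t) *\<^sub>R X) k $ i $ j / fact k"
        by (simp add: mat_power_scaleR)
    qed
    finally show ?thesis by (simp add: mat_exp_nth)
  qed
  then show ?thesis by (simp add: vec_eq_iff)
qed

lemma mat_exp_conj:
  assumes "p ** q = mat 1" "q ** p = mat 1"
  shows "mat_exp (p ** X ** q) = p ** mat_exp X ** q"
proof -
  have pow: "mat_power (p ** X ** q) k = p ** mat_power X k ** q" for k
  proof (induction k)
    case (Suc k)
    have "mat_power (p ** X ** q) (Suc k) = p ** X ** (q ** p) ** mat_power X k ** q"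
      by (simp only: mat_power.simps Suc matrix_mul_assoc)
    then show ?case by (simp add: assms matrix_mul_assoc)
  qed (simp add: assms)
  have "linear (\<lambda>A. p ** A ** q)"
    by (rule linearI)
      (simp_all add: vec_eq_iff matrix_matrix_mult_def sum.distrib distrib_left distrib_right sum_distrib_left sum_distrib_right mult_ac)
  then have "bounded_linear (\<lambda>A. p ** A ** q)" by (simp add: linear_conv_bounded_linear)
  from bounded_linear.suminf[OF this sums_summable[OF mat_exp_sums[of X]]]
  have "p ** mat_exp X ** q = suminf (\<lambda>k. p ** ((1 / fact k) *\<^sub>R mat_power X k) ** q)"
    by (simp add: mat_exp_def)
  also have "(\<lambda>k. p ** ((1 / fact k) *\<^sub>R mat_power X k) ** q) = (\<lambda>k. (1 / fact k) *\<^sub>R mat_power (p ** X ** q) k)"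
    using linear_scale[OF \<open>linear _\<close>] by (auto simp: pow)
  finally show ?thesis by (simp add: mat_exp_def)
qed

lemma mat_exp_nilpotent:
  assumes "X ** X = 0"
  shows "mat_exp X = mat 1 + X"
proof -
  have "mat_power X k $ i $ j / fact k = (if k = 0 then mat 1 $ i $ j else 0) + (if k = 1 then X $ i $ j else 0)" for k i j
  proof (cases k)
    case (Suc l)
    have z: "X ** (X ** B) = 0" for B
      by (simp add: matrix_mul_assoc assms)
    show ?thesis using Suc by (cases l) (simp_all add: z)
  qed simp
  moreover have "(\<lambda>k::nat. (if k = 0 then mat 1 $ i $ j else 0) + (if k = 1 then X $ i $ j else 0)) sums (mat 1 $ i $ j + X $ i $ j)" for i j
    using sums_single[of 0 "\<lambda>_. mat 1 $ i $ j"] sums_single[of 1 "\<lambda>_. X $ i $ j"] by (intro sums_add) simp_all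
  ultimately show ?thesis
    by (simp add: vec_eq_iff mat_exp_nth sums_unique[symmetric])
qed

lemma mat_exp_0 [simp]: "mat_exp 0 = mat 1"
  using mat_exp_nilpotent[of 0] by simp

lemma diagm_mult: "diagm d ** A = (\<chi> i j. d i * A $ i $ j)"
proof -
  have "(\<Sum>l\<in>UNIV. (if i = l then d i else 0) * A $ l $ j) = (\<Sum>l\<in>UNIV. if i = l then d i * A $ i $ j else 0)" for i j
    by (rule sum.cong) auto
  then show ?thesis by (simp add: vec_eq_iff matrix_matrix_mult_def diagm_def)
qed

lemma mat_exp_diagm: "mat_exp (diagm d) = diagm (\<lambda>i. exp (d i))"
proof -
  have "mat_power (diagm d) k = diagm (\<lambda>i. d i ^ k)" for k
  proof (induction k)
    case (Suc k)
    show ?case by (simp add: Suc diagm_mult) (simp add: diagm_def vec_eq_iff)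
  qed (simp add: diagm_def mat_def)
  then show ?thesis
    by (auto simp: vec_eq_iff mat_exp_nth diagm_def exp_def field_simps)
qed

section \<open>Block upper triangular matrices\<close>

definition mk_block :: "'a \<Rightarrow> 'a^'m \<Rightarrow> 'a^'m^'m \<Rightarrow> 'a::zero^('m option)^('m::finite option)" where
  "mk_block a b D = (\<chi> i j. case (i, j) of (None, None) \<Rightarrow> a | (None, Some l) \<Rightarrow> b $ l
    | (Some k, None) \<Rightarrow> 0 | (Some k, Some l) \<Rightarrow> D $ k $ l)"

lemma mk_block_nth [simp]:
  "mk_block a b D $ None $ None = a" "mk_block a b D $ None $ Some l = b $ l"
  "mk_block a b D $ Some k $ None = 0" "mk_block a b D $ Some k $ Some l = D $ k $ l"
  by (simp_all add: mk_block_def)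

lemma option_mat_eqI:
  assumes "A $ None $ None = B $ None $ None" "\<And>l. A $ None $ Some l = B $ None $ Some l"
    "\<And>k. A $ Some k $ None = B $ Some k $ None" "\<And>k l. A $ Some k $ Some l = B $ Some k $ Some l"
  shows "A = B"
  unfolding vec_eq_iff
proof (intro allI)
  fix i j show "A $ i $ j = B $ i $ j" by (cases i; cases j) (simp_all add: assms)
qed

lemma mk_block_inject: "mk_block a b D = mk_block a' b' D' \<longleftrightarrow> a = a' \<and> b = b' \<and> D = D'"
  by (metis mk_block_nth vec_eq_iff)

lemma mk_block_mult:
  "mk_block a b D ** mk_block a' b' D' =
    mk_block (a * a') (\<chi> l. a * b' $ l + (\<Sum>k\<in>UNIV. b $ k * D' $ k $ l)) (D ** D')"
  by (rule option_mat_eqI) (simp_all add: matrix_matrix_mult_def sum_option_UNIV)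

lemma mk_block_one: "mat 1 = mk_block 1 0 (mat 1)"
  by (rule option_mat_eqI) (simp_all add: mat_def)

lemma M_elem_block: "M_elem g = mk_block (inverse (det g)) 0 g"
  by (rule option_mat_eqI) (simp_all add: M_elem_def)

lemma A_elem_block: "A_elem t = mk_block (exp t) 0 (exp (- t / real CARD('m)) *\<^sub>R (mat 1 :: real^'m^'m::finite))"
proof -
  have "t *\<^sub>R (H0 :: real^('m option)^('m option)) =
      diagm (\<lambda>i. case i of None \<Rightarrow> t | Some _ \<Rightarrow> - t / real CARD('m))"
    by (rule option_mat_eqI) (simp_all add: H0_def diagm_def)
  then show ?thesis unfolding A_elem_def
    by (simp only: mat_exp_diagm) (rule option_mat_eqI; simp add: diagm_def mat_def)
qed

lemma N_elem_block: "N_elem x = mk_block 1 x (mat 1)"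
proof -
  have Y: "(\<Sum>j\<in>UNIV. (x $ j) *\<^sub>R unit_mat None (Some j)) = mk_block 0 x (0 :: real^'a^'a)"
  proof (rule option_mat_eqI)
    fix l
    have "(\<Sum>j\<in>UNIV. ((x $ j) *\<^sub>R (unit_mat None (Some j) :: real^('a option)^('a option))) $ None $ Some l) =
        (\<Sum>j\<in>UNIV. if j = l then x $ j else 0)"
      by (rule sum.cong) (auto simp: unit_mat_def)
    then show "(\<Sum>j\<in>UNIV. (x $ j) *\<^sub>R (unit_mat None (Some j) :: real^('a option)^('a option))) $ None $ Some l =
        mk_block 0 x 0 $ None $ Some l"
      by simp
  qed (simp_all add: unit_mat_def)
  have "mk_block 0 x (0 :: real^'a^'a) ** mk_block 0 x 0 = 0"
    by (rule option_mat_eqI) (simp_all add: matrix_matrix_mult_def sum_option_UNIV)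
  then have "N_elem x = mat 1 + mk_block 0 x (0 :: real^'a^'a)"
    unfolding N_elem_def Y by (rule mat_exp_nilpotent)
  also have "\<dots> = mk_block 1 x (mat 1)"
    by (rule option_mat_eqI) (simp_all add: mat_def)
  finally show ?thesis .
qed

lemma det_scaleR: "det (c *\<^sub>R g) = c ^ CARD('m) * det (g :: real^'m^'m::finite)"
  unfolding scaleR_eq_diagm(2) det_mul det_diagm by simp

lemma MAN_block:
  fixes g :: "real^'m^'m::finite"
  shows "M_elem g ** A_elem t ** N_elem x = mk_block (inverse (det g) * exp t)
    ((inverse (det g) * exp t) *\<^sub>R x) (exp (- t / real CARD('m)) *\<^sub>R g)"
proof -
  have "g ** (c *\<^sub>R mat 1) = c *\<^sub>R g" for c
    unfolding scaleR_eq_diagm(2)[of c "mat 1"] scaleR_eq_diagm(1)[of c g] by simp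
  then show ?thesis
    unfolding M_elem_block A_elem_block N_elem_block mk_block_mult mk_block_inject
    by simp (simp add: vec_eq_iff)
qed

text \<open>In the decomposition \<open>p = M_elem g ** A_elem t ** N_elem x\<close> the upper left entry is
  \<open>a = det(g)\<^sup>-\<^sup>1 e\<^sup>t\<close>, whence \<open>t = ln \<bar>a\<bar>\<close> and \<open>g = e\<^sup>t\<^sup>/\<^sup>m D\<close>.\<close>

lemma block_MAN:
  fixes D :: "real^'m^'m::finite"
  assumes "a * det D = 1"
  shows "exp (ln \<bar>a\<bar> / real CARD('m)) *\<^sub>R D \<in> SLpm"
    "det (exp (ln \<bar>a\<bar> / real CARD('m)) *\<^sub>R D) = sgn a"
    "mk_block a b D = M_elem (exp (ln \<bar>a\<bar> / real CARD('m)) *\<^sub>R D) ** A_elem (ln \<bar>a\<bar>) ** N_elem (inverse a *\<^sub>R b)"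
proof -
  have a: "a \<noteq> 0" using assms by auto
  have "exp (ln \<bar>a\<bar> / real CARD('m)) ^ CARD('m) = \<bar>a\<bar>"
    using a by (simp flip: exp_of_nat_mult)
  moreover have "det D = inverse a" using assms a by (simp add: field_simps)
  ultimately show d: "det (exp (ln \<bar>a\<bar> / real CARD('m)) *\<^sub>R D) = sgn a"
    using a by (simp add: det_scaleR sgn_if abs_if)
  then show "exp (ln \<bar>a\<bar> / real CARD('m)) *\<^sub>R D \<in> SLpm"
    using a by (auto simp: SLpm_def sgn_if)
  have "inverse (sgn a) * exp (ln \<bar>a\<bar>) = a" using a by (auto simp: sgn_if abs_if)
  then show "mk_block a b D = M_elem (exp (ln \<bar>a\<bar> / real CARD('m)) *\<^sub>R D) ** A_elem (ln \<bar>a\<bar>) ** N_elem (inverse a *\<^sub>R b)"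
    using a by (simp add: MAN_block d flip: exp_add)
qed

lemma P_grp_eq: "(P_grp :: (real^('m option)^('m::finite option)) set) = {mk_block a b D | a b D. a * det D = 1}"
proof (intro equalityI subsetI)
  fix p :: "real^('m option)^('m option)" assume "p \<in> P_grp"
  then obtain g :: "real^'m^'m" and t x where g: "g \<in> SLpm" and p: "p = M_elem g ** A_elem t ** N_elem x"
    by (auto simp: P_grp_def)
  have "exp (- t / real CARD('m)) ^ CARD('m) = exp (- t)"
    by (simp flip: exp_of_nat_mult)
  then have "(inverse (det g) * exp t) * det (exp (- t / real CARD('m)) *\<^sub>R g) = 1"
    using g by (auto simp: det_scaleR SLpm_def exp_minus)
  then show "p \<in> {mk_block a b D | a b D. a * det D = 1}"
    unfolding p MAN_block by blast
next
  fix p :: "real^('m option)^('m option)" assume "p \<in> {mk_block a b D | a b D. a * det D = 1}"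
  then obtain a b and D :: "real^'m^'m" where D: "a * det D = 1" and p: "p = mk_block a b D" by blast
  show "p \<in> P_grp"
    unfolding P_grp_def p using block_MAN(1)[OF D] block_MAN(3)[OF D, of b] by blast
qed

lemma P_grp_mult: "p \<in> P_grp \<Longrightarrow> q \<in> P_grp \<Longrightarrow> p ** q \<in> P_grp"
proof -
  assume "p \<in> P_grp" "q \<in> P_grp"
  then obtain a b D a' b' D' where p: "p = mk_block a b D" "a * det D = 1" and q: "q = mk_block a' b' D'" "a' * det D' = 1"
    unfolding P_grp_eq by blast
  have "(a * a') * det (D ** D') = 1" using p q by (simp add: det_mul algebra_simps)
  then show ?thesis unfolding P_grp_eq p q mk_block_mult by blast
qed

lemma P_grp_one: "mat 1 \<in> P_grp"
proof -
  have "1 * det (mat 1 :: real^'a^'a) = 1" by simp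
  then show ?thesis unfolding P_grp_eq mk_block_one by blast
qed

lemma P_grp_inverse:
  assumes "p \<in> P_grp"
  obtains q where "q \<in> P_grp" "p ** q = mat 1" "q ** p = mat 1"
proof -
  obtain a b D where p: "p = mk_block a b D" "a * det D = 1" using assms unfolding P_grp_eq by blast
  then have "invertible D" "a \<noteq> 0" by (auto simp: invertible_det_nz)
  then obtain E where E: "D ** E = mat 1" "E ** D = mat 1" unfolding invertible_def by blast
  define c where "c = (\<chi> l. - inverse a * (\<Sum>k\<in>UNIV. b $ k * E $ k $ l))"
  let ?q = "mk_block (inverse a) c E"
  have "det D * det E = 1" using det_mul[of D E] E by (simp add: det_I)
  then have "inverse a * det E = 1" using p(2) \<open>a \<noteq> 0\<close>
    by (metis inverse_unique mult.commute mult.left_commute mult_1_right right_inverse)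
  then have "?q \<in> P_grp" unfolding P_grp_eq by blast
  moreover have "p ** ?q = mat 1"
    using \<open>a \<noteq> 0\<close> unfolding p mk_block_mult E mk_block_one mk_block_inject c_def by (simp add: vec_eq_iff)
  moreover have "(\<Sum>k\<in>UNIV. (\<Sum>j\<in>UNIV. b $ j * E $ j $ k) * D $ k $ l) = b $ l" for l
  proof -
    have "(\<Sum>k\<in>UNIV. (\<Sum>j\<in>UNIV. b $ j * E $ j $ k) * D $ k $ l) = (\<Sum>j\<in>UNIV. b $ j * (E ** D) $ j $ l)"
      by (simp add: matrix_matrix_mult_def sum_distrib_left sum_distrib_right mult.assoc) (rule sum.swap)
    also have "\<dots> = (\<Sum>j\<in>UNIV. if j = l then b $ j else 0)"
      unfolding E by (rule sum.cong) (auto simp: mat_def)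
    finally show ?thesis by simp
  qed
  then have "?q ** p = mat 1"
    using \<open>a \<noteq> 0\<close> unfolding p mk_block_mult E mk_block_one mk_block_inject c_def
    by (simp add: vec_eq_iff mult.assoc sum_negf flip: sum_distrib_left)
  ultimately show ?thesis using that by blast
qed

lemma Ad_sl_mat:
  assumes "p ** q = mat 1" "q ** p = mat 1"
  shows "mat_of_sl (Ad_sl p X) = cmat p ** mat_of_sl X ** cmat q"
proof -
  have "invertible p" using assms unfolding invertible_def by blast
  moreover have "matrix_inv p ** p = mat 1"
    using assms unfolding matrix_inv_def by (metis (mono_tags, lifting) someI_ex)
  then have "matrix_inv p = q" using assms by (metis matrix_mul_assoc matrix_mul_lid matrix_mul_rid)
  ultimately show ?thesis by (simp add: Ad_sl.rep_eq)
qed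

lemma block_up_mult:
  fixes A B :: "complex^('m::finite option)^('m option)"
  assumes "\<forall>j. A $ Some j $ None = 0" "\<forall>j. B $ Some j $ None = 0"
  shows "\<forall>j. (A ** B) $ Some j $ None = 0" "(A ** B) $ None $ None = A $ None $ None * B $ None $ None"
  using assms by (simp_all add: matrix_matrix_mult_def sum_option_UNIV)

lemma P_grp_block: "p \<in> P_grp \<Longrightarrow> \<forall>j. cmat p $ Some j $ None = 0"
  by (auto simp: P_grp_eq cmat_def)

text \<open>For block upper triangular matrices the upper left entry is multiplicative, hence invariant under
  conjugation.\<close>

lemma Ad_block_up:
  assumes "p \<in> P_grp" "block_up X"
  shows "block_up (Ad_sl p X)" "mat_of_sl (Ad_sl p X) $ None $ None = mat_of_sl X $ None $ None"
proof -
  obtain q where q: "q \<in> P_grp" "p ** q = mat 1" "q ** p = mat 1" using P_grp_inverse assms by blast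
  note b = P_grp_block[OF assms(1)] assms(2)[unfolded block_up_def] P_grp_block[OF q(1)]
  have "cmat p $ None $ None * cmat q $ None $ None = 1"
    unfolding block_up_mult(2)[OF b(1,3), symmetric] cmat_mult[symmetric] q(2) by (simp add: cmat_def mat_def)
  moreover note block_up_mult[OF block_up_mult(1)[OF b(1,2)] b(3)] block_up_mult[OF b(1,2)]
  ultimately show "block_up (Ad_sl p X)" "mat_of_sl (Ad_sl p X) $ None $ None = mat_of_sl X $ None $ None"
    unfolding Ad_sl_mat[OF q(2,3)] block_up_def by simp_all
qed

lemma real_lie_P_Ad:
  assumes "Y \<in> real_lie_P" "p \<in> P_grp" "q \<in> P_grp" "p ** q = mat 1" "q ** p = mat 1"
  shows "p ** Y ** q \<in> real_lie_P"
proof -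
  have "t *\<^sub>R (p ** Y ** q) = p ** (t *\<^sub>R Y) ** q" for t
    by (simp add: vec_eq_iff matrix_matrix_mult_def sum_distrib_left sum_distrib_right mult_ac)
  then show ?thesis
    using assms by (simp add: real_lie_P_def mat_exp_conj P_grp_mult)
qed

lemma Ad_lie_p:
  assumes "X \<in> lie_p" "p \<in> P_grp"
  shows "Ad_sl p X \<in> lie_p"
proof -
  obtain q where q: "q \<in> P_grp" "p ** q = mat 1" "q ** p = mat 1" using P_grp_inverse assms by blast
  have "Re_mat (cmat p ** A ** cmat q) = p ** Re_mat A ** q" "Im_mat (cmat p ** A ** cmat q) = p ** Im_mat A ** q" for A
    by (simp_all add: vec_eq_iff Re_mat_def Im_mat_def cmat_def matrix_matrix_mult_def Re_sum Im_sum)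
  then show ?thesis
    using assms q by (simp add: lie_p_def Ad_sl_mat[OF q(2,3)] real_lie_P_Ad)
qed

text \<open>The entries of the one-parameter subgroup are differentiable at \<open>0\<close> with the entries of \<open>Y\<close> as
  derivatives.  As the lower left block vanishes along the curve, it vanishes for \<open>Y\<close>.\<close>

lemma real_lie_P_curve:
  assumes "Y \<in> real_lie_P"
  obtains a b D where "\<And>t. mat_exp (t *\<^sub>R Y) = mk_block (a t) (b t) (D t)" "\<And>t. a t * det (D t) = 1"
    "a 0 = 1" "D 0 = mat 1" "(a has_real_derivative Y $ None $ None) (at 0)"
    "\<And>i j. ((\<lambda>t. D t $ i $ j) has_real_derivative Y $ Some i $ Some j) (at 0)"
    "\<And>i. Y $ Some i $ None = 0"
proof -
  have "\<forall>t. \<exists>a b D. mat_exp (t *\<^sub>R Y) = mk_block a b D \<and> a * det D = 1"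
    using assms unfolding real_lie_P_def P_grp_eq by blast
  then obtain a b D where e: "mat_exp (t *\<^sub>R Y) = mk_block (a t) (b t) (D t)" and d: "a t * det (D t) = 1" for t
    by metis
  have 0: "mk_block (a 0) (b 0) (D 0) = mk_block 1 0 (mat 1)"
    using e[of 0] by (simp add: mk_block_one)
  note der = mat_exp_derivative[of Y, unfolded e]
  have "Y $ Some i $ None = 0" for i
    using DERIV_unique[OF der[of "Some i" None, simplified] DERIV_const] by simp
  then show ?thesis
    using that[OF e d] 0 der[of None None] der[of "Some _" "Some _"] by (simp add: mk_block_inject)
qed

lemma cmat_Re_Im: "X = cmat (Re_mat X) + (\<chi> i j. \<i> * cmat (Im_mat X) $ i $ j)"
  by (simp add: vec_eq_iff cmat_def Re_mat_def Im_mat_def complex_eq)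

lemma lie_p_block_up:
  assumes "X \<in> lie_p"
  shows "block_up X"
proof -
  have "Re_mat (mat_of_sl X) $ Some j $ None = 0" "Im_mat (mat_of_sl X) $ Some j $ None = 0" for j
    using assms by (auto simp: lie_p_def elim!: real_lie_P_curve)
  then show ?thesis by (simp add: block_up_def Re_mat_def Im_mat_def complex_eq_iff)
qed

section \<open>Generators of the parabolic subalgebra\<close>

text \<open>For \<open>a = Some j\<close> the matrix unit is corrected to have trace zero.  The exponentials of these
  matrices are explicit, as each is diagonal or has square zero, so that they visibly lie in \<open>P\<close>.\<close>

lift_definition gen_p :: "'m option \<Rightarrow> 'm::finite \<Rightarrow> 'm sl" is
  "\<lambda>a j. if a = Some j then unit_mat (Some j) (Some j) - unit_mat None None else unit_mat a (Some j)"
proof -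
  fix a :: "'m option" and j :: 'm
  show "trace (if a = Some j then unit_mat (Some j) (Some j) - unit_mat None None
      else unit_mat a (Some j) :: complex^('m option)^('m option)) = 0"
    by (auto simp: trace_def unit_mat_def sum_option_UNIV intro!: sum.neutral)
qed

lemma gen_p_lie_p: "gen_p a (j :: 'm::finite) \<in> lie_p"
proof -
  define Y :: "real^('m option)^('m option)" where "Y = (if a = Some j then unit_mat (Some j) (Some j) - unit_mat None None else unit_mat a (Some j))"
  have "mat_exp (t *\<^sub>R Y) \<in> P_grp" for t
  proof (cases "a = Some j")
    case True
    then have "t *\<^sub>R Y = diagm (\<lambda>i. if i = None then - t else if i = Some j then t else 0)"
      by (intro option_mat_eqI) (simp_all add: Y_def unit_mat_def diagm_def)
    then have "mat_exp (t *\<^sub>R Y) = mk_block (exp (- t)) 0 (diagm (\<lambda>i. if i = j then exp t else 1))"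
      by (simp only: mat_exp_diagm) (rule option_mat_eqI; simp add: diagm_def)
    moreover have "exp (- t) * det (diagm (\<lambda>i. if i = j then exp t else 1) :: real^'m^'m) = 1"
      by (simp add: det_diagm flip: exp_add)
    ultimately show ?thesis unfolding P_grp_eq by blast
  next
    case False
    have "(t *\<^sub>R Y) ** (t *\<^sub>R Y) = 0"
      using False by (auto simp: Y_def unit_mat_def matrix_matrix_mult_def vec_eq_iff intro!: sum.neutral)
    then have e: "mat_exp (t *\<^sub>R Y) = mat 1 + t *\<^sub>R Y" by (rule mat_exp_nilpotent)
    show ?thesis
    proof (cases a)
      case None
      have "mat_exp (t *\<^sub>R Y) = mk_block 1 (\<chi> l. if l = j then t else 0) (mat 1)"
        unfolding e using None by (intro option_mat_eqI) (auto simp: Y_def unit_mat_def mat_def)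
      moreover have "1 * det (mat 1 :: real^'m^'m) = 1" by simp
      ultimately show ?thesis unfolding P_grp_eq by blast
    next
      case (Some i)
      have "mat_exp (t *\<^sub>R Y) = mk_block 1 0 (shear i j t)"
        unfolding e using Some False by (intro option_mat_eqI) (auto simp: Y_def unit_mat_def mat_def shear_def)
      moreover have "1 * det (shear i j t) = 1" using shear_SL[of i j t] Some False by (simp add: SL_def)
      ultimately show ?thesis unfolding P_grp_eq by blast
    qed
  qed
  then have "Y \<in> real_lie_P" by (simp add: real_lie_P_def)
  moreover have "Re_mat (mat_of_sl (gen_p a j)) = Y"
    by (auto simp: gen_p.rep_eq Y_def Re_mat_def unit_mat_def vec_eq_iff)
  moreover have "Im_mat (mat_of_sl (gen_p a j)) = 0"
    by (auto simp: gen_p.rep_eq Im_mat_def unit_mat_def vec_eq_iff)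
  moreover have "(0 :: real^('m option)^('m option)) \<in> real_lie_P"
    by (simp add: real_lie_P_def P_grp_one)
  ultimately show ?thesis by (simp add: lie_p_def)
qed

text \<open>The matrices \<open>gen_p a j\<close> span the block upper triangular ones; the induction clears the entries
  outside the first column one by one, and the remaining corner entry is zero by the trace.  As
  \<open>gen_p a j\<close> lies in \<open>p\<close>, this reaches all block upper triangular matrices without computing their
  exponentials.\<close>

lemma block_up_induct [consumes 1, case_names gen add scale]:
  fixes X :: "'m::finite sl"
  assumes "block_up X" and gen: "\<And>a j. P (gen_p a j)"
    and add: "\<And>X Y. block_up X \<Longrightarrow> block_up Y \<Longrightarrow> P X \<Longrightarrow> P Y \<Longrightarrow> P (sl_add X Y)"
    and scale: "\<And>c X. block_up X \<Longrightarrow> P X \<Longrightarrow> P (sl_scale c X)"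
  shows "P X"
proof -
  have "P X" if "finite S" "block_up X" "\<forall>a j. (a, j) \<notin> S \<longrightarrow> mat_of_sl X $ a $ Some j = 0"
    for S :: "('m option \<times> 'm) set" and X
    using that
  proof (induction S arbitrary: X)
    case empty
    have "trace (mat_of_sl X) = 0" using mat_of_sl[of X] by simp
    then have "mat_of_sl X $ None $ None = 0" using empty by (simp add: trace_def sum_option_UNIV)
    then have "mat_of_sl X = mat_of_sl (sl_scale 0 (gen_p None undefined))"
      using empty by (intro option_mat_eqI) (simp_all add: sl_scale.rep_eq block_up_def)
    then have "X = sl_scale 0 (gen_p None undefined)" by (simp add: mat_of_sl_inject)
    then show ?case using scale gen lie_p_block_up[OF gen_p_lie_p] by metis
  next
    case (insert e S)
    obtain a j where e: "e = (a, j)" by (cases e)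
    define c where "c = mat_of_sl X $ a $ Some j"
    define Y where "Y = sl_add X (sl_scale (- c) (gen_p a j))"
    have X: "X = sl_add Y (sl_scale c (gen_p a j))"
      unfolding Y_def by transfer (simp add: vec_eq_iff)
    have bg: "block_up (gen_p a j)" "block_up (sl_scale d (gen_p a j))" for d
      using lie_p_block_up[OF gen_p_lie_p, of a j] by (simp_all add: block_up_def sl_scale.rep_eq)
    have bY: "block_up Y" using insert.prems(1) bg by (simp add: Y_def block_up_def sl_add.rep_eq)
    have "\<forall>a' j'. (a', j') \<notin> S \<longrightarrow> mat_of_sl Y $ a' $ Some j' = 0"
      using insert.prems(2) by (auto simp: Y_def sl_add.rep_eq sl_scale.rep_eq gen_p.rep_eq unit_mat_def c_def e)
    then have "P Y" using insert.IH bY by blast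
    then show ?case unfolding X using add bY bg scale gen by blast
  qed
  from this[of UNIV X] show ?thesis using assms(1) by simp
qed

section \<open>Representations of the parabolic subgroup and their differentials\<close>

text \<open>The character \<open>sgn(a)\<^sup>\<alpha> \<bar>a\<bar>\<^sup>s\<close> of the multiplicative group of \<open>\<real>\<close>.  On \<open>P\<close> it is evaluated at the
  upper left entry \<open>a\<close>, which combines the characters of \<open>M\<close> and of \<open>A\<close>.\<close>

definition sgn_pow :: "int \<Rightarrow> complex \<Rightarrow> real \<Rightarrow> complex" where
  "sgn_pow \<alpha> s a = (if \<alpha> = 1 then 1 else complex_of_real (sgn a)) * exp (s * complex_of_real (ln \<bar>a\<bar>))"

text \<open>The factors \<open>g\<close> and \<open>t\<close> of the decomposition are determined by \<open>a\<close> and \<open>D\<close>, so the description in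
  the definition of \<open>P_rep\<close> has a unique value.\<close>

lemma P_rep_sgn_pow:
  fixes D :: "real^'m^'m::finite"
  assumes "a * det D = 1"
  shows "P_rep \<alpha> \<sigma> \<nu> (mk_block a b D) w =
    cscale (sgn_pow \<alpha> \<nu> a)
      (\<sigma> (exp (ln \<bar>a\<bar> / real CARD('m)) *\<^sub>R D) w)"
proof -
  let ?g = "exp (ln \<bar>a\<bar> / real CARD('m)) *\<^sub>R D"
  have a: "a \<noteq> 0" using assms by auto
  have u: "g = ?g \<and> t = ln \<bar>a\<bar>" if "g \<in> SLpm" "mk_block a b D = M_elem g ** A_elem t ** N_elem x" for g t x
  proof -
    have e: "a = inverse (det g) * exp t" "D = exp (- t / real CARD('m)) *\<^sub>R g"
      using that(2) by (simp_all add: MAN_block mk_block_inject)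
    have "\<bar>a\<bar> = exp t" using that(1) by (auto simp: e(1) SLpm_def abs_mult)
    then have t: "t = ln \<bar>a\<bar>" by simp
    have "?g = (exp (t / real CARD('m)) * exp (- t / real CARD('m))) *\<^sub>R g"
      unfolding e(2) t[symmetric] by simp
    moreover have "exp (t / real CARD('m)) * exp (- t / real CARD('m)) = 1"
      by (simp add: exp_minus)
    ultimately have "?g = g" by (simp only: scaleR_one)
    then show ?thesis unfolding t by (rule conjI[OF sym refl])
  qed
  have s: "sign_char \<alpha> ?g * exp (\<nu> * complex_of_real (ln \<bar>a\<bar>)) = sgn_pow \<alpha> \<nu> a"
    by (simp add: sign_char_def sgn_pow_def block_MAN(2)[OF assms])
  show ?thesis unfolding P_rep_def
  proof (rule the_equality)
    show "\<exists>g t x. g \<in> SLpm \<and> mk_block a b D = M_elem g ** A_elem t ** N_elem x \<and>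
      cscale (sgn_pow \<alpha> \<nu> a) (\<sigma> ?g w) =
      cscale (sign_char \<alpha> g * exp (\<nu> * complex_of_real t)) (\<sigma> g w)"
      unfolding s[symmetric]
      by (rule exI[of _ ?g], rule exI[of _ "ln \<bar>a\<bar>"], rule exI[of _ "inverse a *\<^sub>R b"],
        rule conjI[OF block_MAN(1)[OF assms] conjI[OF block_MAN(3)[OF assms, of b] refl]])
  next
    fix v
    assume "\<exists>g t x. g \<in> SLpm \<and> mk_block a b D = M_elem g ** A_elem t ** N_elem x \<and>
      v = cscale (sign_char \<alpha> g * exp (\<nu> * complex_of_real t)) (\<sigma> g w)"
    then obtain g t x where g: "g \<in> SLpm" "mk_block a b D = M_elem g ** A_elem t ** N_elem x"
      and v: "v = cscale (sign_char \<alpha> g * exp (\<nu> * complex_of_real t)) (\<sigma> g w)" by blast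
    show "v = cscale (sgn_pow \<alpha> \<nu> a) (\<sigma> ?g w)"
      unfolding v s[symmetric] using u[OF g] by simp
  qed
qed

lemma P_rep_triv: "a * det D = 1 \<Longrightarrow> P_rep \<alpha> triv_rep s (mk_block a b D) w = cscale (sgn_pow \<alpha> s a) w"
  by (simp add: P_rep_sgn_pow triv_rep_def)

text \<open>By homogeneity the rescaling \<open>g = \<bar>a\<bar>\<^sup>1\<^sup>/\<^sup>m D\<close> contributes the power \<open>\<bar>a\<bar>\<^sup>k\<^sup>/\<^sup>m\<close>.\<close>

lemma P_rep_sym:
  fixes D :: "real^'m^'m::finite"
  assumes "a * det D = 1" "w \<in> coord_space (Xi k)"
  shows "P_rep \<beta> sym_rep r (mk_block a b D) w =
    cscale (sgn_pow \<beta> (r + of_nat k / of_nat CARD('m)) a) (sym_rep D w)"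
proof -
  let ?L = "complex_of_real (ln \<bar>a\<bar>)" and ?m = "of_nat CARD('m) :: complex"
  have "complex_of_real (exp (ln \<bar>a\<bar> / real CARD('m))) ^ k = exp (of_nat k * (?L / ?m))"
    by (simp only: exp_of_nat_mult) (simp add: exp_of_real[symmetric])
  then have "exp (r * ?L) * complex_of_real (exp (ln \<bar>a\<bar> / real CARD('m))) ^ k = exp ((r + of_nat k / ?m) * ?L)"
    by (simp only: exp_add[symmetric]) (simp add: algebra_simps)
  then have "sgn_pow \<beta> r a * complex_of_real (exp (ln \<bar>a\<bar> / real CARD('m))) ^ k = sgn_pow \<beta> (r + of_nat k / ?m) a"
    unfolding sgn_pow_def mult.assoc by (simp only:)
  then show ?thesis
    unfolding P_rep_sgn_pow[OF assms(1)] sym_rep_scaleR[OF assms(2)] cscale_cscale by (simp only:)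
qed

lemma sgn_pow_derivative:
  assumes "a 0 = 1" "(a has_real_derivative a') (at 0)"
  shows "((\<lambda>t. sgn_pow \<alpha> s (a t)) has_vector_derivative s * complex_of_real a') (at 0)"
proof -
  have "((\<lambda>t. complex_of_real (ln (a t))) has_vector_derivative complex_of_real a') (at 0)"
    using assms by (intro has_vector_derivative_of_real) (auto intro!: derivative_eq_intros)
  then have 1: "((\<lambda>t. s * complex_of_real (ln (a t))) has_vector_derivative s * complex_of_real a') (at 0)"
    by (rule has_vector_derivative_mult_right)
  have "((\<lambda>z. exp z) has_field_derivative exp (s * complex_of_real (ln (a 0)))) (at (s * complex_of_real (ln (a 0))))"
    by (rule DERIV_exp)
  from field_vector_diff_chain_at[OF 1 this]
  have 2: "((\<lambda>t. exp (s * complex_of_real (ln (a t)))) has_vector_derivative s * complex_of_real a') (at 0)"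
    by (simp add: o_def assms(1))
  have "isCont a 0" using assms(2) DERIV_isCont by blast
  then have "(a \<longlongrightarrow> 1) (at 0)" using assms(1) by (simp add: isCont_def)
  then have "eventually (\<lambda>t. a t > 0) (at 0)" by (rule order_tendstoD) simp
  then have "eventually (\<lambda>t. a t > 0) (nhds 0)"
    using assms(1) by (simp add: eventually_at_filter) (auto elim!: eventually_mono)
  then have "eventually (\<lambda>t. t \<in> UNIV \<longrightarrow> exp (s * complex_of_real (ln (a t))) = sgn_pow \<alpha> s (a t)) (nhds 0)"
    by eventually_elim (simp add: sgn_pow_def)
  from has_vector_derivative_cong_ev[OF this] 2 assms(1) show ?thesis
    by (simp add: sgn_pow_def)
qed

lemma sgn_pow_1 [simp]: "sgn_pow \<alpha> s 1 = 1"
  by (simp add: sgn_pow_def)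

lemma real_differentialI:
  assumes "\<And>i. ((\<lambda>t. lookup (\<pi> (mat_exp (t *\<^sub>R X)) w) i) has_vector_derivative lookup F i) (at 0)"
  shows "real_differential \<pi> X w = F"
proof -
  have "vector_derivative (\<lambda>t. lookup (\<pi> (mat_exp (t *\<^sub>R X)) w) i) (at 0) = lookup F i" for i
    using assms by (rule vector_derivative_at)
  then show ?thesis by (simp add: real_differential_def lookup_inverse)
qed

lemma differential_triv:
  assumes "X \<in> lie_p"
  shows "differential (P_rep \<alpha> triv_rep s) X w = cscale (s * mat_of_sl X $ None $ None) w"
proof -
  have rd: "real_differential (P_rep \<alpha> triv_rep s) Y w = cscale (s * complex_of_real (Y $ None $ None)) w"
    if Y: "Y \<in> real_lie_P" for Y :: "real^('m::finite option)^('m option)"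
  proof (rule real_differentialI)
    obtain a b D where e: "\<And>t. mat_exp (t *\<^sub>R Y) = mk_block (a t) (b t) (D t)" "\<And>t. a t * det (D t) = 1"
        "a 0 = 1" "(a has_real_derivative Y $ None $ None) (at 0)"
      using Y by (rule real_lie_P_curve) blast
    show "((\<lambda>t. lookup (P_rep \<alpha> triv_rep s (mat_exp (t *\<^sub>R Y)) w) i) has_vector_derivative
        lookup (cscale (s * complex_of_real (Y $ None $ None)) w) i) (at 0)" for i
      using has_vector_derivative_mult_left[OF sgn_pow_derivative[of a, OF e(3,4)]]
      by (simp add: e(1) P_rep_triv[OF e(2)])
  qed
  have "mat_of_sl X $ None $ None = complex_of_real (Re_mat (mat_of_sl X) $ None $ None)
      + \<i> * complex_of_real (Im_mat (mat_of_sl X) $ None $ None)"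
    by (simp add: Re_mat_def Im_mat_def complex_eq)
  then show ?thesis
    using assms by (simp add: differential_def lie_p_def rd distrib_left mult_ac flip: cscale_add_left)
qed

text \<open>For \<open>s = k - 1\<close> the operator \<open>s - E\<close> is \<open>-1\<close> in degree \<open>k\<close> and \<open>0\<close> in degree \<open>k - 1\<close>.  The second
  kills the operators \<open>(s - E) \<partial>\<^sub>j\<close> of \<open>n\<^sub>+\<close>: this is where the condition on \<open>s\<close> comes from.\<close>

lemma rho_Pol:
  assumes w: "w \<in> coord_space (Xi k)" and A: "\<And>i. A $ Some i $ None = 0"
  shows "rho (of_nat k - 1) A w = lin_vf (\<chi> i j. A $ Some i $ Some j) w - cscale (A $ None $ None) w"
proof -
  have "deg_op (of_nat k - 1) w = - w"
  proof (rule poly_mapping_eqI)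
    fix \<kappa>
    show "lookup (deg_op (of_nat k - 1) w) \<kappa> = lookup (- w) \<kappa>"
      using w by (cases "lookup w \<kappa> = 0") (simp_all add: deg_op.rep_eq Pol_iff)
  qed
  moreover have "deg_op (of_nat k - 1) (pdiff j w) = 0" for j
  proof (rule poly_mapping_eqI)
    fix \<kappa>
    have "mdeg \<kappa> + 1 = k" if "lookup w (\<kappa> + uexp j) \<noteq> 0"
      using w that by (auto simp: Pol_iff mdeg_add)
    then show "lookup (deg_op (of_nat k - 1) (pdiff j w)) \<kappa> = lookup 0 \<kappa>"
      by (auto simp: deg_op.rep_eq pdiff.rep_eq)
  qed
  moreover have "cscale c (- w) = - cscale c w" for c by (rule poly_mapping_eqI) simp
  ultimately show ?thesis by (simp add: rho_expand A)
qed

lemma coord_space_closed: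
  fixes v w :: "'i \<Rightarrow>\<^sub>0 complex"
  shows "0 \<in> (coord_space I :: ('i \<Rightarrow>\<^sub>0 complex) set)"
    "v \<in> coord_space I \<Longrightarrow> w \<in> coord_space I \<Longrightarrow> v + w \<in> coord_space I"
    "v \<in> coord_space I \<Longrightarrow> w \<in> coord_space I \<Longrightarrow> v - w \<in> coord_space I"
    "v \<in> coord_space I \<Longrightarrow> cscale c v \<in> coord_space I"
  by (auto simp: coord_space_iff lookup_add lookup_minus) (metis add.right_neutral)+

lemma lin_vf_Pol:
  assumes "w \<in> coord_space (Xi k)"
  shows "lin_vf D w \<in> coord_space (Xi k)"
proof -
  have "xvar i * pdiff j w \<in> coord_space (Xi k)" for i j
    unfolding Pol_iff
  proof (intro allI impI)
    fix \<kappa> assume "lookup (xvar i * pdiff j w) \<kappa> \<noteq> 0"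
    then have i: "lookup \<kappa> i \<noteq> 0" and "lookup w (\<kappa> - uexp i + uexp j) \<noteq> 0"
      by (auto simp: lookup_xvar_mult pdiff.rep_eq split: if_splits)
    then have "mdeg (\<kappa> - uexp i + uexp j) = k" using assms by (simp add: Pol_iff)
    then show "mdeg \<kappa> = k" using mdeg_minus[OF i] by (simp add: mdeg_add)
  qed
  moreover have S: "sum f S \<in> coord_space (Xi k)" if "\<And>x. x \<in> S \<Longrightarrow> f x \<in> coord_space (Xi k)" for f :: "_ \<Rightarrow> 'a pol" and S
    using that by (induction S rule: infinite_finite_induct) (auto intro: coord_space_closed)
  ultimately show ?thesis unfolding lin_vf_def by (intro S coord_space_closed)
qed

lemma rho_Pol_closed:
  assumes "w \<in> coord_space (Xi k)" "block_up X"
  shows "rho (of_nat k - 1) (mat_of_sl X) w \<in> coord_space (Xi k)"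
  using assms by (simp add: rho_Pol block_up_def lin_vf_Pol coord_space_closed)

text \<open>With this \<open>r\<close> the exponent \<open>r + k/m\<close> of \<open>P_rep_sym\<close> is \<open>-1\<close>, in agreement with \<open>rho_Pol\<close>.  So
  the polynomials of degree \<open>k\<close> carry the inducing representation inside the scalar module.\<close>

lemma differential_sym:
  fixes X :: "'m::finite sl"
  assumes X: "X \<in> lie_p" and w: "w \<in> coord_space (Xi k)"
    and r: "r = - (1 + of_nat k / of_nat CARD('m))"
  shows "differential (P_rep \<beta> sym_rep r) X w = rho (of_nat k - 1) (mat_of_sl X) w"
proof -
  have rd: "real_differential (P_rep \<beta> sym_rep r) Y w = rho (of_nat k - 1) (cmat Y) w"
    if Y: "Y \<in> real_lie_P" for Y :: "real^('m option)^('m option)"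
  proof (rule real_differentialI)
    obtain a b D where e: "\<And>t. mat_exp (t *\<^sub>R Y) = mk_block (a t) (b t) (D t)" "\<And>t. a t * det (D t) = 1"
        "a 0 = 1" "D 0 = mat 1" "(a has_real_derivative Y $ None $ None) (at 0)"
        "\<And>i j. ((\<lambda>t. D t $ i $ j) has_real_derivative Y $ Some i $ Some j) (at 0)" "\<And>i. Y $ Some i $ None = 0"
      using Y by (rule real_lie_P_curve) blast
    let ?D = "(\<chi> i j. Y $ Some i $ Some j) :: real^'m^'m"
    have r1: "r + of_nat k / of_nat CARD('m) = - 1" by (simp add: r)
    have D': "((\<lambda>t. lookup (sym_rep (D t) w) \<kappa>) has_vector_derivative
        lookup (lin_vf (cmat ?D) w) \<kappa>) (at 0)" for \<kappa>
      by (rule sym_rep_derivative) (simp_all add: e(4,6))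
    have "rho (of_nat k - 1) (cmat Y) w = lin_vf (cmat ?D) w - cscale (complex_of_real (Y $ None $ None)) w"
      using rho_Pol[OF w, of "cmat Y"] e(7) by (simp add: cmat_def)
    then show "((\<lambda>t. lookup (P_rep \<beta> sym_rep r (mat_exp (t *\<^sub>R Y)) w) \<kappa>) has_vector_derivative
        lookup (rho (of_nat k - 1) (cmat Y) w) \<kappa>) (at 0)" for \<kappa>
      using has_vector_derivative_mult[OF sgn_pow_derivative[of a, OF e(3,5), of \<beta> "- 1"] D'[of \<kappa>]]
      by (simp add: e(1) P_rep_sym[OF e(2) w] r1 e(3,4) lookup_minus)
  qed
  have "differential (P_rep \<beta> sym_rep r) X w = rho (of_nat k - 1)
      (cmat (Re_mat (mat_of_sl X)) + (\<chi> i j. \<i> * cmat (Im_mat (mat_of_sl X)) $ i $ j)) w"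
    using X by (simp only: differential_def lie_p_def rd mem_Collect_eq rho_add_mat rho_scale_mat)
  then show ?thesis by (simp only: cmat_Re_Im[symmetric])
qed

section \<open>Induced modules\<close>

lemma lookup_uea_act [simp]: "lookup (uea_act u x) i = u * lookup x i"
  by (simp add: uea_act_def Poly_Mapping.map.rep_eq when_def)

lemma lookup_tensor [simp]: "lookup (tensor u w) i = uea_const (lookup w i) * u"
  by (simp add: tensor_def Poly_Mapping.map.rep_eq when_def)

interpretation uea_mod: module "\<lambda>c. uea_act (uea_const c) :: ('i \<Rightarrow>\<^sub>0 'm::finite uea) \<Rightarrow> _"
  by standard (rule poly_mapping_eqI; simp add: lookup_add distrib_left distrib_right
     uea_const_add uea_const_mult mult.assoc)+

lemma uea_act_add: "uea_act u (x + y) = uea_act u x + uea_act u y"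
  by (rule poly_mapping_eqI) (simp add: lookup_add distrib_left)

lemma uea_act_diff: "uea_act u (x - y) = uea_act u x - uea_act u y"
  by (rule poly_mapping_eqI) (simp add: lookup_minus right_diff_distrib)

lemma uea_act_const: "uea_act u (uea_act (uea_const c) x) = uea_act (uea_const c) (uea_act u x)"
  by (rule poly_mapping_eqI) (simp add: uea_const_left_commute)

lemma uea_act_mult: "uea_act (u * v) x = uea_act u (uea_act v x)"
  by (rule poly_mapping_eqI) (simp add: mult.assoc)

lemma uea_act_0 [simp]: "uea_act u 0 = 0"
  by (rule poly_mapping_eqI) simp

lemma uea_act_tensor: "uea_act v (tensor u w) = tensor (v * u) w"
  by (rule poly_mapping_eqI) (simp add: uea_const_left_commute)

lemma balance_subspace: "uea_mod.subspace (balance \<pi> I)"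
  unfolding balance_def by (rule uea_mod.subspace_span)

lemmas balance_add = uea_mod.subspace_add[OF balance_subspace]
  and balance_diff = uea_mod.subspace_diff[OF balance_subspace]
  and balance_0 = uea_mod.subspace_0[OF balance_subspace]
  and balance_scale = uea_mod.subspace_scale[OF balance_subspace]
  and balance_neg = uea_mod.subspace_neg[OF balance_subspace]

lemma balance_gen:
  "set Xs \<subseteq> lie_p \<Longrightarrow> w \<in> coord_space I \<Longrightarrow>
    tensor (u * prod_list (map uea_of Xs)) w - tensor u (foldr (differential \<pi>) Xs w) \<in> balance \<pi> I"
  unfolding balance_def by (rule uea_mod.span_base) blast

lemma balance_subsetI:
  assumes "uea_mod.subspace T"
    and "\<And>u Xs w. set Xs \<subseteq> lie_p \<Longrightarrow> w \<in> coord_space I \<Longrightarrow>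
      tensor (u * prod_list (map uea_of Xs)) w - tensor u (foldr (differential \<pi>) Xs w) \<in> T"
  shows "balance \<pi> I \<subseteq> T"
  unfolding balance_def by (rule uea_mod.span_minimal) (use assms in auto)

lemma balance_uea_act: "x \<in> balance \<pi> I \<Longrightarrow> uea_act u x \<in> balance \<pi> I"
proof -
  have "balance \<pi> I \<subseteq> {x. uea_act u x \<in> balance \<pi> I}"
  proof (rule balance_subsetI)
    show "uea_mod.subspace {x. uea_act u x \<in> balance \<pi> I}"
      by (auto simp: uea_mod.subspace_def balance_0 uea_act_add balance_add uea_act_const balance_scale)
    show "tensor (v * prod_list (map uea_of Xs)) w - tensor v (foldr (differential \<pi>) Xs w)
        \<in> {x. uea_act u x \<in> balance \<pi> I}" if "set Xs \<subseteq> lie_p" "w \<in> coord_space I" for v Xs w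
      using balance_gen[OF that, of "u * v" \<pi>]
      by (simp add: uea_act_diff uea_act_tensor mult.assoc)
  qed
  then show "x \<in> balance \<pi> I \<Longrightarrow> uea_act u x \<in> balance \<pi> I" by blast
qed

text \<open>For the inducing space \<open>\<complex>\<close>, an element of \<open>U(g) \<otimes> \<complex>\<close> is a single element of \<open>U(g)\<close>; this is its
  value on the constant polynomial \<open>1\<close>.\<close>

definition Vpol :: "complex \<Rightarrow> (unit \<Rightarrow>\<^sub>0 'm::finite uea) \<Rightarrow> 'm pol" where
  "Vpol s x = uact s (lookup x ()) 1"

lemma Vpol_add: "Vpol s (x + y) = Vpol s x + Vpol s y"
  by (simp add: Vpol_def lookup_add uact_add)

lemma uact_0_right [simp]: "uact s u 0 = 0"
  using uact_cscale[of s u 0 0] by simp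

lemma Vpol_0 [simp]: "Vpol s 0 = 0"
  by (simp add: Vpol_def)

lemma Vpol_diff: "Vpol s (x - y) = Vpol s x - Vpol s y"
  by (simp add: Vpol_def lookup_minus uact_diff)

lemma Vpol_act: "Vpol s (uea_act u x) = uact s u (Vpol s x)"
  by (simp add: Vpol_def uact_mult)

lemma unit_poly_mapping: "x = single () (lookup x ())"
  by (rule poly_mapping_eqI) simp

text \<open>The generators of \<open>balance\<close> act by zero on \<open>1\<close>, because \<open>1\<close> is an eigenvector of \<open>p\<close> with the right
  eigenvalues.  Conversely \<open>balance\<close> contains the generators of \<open>vac_ideal\<close>, which is the
  annihilator of \<open>1\<close>.\<close>

lemma balance_triv_iff:
  fixes x :: "unit \<Rightarrow>\<^sub>0 'm::finite uea"
  shows "x \<in> balance (P_rep \<alpha> triv_rep s) UNIV \<longleftrightarrow> Vpol s x = 0"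
proof
  let ?\<pi> = "P_rep \<alpha> triv_rep s :: real^('m::finite option)^('m option) \<Rightarrow> _"
  let ?R = "balance ?\<pi> UNIV"
  have words: "\<exists>c. uact s (prod_list (map uea_of Xs)) 1 = cscale c 1 \<and> (\<forall>w. foldr (differential ?\<pi>) Xs w = cscale c w)"
    if "set Xs \<subseteq> lie_p" for Xs
    using that
  proof (induction Xs)
    case Nil
    show ?case by (intro exI[of _ 1]) simp
  next
    case (Cons X Xs)
    then obtain c where c: "uact s (prod_list (map uea_of Xs)) 1 = cscale c 1" "\<forall>w. foldr (differential ?\<pi>) Xs w = cscale c w"
      by auto
    have "rho s (mat_of_sl X) 1 = cscale (s * mat_of_sl X $ None $ None) 1"
      using rho_const[of s "mat_of_sl X" 1] lie_p_block_up[of X] Cons.prems by (simp add: block_up_def)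
    then show ?case using c Cons.prems differential_triv[of X \<alpha> s]
      by (intro exI[of _ "c * (s * mat_of_sl X $ None $ None)"])
        (auto simp: uact_mult uact_of rho_cscale mult.commute)
  qed
  have "?R \<subseteq> {x. Vpol s x = 0}"
  proof (rule balance_subsetI)
    show "uea_mod.subspace {x. Vpol s x = 0}"
      unfolding uea_mod.subspace_def by (simp add: Vpol_add Vpol_act)
    show "tensor (u * prod_list (map uea_of Xs)) w - tensor u (foldr (differential ?\<pi>) Xs w) \<in> {x. Vpol s x = 0}"
      if Xs: "set Xs \<subseteq> lie_p" for u Xs w
    proof -
      obtain c where c: "uact s (prod_list (map uea_of Xs)) 1 = cscale c 1" "foldr (differential ?\<pi>) Xs w = cscale c w"
        using words[OF Xs] by blast
      show ?thesis
        by (simp add: Vpol_diff c(2)) (simp add: Vpol_def uact_mult uact_const c(1) uact_cscale mult.commute)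
    qed
  qed
  then show "x \<in> ?R \<Longrightarrow> Vpol s x = 0" by blast
  have s_add: "single () u + single () v = single () (u + v)" for u v :: "'m uea"
    by (simp add: single_add)
  have s_act: "uea_act v (single () u) = single () (v * u)" for u v :: "'m uea"
    by (rule poly_mapping_eqI) simp
  have gen: "single () (u * (uea_of X - uea_const (s * mat_of_sl X $ None $ None))) \<in> ?R"
    if "block_up X" for u and X :: "'m sl"
    using that
  proof (induction X rule: block_up_induct)
    case (gen a j)
    have "tensor (u * prod_list (map uea_of [gen_p a j])) (single () 1)
      - tensor u (foldr (differential ?\<pi>) [gen_p a j] (single () 1)) \<in> ?R"
      by (rule balance_gen) (simp_all add: gen_p_lie_p coord_space_def)
    also have "tensor (u * prod_list (map uea_of [gen_p a j])) (single () 1)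
      - tensor u (foldr (differential ?\<pi>) [gen_p a j] (single () 1)) =
      single () (u * (uea_of (gen_p a j) - uea_const (s * mat_of_sl (gen_p a j) $ None $ None)))"
      by (rule poly_mapping_eqI)
        (simp add: lookup_minus differential_triv gen_p_lie_p right_diff_distrib uea_const_central)
    finally show ?case .
  next
    case (add X Y)
    from balance_add[OF add(3,4)] show ?case
      unfolding s_add distrib_left[symmetric]
      by (simp add: uea_of_add sl_add.rep_eq distrib_left uea_const_add algebra_simps)
  next
    case (scale c X)
    have "uea_const c * (u * (uea_of X - uea_const (s * mat_of_sl X $ None $ None))) =
        u * (uea_of (sl_scale c X) - uea_const (s * mat_of_sl (sl_scale c X) $ None $ None))"
      unfolding uea_const_left_commute[symmetric] uea_of_scale sl_scale.rep_eq right_diff_distrib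
      by (simp add: mult.left_commute[of s] right_diff_distrib flip: uea_const_mult)
    then show ?case using balance_uea_act[OF scale(2), of "uea_const c"] by (simp add: s_act)
  qed
  have "single () u \<in> ?R" if "u \<in> vac_ideal s" for u
    using that
  proof (induction rule: vac_ideal.induct)
    case zero
    then show ?case by (simp add: balance_0)
  next
    case (add u v)
    then show ?case by (simp add: balance_add flip: s_add)
  qed (rule gen)
  then show "Vpol s x = 0 \<Longrightarrow> x \<in> ?R"
    using unit_poly_mapping[of x] by (metis Vpol_def vac_ideal_iff)
qed

section \<open>The adjoint action of the parabolic subgroup on polynomials\<close>

lemma Ad_uea_add: "Ad_uea p (u + v) = Ad_uea p u + Ad_uea p v"
  by transfer (simp add: free_map_add uea_rel_def uea_ideal_zero)

lemma Ad_uea_mult: "Ad_uea p (u * v) = Ad_uea p u * Ad_uea p v"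
  by transfer (simp add: free_map_mult uea_rel_def uea_ideal_zero)

lemma Ad_uea_of: "Ad_uea p (uea_of X) = uea_of (Ad_sl p X)"
  by (simp add: uea_of_def Ad_uea.abs_eq letter_def)

lemma Ad_uea_const [simp]: "Ad_uea p (uea_const c) = uea_const c"
  by (simp add: uea_const_def Ad_uea.abs_eq zero_list_def)

lemma Ad_uea_0 [simp]: "Ad_uea p 0 = 0"
  using Ad_uea_const[of p 0] by simp

lemma Ad_uea_1 [simp]: "Ad_uea p 1 = 1"
  using Ad_uea_const[of p 1] by simp

lemma Ad_uea_diff: "Ad_uea p (u - v) = Ad_uea p u - Ad_uea p v"
  by (metis Ad_uea_add add_diff_cancel_right' diff_add_cancel)

lemma Ad_vac_ideal:
  assumes "u \<in> vac_ideal s" "p \<in> P_grp"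
  shows "Ad_uea p u \<in> vac_ideal s"
  using assms(1)
proof (induction rule: vac_ideal.induct)
  case (gen X u)
  then show ?case
    using vac_ideal.gen[OF Ad_block_up(1)[OF assms(2) gen], of "Ad_uea p u" s] Ad_block_up(2)[OF assms(2) gen]
    by (simp add: Ad_uea_mult Ad_uea_diff Ad_uea_of)
qed (simp_all add: Ad_uea_add vac_ideal.intros)

lemma Ad_uea_comp:
  assumes "p \<in> P_grp" "q \<in> P_grp"
  shows "Ad_uea (p ** q) u = Ad_uea p (Ad_uea q u)"
proof -
  obtain p' where p: "p ** p' = mat 1" "p' ** p = mat 1" using P_grp_inverse assms by blast
  obtain q' where q: "q ** q' = mat 1" "q' ** q = mat 1" using P_grp_inverse assms by blast
  have "p ** q ** (q' ** p') = p ** (q ** q') ** p'" by (simp only: matrix_mul_assoc)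
  then have 1: "p ** q ** (q' ** p') = mat 1" by (simp add: p q)
  have "q' ** p' ** (p ** q) = q' ** (p' ** p) ** q" by (simp only: matrix_mul_assoc)
  then have 2: "q' ** p' ** (p ** q) = mat 1" by (simp add: p q)
  have "Ad_sl (p ** q) X = Ad_sl p (Ad_sl q X)" for X
    unfolding mat_of_sl_inject[symmetric] Ad_sl_mat[OF 1 2] Ad_sl_mat[OF p] Ad_sl_mat[OF q] cmat_mult
    by (simp only: matrix_mul_assoc)
  then show ?thesis
    by (induction u rule: uea_induct) (simp_all add: Ad_uea_add Ad_uea_mult Ad_uea_of)
qed

text \<open>The Levi factor conjugates \<open>N\<^sub>j\<^sup>-\<close> to a linear combination of the \<open>N\<^sub>i\<^sup>-\<close>, with the coefficients
  of the matrix \<open>D/a\<close>; products of them are treated factor by factor.\<close>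

lemma uact_Ad_levi:
  fixes D :: "real^'m^'m::finite"
  assumes "a * det D = 1"
  shows "uact s (Ad_uea (mk_block a 0 D) (pol_to_uea f)) 1 = sym_rep (inverse a *\<^sub>R D) f"
proof -
  let ?l = "mk_block a 0 D"
  have a: "a \<noteq> 0" using assms by auto
  have l: "?l \<in> P_grp" using assms unfolding P_grp_eq by blast
  obtain q where q: "?l ** q = mat 1" "q ** ?l = mat 1" "q \<in> P_grp" using P_grp_inverse[OF l] by metis
  have "a * q $ None $ y = mat 1 $ None $ y" for y
    using arg_cong[OF q(1), of "\<lambda>A. A $ None $ y"] by (simp add: matrix_matrix_mult_def sum_option_UNIV)
  from this[of None] this[of "Some _"] have q0: "q $ None $ None = inverse a" "q $ None $ Some k = 0" for k
    using a by (simp_all add: mat_def field_simps)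
  have N: "mat_of_sl (Ad_sl ?l (N_minus j)) $ x $ y =
      complex_of_real (?l $ x $ Some j) * complex_of_real (q $ None $ y)" for j x y
  proof -
    have "(cmat ?l ** mat_of_sl (N_minus j)) $ x $ z = (if z = None then complex_of_real (?l $ x $ Some j) else 0)" for z
    proof -
      have "(cmat ?l ** mat_of_sl (N_minus j)) $ x $ z = (\<Sum>w\<in>UNIV. if w = Some j then (if z = None then complex_of_real (?l $ x $ Some j) else 0) else 0)"
        unfolding matrix_matrix_mult_def vec_lambda_beta
        by (rule sum.cong) (auto simp: N_minus.rep_eq unit_mat_def cmat_def)
      then show ?thesis by simp
    qed
    then show ?thesis
      unfolding Ad_sl_mat[OF q(1,2)]
      by (simp add: matrix_matrix_mult_def[of "_ ** _"] sum_option_UNIV) (simp add: cmat_def)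
  qed
  have step: "rho s (mat_of_sl (Ad_sl ?l (N_minus j))) F = lin_form (inverse a *\<^sub>R D) j * F" for j F
    by (simp add: rho_expand N q0 lin_vf_def lin_form_def sum_distrib_right mult_cscale)
      (simp add: mult.commute)
  show ?thesis
  proof (induction f rule: pol_induct)
    case (const c)
    show ?case using cscale_single[of c 0 1] by (simp add: pol_to_uea_const uact_const)
  qed (simp_all add: pol_to_uea_xvar Ad_uea_mult Ad_uea_of uact_mult uact_of step sym_rep_xvar
      pol_to_uea_add Ad_uea_add uact_add sym_rep_add)
qed

text \<open>The divided powers \<open>rho(Y)\<^sup>k/k!\<close> are the terms of the exponential series of \<open>rho(Y)\<close>.\<close>

definition rho_div :: "complex \<Rightarrow> complex^('m option)^('m option) \<Rightarrow> nat \<Rightarrow> 'm::finite pol \<Rightarrow> 'm pol" where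
  "rho_div s Y k f = cscale (1 / fact k) ((rho s Y ^^ k) f)"

lemma rho_div_0 [simp]: "rho_div s Y 0 f = f"
  by (simp add: rho_div_def)

lemma rho_div_Suc: "rho_div s Y (Suc k) f = cscale (1 / of_nat (Suc k)) (rho s Y (rho_div s Y k f))"
  by (simp add: rho_div_def rho_cscale field_simps)

text \<open>This is the expansion of \<open>exp(Y) X = (exp(Y) X exp(-Y)) exp(Y)\<close> by degree in \<open>Y\<close>.  For \<open>Y\<^sup>2 = 0\<close> the
  conjugate is \<open>X + [Y, X] - Y X Y\<close>, so that three consecutive divided powers occur.\<close>

lemma rho_div_commute:
  assumes "Y ** Y = 0"
  defines "X1 \<equiv> \<lambda>X. Y ** X - X ** Y" and "X2 \<equiv> \<lambda>X. - (Y ** X ** Y)"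
  shows "rho_div s Y (Suc (Suc k)) (rho s X f) = rho s X (rho_div s Y (Suc (Suc k)) f)
    + rho s (X1 X) (rho_div s Y (Suc k) f) + rho s (X2 X) (rho_div s Y k f)"
    and "rho_div s Y (Suc 0) (rho s X f) = rho s X (rho_div s Y (Suc 0) f) + rho s (X1 X) f"
proof -
  have c1: "rho s Y (rho s X g) = rho s X (rho s Y g) + rho s (X1 X) g" for g
    unfolding X1_def using rho_bracket[of s Y X g] by (simp add: algebra_simps)
  have z: "Y ** (X1 X) - X1 X ** Y = X2 X + X2 X"
  proof -
    have "Y ** (X1 X) = - (Y ** X ** Y)"
      unfolding X1_def by (simp add: matrix_diff_ldistrib matrix_mul_assoc assms(1))
    moreover have "X1 X ** Y = Y ** X ** Y"
      unfolding X1_def matrix_diff_rdistrib matrix_mul_assoc[symmetric] assms(1) by simp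
    ultimately show ?thesis unfolding X2_def by simp
  qed
  have c2: "rho s Y (rho s (X1 X) g) = rho s (X1 X) (rho s Y g) + cscale 2 (rho s (X2 X) g)" for g
  proof -
    have "rho s Y (rho s (X1 X) g) = rho s (X1 X) (rho s Y g) + (rho s (X2 X) g + rho s (X2 X) g)"
      using rho_bracket[of s Y "X1 X" g] unfolding z rho_add_mat by (simp add: algebra_simps)
    moreover have "cscale 2 h = h + h" for h :: "'a pol" by (rule poly_mapping_eqI) (simp only: lookup_cscale lookup_add mult_2)
    ultimately show ?thesis by (simp only:)
  qed
  have c3: "rho s Y (rho s (X2 X) g) = rho s (X2 X) (rho s Y g)" for g
  proof -
    have "Y ** (Y ** X ** Y) = 0" by (simp add: matrix_mul_assoc assms(1))
    moreover have "(Y ** X ** Y) ** Y = 0" by (simp add: assms(1) flip: matrix_mul_assoc)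
    ultimately have "Y ** X2 X - X2 X ** Y = 0"
      unfolding X2_def by (metis (no_types, lifting) add.inverse_neutral add.right_inverse diff_0 matrix_diff_ldistrib matrix_diff_rdistrib diff_self)
    then have "rho s (Y ** X2 X - X2 X ** Y) g = 0" using rho_scale_mat[of s 0 0 g] by (simp add: zero_vec_def)
    then show ?thesis by (simp add: rho_bracket)
  qed
  have inv: "rho s Y (rho_div s Y k f) = cscale (of_nat (Suc k)) (rho_div s Y (Suc k) f)" for k
    unfolding rho_div_Suc cscale_cscale by (simp del: of_nat_Suc)
  show e1: "rho_div s Y (Suc 0) (rho s X f) = rho s X (rho_div s Y (Suc 0) f) + rho s (X1 X) f"
    by (simp add: rho_div_Suc c1)
  show "rho_div s Y (Suc (Suc k)) (rho s X f) = rho s X (rho_div s Y (Suc (Suc k)) f)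
    + rho s (X1 X) (rho_div s Y (Suc k) f) + rho s (X2 X) (rho_div s Y k f)"
  proof (induction k)
    case 0
    show ?case
      unfolding rho_div_Suc[of s Y "Suc 0" "rho s X f"] e1 rho_add c1 c2 inv
      by (simp add: cscale_add rho_cscale inv c1 c2) (simp add: rho_div_Suc rho_cscale cscale_add_left[of "1/2" "1/2", symmetric] add.assoc flip: cscale_add_left)
  next
    case (Suc k)
    have "cscale (of_nat (Suc (Suc (Suc k)))) (rho_div s Y (Suc (Suc (Suc k))) (rho s X f)) =
        rho s Y (rho_div s Y (Suc (Suc k)) (rho s X f))"
      unfolding rho_div_Suc[of s Y "Suc (Suc k)"] cscale_cscale by (simp del: of_nat_Suc)
    also have "\<dots> = cscale (of_nat (Suc (Suc (Suc k)))) (rho s X (rho_div s Y (Suc (Suc (Suc k))) f)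
      + rho s (X1 X) (rho_div s Y (Suc (Suc k)) f) + rho s (X2 X) (rho_div s Y (Suc k) f))"
      unfolding Suc rho_add c1 c2 c3 inv rho_cscale
      by (rule poly_mapping_eqI) (simp add: lookup_add algebra_simps)
    finally have eq: "cscale (of_nat (Suc (Suc (Suc k)))) (rho_div s Y (Suc (Suc (Suc k))) (rho s X f)) = \<dots>" .
    show ?case
      using arg_cong[OF eq, of "cscale (1 / of_nat (Suc (Suc (Suc k))))"] by (simp del: of_nat_Suc)
  qed
qed

text \<open>The partial sums satisfy the recursion that \<open>uact_Ad_unipotent\<close> requires, but end at the three different
  indices \<open>K + 2\<close>, \<open>K + 1\<close> and \<open>K\<close>.\<close>

lemma rho_div_sum_commute:
  assumes "Y ** Y = 0"
  shows "(\<Sum>k\<le>Suc (Suc K). rho_div s Y k (rho s X f)) = rho s X (\<Sum>k\<le>Suc (Suc K). rho_div s Y k f)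
    + rho s (Y ** X - X ** Y) (\<Sum>k\<le>Suc K. rho_div s Y k f) + rho s (- (Y ** X ** Y)) (\<Sum>k\<le>K. rho_div s Y k f)"
proof (induction K)
  case 0
  show ?case using rho_div_commute(1)[OF assms, of s 0 X f] rho_div_commute(2)[OF assms, of s X f]
    by (simp add: rho_add)
next
  case (Suc K)
  have split: "(\<Sum>k\<le>Suc n. F k) = (\<Sum>k\<le>n. F k) + F (Suc n)" for F :: "nat \<Rightarrow> 'a pol" and n
    by simp
  show ?case
    unfolding split[of _ "Suc (Suc K)"] Suc rho_div_commute(1)[OF assms] rho_add
      split[of _ "Suc K"] split[of _ K]
    by (simp only: add_ac)
qed

text \<open>The operator \<open>rho(Y)\<close> lowers the degree, so its exponential series is a finite sum on each
  polynomial.  Where it ends depends on \<open>u\<close>; the formulation with all sufficiently large \<open>K\<close> allows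
  the induction on \<open>u\<close> to shift the upper limits in \<open>rho_div_sum_commute\<close>.\<close>

lemma uact_Ad_unipotent:
  fixes b :: "real^'m::finite"
  defines "Y \<equiv> cmat (mk_block 0 b 0)"
  shows "\<exists>K0. \<forall>K\<ge>K0. uact s (Ad_uea (mk_block 1 b (mat 1)) u) 1 = (\<Sum>k\<le>K. rho_div s Y k (uact s u 1))"
proof -
  let ?n = "mk_block 1 b (mat 1)"
  have YY: "Y ** Y = 0"
    by (rule option_mat_eqI) (simp_all add: Y_def cmat_def matrix_matrix_mult_def sum_option_UNIV)
  have n: "cmat ?n = mat 1 + Y" "cmat (mk_block 1 (- b) (mat 1)) = mat 1 - Y"
    by (rule option_mat_eqI; simp add: Y_def cmat_def mat_def)+
  have inv: "?n ** mk_block 1 (- b) (mat 1) = mat 1" "mk_block 1 (- b) (mat 1) ** ?n = mat 1"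
  proof -
    have "(\<Sum>k\<in>UNIV. c $ k * (mat 1 :: real^'m^'m) $ k $ l) = c $ l" for c :: "real^'m" and l
    proof -
      have "(\<Sum>k\<in>UNIV. c $ k * (mat 1 :: real^'m^'m) $ k $ l) = (\<Sum>k\<in>UNIV. if k = l then c $ k else 0)"
        by (rule sum.cong) (auto simp: mat_def)
      then show ?thesis by simp
    qed
    then show "?n ** mk_block 1 (- b) (mat 1) = mat 1" "mk_block 1 (- b) (mat 1) ** ?n = mat 1"
      unfolding mk_block_mult mk_block_one mk_block_inject
      by (simp_all only: vec_eq_iff vec_lambda_beta mult_1) simp_all
  qed
  have Ad: "mat_of_sl (Ad_sl ?n X) = mat_of_sl X + (Y ** mat_of_sl X - mat_of_sl X ** Y) + - (Y ** mat_of_sl X ** Y)" for X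
    unfolding Ad_sl_mat[OF inv] n by (simp add: matrix_add_rdistrib matrix_diff_ldistrib)
  have Y1: "rho s Y (single 0 c) = 0" for c
    by (simp add: rho_const Y_def cmat_def)
  have div_const: "rho_div s Y k (single 0 c) = (if k = 0 then single 0 c else 0)" for k c
    using rho_cscale[of s Y 0 0] by (induction k) (simp_all add: rho_div_Suc Y1)
  have div_add: "rho_div s Y k (f + g) = rho_div s Y k f + rho_div s Y k g" for k f g
    by (induction k) (simp_all add: rho_div_Suc rho_add cscale_add)
  show ?thesis
  proof (induction u rule: uea_induct)
    case (const c)
    have 1: "uact s (uea_const c) 1 = single 0 c"
      using cscale_single[of c 0 1] by (simp add: uact_const)
    have "(\<Sum>k\<le>K. rho_div s Y k (single 0 c)) = single 0 c" for K
      unfolding div_const by (subst sum.delta) simp_all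
    then show ?case
      unfolding Ad_uea_const 1 by (intro exI[of _ 0] allI impI) (rule sym)
  next
    case (of X u)
    from of obtain K0 where K0: "\<forall>K\<ge>K0. uact s (Ad_uea ?n u) 1 = (\<Sum>k\<le>K. rho_div s Y k (uact s u 1))"
      by (rule exE)
    have "uact s (Ad_uea ?n (uea_of X * u)) 1 = (\<Sum>k\<le>K. rho_div s Y k (uact s (uea_of X * u) 1))"
      if "K \<ge> Suc (Suc K0)" for K
    proof -
      define K' where "K' = K - 2"
      have K: "K = Suc (Suc K')" "K' \<ge> K0" using that by (simp_all add: K'_def)
      note K0 = K0[rule_format]
      show ?thesis
        unfolding K(1) uact_mult uact_of Ad_uea_mult Ad_uea_of rho_div_sum_commute[OF YY] Ad rho_add_mat
          K0[of K', symmetric, OF K(2)] K0[of "Suc K'", symmetric, OF le_SucI[OF K(2)]]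
          K0[of "Suc (Suc K')", symmetric, OF le_SucI[OF le_SucI[OF K(2)]]] by (rule refl)
    qed
    then show ?case by (intro exI[of _ "Suc (Suc K0)"] allI impI)
  next
    case (add u v)
    from add(1) obtain K1 where K1: "\<forall>K\<ge>K1. uact s (Ad_uea ?n u) 1 = (\<Sum>k\<le>K. rho_div s Y k (uact s u 1))"
      by (rule exE)
    from add(2) obtain K2 where K2: "\<forall>K\<ge>K2. uact s (Ad_uea ?n v) 1 = (\<Sum>k\<le>K. rho_div s Y k (uact s v 1))"
      by (rule exE)
    have "uact s (Ad_uea ?n (u + v)) 1 = (\<Sum>k\<le>K. rho_div s Y k (uact s (u + v) 1))" if "K \<ge> max K1 K2" for K
      unfolding Ad_uea_add uact_add div_add sum.distrib 
      using K1[rule_format, of K] K2[rule_format, of K] that by (simp only: max.bounded_iff)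
    then show ?case by (intro exI[of _ "max K1 K2"] allI impI)
  qed
qed

lemma block_levi_unipotent:
  fixes D :: "real^'m^'m::finite"
  assumes "a \<noteq> 0"
  shows "mk_block a b D = mk_block a 0 D ** mk_block 1 (inverse a *\<^sub>R b) (mat 1)"
  using assms by (simp add: mk_block_mult mk_block_inject) (simp add: vec_eq_iff)

text \<open>For \<open>s = k - 1\<close> the operators of \<open>n\<^sub>+\<close> kill the polynomials of degree \<open>k\<close>, so all terms of the
  exponential series but the first vanish, and \<open>p\<close> acts like its Levi factor.\<close>

lemma uact_Ad_Pol:
  fixes D :: "real^'m^'m::finite"
  assumes p: "a * det D = 1" and f: "f \<in> coord_space (Xi k)"
  defines "s \<equiv> of_nat k - 1"
  shows "uact s (Ad_uea (mk_block a b D) (pol_to_uea f)) 1 = sym_rep (inverse a *\<^sub>R D) f"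
proof -
  let ?b = "inverse a *\<^sub>R b"
  let ?l = "mk_block a 0 D" and ?n = "mk_block 1 ?b (mat 1)" and ?Y = "cmat (mk_block 0 ?b 0)"
  have l: "?l \<in> P_grp" unfolding P_grp_eq using p by blast
  have "1 * det (mat 1 :: real^'m^'m) = 1" by simp
  then have n: "?n \<in> P_grp" unfolding P_grp_eq by blast
  have "lin_vf (0 :: complex^'m^'m) f = 0" by (simp add: lin_vf_def)
  moreover have "(\<chi> i j. ?Y $ Some i $ Some j) = 0" by (simp add: vec_eq_iff cmat_def)
  ultimately have Yf: "rho s ?Y f = 0"
    unfolding s_def by (subst rho_Pol[OF f]) (simp_all add: cmat_def)
  have div0: "rho_div s ?Y k f = (if k = 0 then f else 0)" for k
    using rho_cscale[of s ?Y 0 0] by (induction k) (simp_all add: rho_div_Suc Yf)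
  obtain K0 where "\<forall>K\<ge>K0. uact s (Ad_uea ?n (pol_to_uea f)) 1 = (\<Sum>k\<le>K. rho_div s ?Y k (uact s (pol_to_uea f) 1))"
    using uact_Ad_unipotent by (rule exE)
  then have "uact s (Ad_uea ?n (pol_to_uea f)) 1 = (\<Sum>k\<le>K0. rho_div s ?Y k f)"
    by (simp add: uact_pol_to_uea)
  also have "\<dots> = f" unfolding div0 by (subst sum.delta) simp_all
  finally have "uact s (Ad_uea ?n (pol_to_uea f) - pol_to_uea f) 1 = 0"
    by (simp add: uact_diff uact_pol_to_uea)
  then have "Ad_uea ?l (Ad_uea ?n (pol_to_uea f) - pol_to_uea f) \<in> vac_ideal s"
    using Ad_vac_ideal[OF _ l] vac_ideal_iff by blast
  then have "uact s (Ad_uea ?l (Ad_uea ?n (pol_to_uea f))) 1 = uact s (Ad_uea ?l (pol_to_uea f)) 1"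
    by (simp add: vac_ideal_iff Ad_uea_diff uact_diff)
  moreover have "a \<noteq> 0" using p by auto
  ultimately show ?thesis
    by (simp add: block_levi_unipotent[of a b D] Ad_uea_comp[OF l n] uact_Ad_levi[OF p])
qed

text \<open>This is \<open>\<bar>a\<bar>\<^sup>k\<^sup>-\<^sup>1 a\<^sup>-\<^sup>k = sgn(a)\<^sup>k \<bar>a\<bar>\<^sup>-\<^sup>1\<close>; the factor \<open>sgn(a)\<^sup>k\<close> turns the sign \<open>\<alpha>\<close> into \<open>\<alpha> + k\<close>.\<close>

lemma sgn_pow_shift:
  assumes "\<alpha> \<in> {1, -1}" "a \<noteq> 0"
  shows "sgn_pow \<alpha> (of_nat k - 1) a * complex_of_real (inverse a) ^ k = sgn_pow (sign_add \<alpha> k) (- 1) a"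
proof -
  have e: "exp ((of_nat k - 1) * complex_of_real (ln \<bar>a\<bar>)) = complex_of_real (\<bar>a\<bar> ^ k * inverse \<bar>a\<bar>)"
  proof -
    have "exp ((of_nat k - 1) * complex_of_real (ln \<bar>a\<bar>)) = complex_of_real (exp ((of_nat k - 1) * ln \<bar>a\<bar>))"
      by (simp flip: exp_of_real)
    also have "exp ((of_nat k - 1) * ln \<bar>a\<bar>) = \<bar>a\<bar> ^ k * inverse \<bar>a\<bar>"
      using assms(2) by (simp add: left_diff_distrib exp_diff exp_of_nat_mult divide_inverse)
    finally show ?thesis .
  qed
  have e': "exp (- 1 * complex_of_real (ln \<bar>a\<bar>)) = complex_of_real (inverse \<bar>a\<bar>)"
  proof -
    have "exp (- 1 * complex_of_real (ln \<bar>a\<bar>)) = complex_of_real (exp (- ln \<bar>a\<bar>))"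
      by (simp flip: exp_of_real)
    then show ?thesis using assms(2) by (simp add: exp_minus)
  qed
  have "\<bar>a\<bar> ^ k * inverse a ^ k = sgn a ^ k"
    using assms(2) by (simp add: sgn_if abs_if flip: power_mult_distrib)
  then have r: "(\<bar>a\<bar> ^ k * inverse \<bar>a\<bar>) * inverse a ^ k = sgn a ^ k * inverse \<bar>a\<bar>"
    by (simp add: mult.commute mult.left_commute)
  have sg: "(if \<alpha> = 1 then 1 else sgn a) * sgn a ^ k = (if sign_add \<alpha> k = 1 then 1 else sgn a)"
    using assms by (cases "even k") (auto simp: sign_add_def sgn_if)
  have "sgn_pow \<alpha> (of_nat k - 1) a * complex_of_real (inverse a) ^ k =
      complex_of_real ((if \<alpha> = 1 then 1 else sgn a) * ((\<bar>a\<bar> ^ k * inverse \<bar>a\<bar>) * inverse a ^ k))"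
    unfolding sgn_pow_def e by simp
  also have "\<dots> = complex_of_real ((if sign_add \<alpha> k = 1 then 1 else sgn a) * inverse \<bar>a\<bar>)"
    unfolding r sg[symmetric] by (simp only: mult.assoc)
  also have "\<dots> = sgn_pow (sign_add \<alpha> k) (- 1) a"
    unfolding sgn_pow_def e' by simp
  finally show ?thesis .
qed

text \<open>The left hand side is the action of \<open>P\<close> on \<open>M(triv, k - 1)\<close>.  There \<open>p\<close> acts by \<open>sgn(a)\<^sup>\<alpha> \<bar>a\<bar>\<^sup>k\<^sup>-\<^sup>1\<close>
  times the substitution by \<open>D/a\<close>, on the right by \<open>sgn(a)\<^sup>\<alpha>\<^sup>+\<^sup>k \<bar>a\<bar>\<^sup>-\<^sup>1\<close> times the substitution by \<open>D\<close>;
  the homogeneity of degree \<open>k\<close> makes up for the difference.\<close>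

lemma phi_equivariant:
  fixes p :: "real^('m::finite option)^('m option)"
  assumes \<alpha>: "\<alpha> \<in> {1, -1}" and p: "p \<in> P_grp" and f: "f \<in> coord_space (Xi k)"
    and r: "r = - (1 + of_nat k / of_nat CARD('m))"
  shows "cscale (sgn_pow \<alpha> (of_nat k - 1) (p $ None $ None)) (uact (of_nat k - 1) (Ad_uea p (pol_to_uea f)) 1) =
    P_rep (sign_add \<alpha> k) sym_rep r p f"
proof -
  obtain a b D where pp: "p = mk_block a b D" and aD: "a * det D = 1" using p unfolding P_grp_eq by blast
  have a: "a \<noteq> 0" using aD by auto
  have r1: "r + of_nat k / of_nat CARD('m) = - 1" by (simp add: r)
  show ?thesis
    unfolding pp P_rep_sym[OF aD f] r1 uact_Ad_Pol[OF aD f] sym_rep_scaleR[OF f] cscale_cscale mk_block_nth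
      sgn_pow_shift[OF \<alpha> a] ..
qed

section \<open>Modules of cosets\<close>

lemma fd_repD:
  assumes "fd_rep SLpm \<sigma> I"
  shows "finite I" "w \<in> coord_space I \<Longrightarrow> \<sigma> (mat 1) w = w"
    "g \<in> SLpm \<Longrightarrow> w \<in> coord_space I \<Longrightarrow> \<sigma> g w \<in> coord_space I"
    "g \<in> SLpm \<Longrightarrow> clinear_on (coord_space I) (\<sigma> g)"
  using assms unfolding fd_rep_def by blast+

lemma P_rep_lin:
  assumes "fd_rep SLpm \<sigma> I" "p \<in> P_grp"
  shows "clinear_on (coord_space I) (P_rep \<beta> \<sigma> r p)" "w \<in> coord_space I \<Longrightarrow> P_rep \<beta> \<sigma> r p w \<in> coord_space I"
proof -
  obtain a b D where p: "p = mk_block a b D" and aD: "a * det D = 1" using assms(2) unfolding P_grp_eq by blast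
  note g = block_MAN(1)[OF aD]
  show "clinear_on (coord_space I) (P_rep \<beta> \<sigma> r p)" "w \<in> coord_space I \<Longrightarrow> P_rep \<beta> \<sigma> r p w \<in> coord_space I"
    using fd_repD(3)[OF assms(1) g] fd_repD(4)[OF assms(1) g] unfolding p
    by (auto simp: clinear_on_def P_rep_sgn_pow[OF aD] cscale_add coord_space_closed mult.commute)
qed

lemma clinear_on_expand:
  assumes T: "clinear_on (coord_space I) T" and "finite I" "w \<in> coord_space I"
  shows "T w = (\<Sum>i\<in>I. cscale (lookup w i) (T (single i 1)))"
proof -
  have e: "single i c \<in> coord_space I" if "i \<in> I" for i and c :: complex
    using that by (auto simp: coord_space_iff lookup_single when_def)
  have T0: "T 0 = 0"
    using T coord_space_closed(1) unfolding clinear_on_def by (metis cscale_simps(1))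
  have "T (\<Sum>i\<in>S. cscale (lookup w i) (single i 1)) =
      (\<Sum>i\<in>S. cscale (lookup w i) (T (single i 1))) \<and>
      (\<Sum>i\<in>S. cscale (lookup w i) (single i 1)) \<in> coord_space I"
    if "S \<subseteq> I" for S
    using finite_subset[OF that assms(2)] that
  proof (induction S rule: finite_induct)
    case empty
    then show ?case by (simp add: T0 coord_space_closed)
  next
    case (insert i S)
    then show ?case
      using T e[of i] by (simp add: clinear_on_def coord_space_closed)
  qed
  moreover have "w = (\<Sum>i\<in>I. cscale (lookup w i) (single i 1))"
    using assms(2,3) by (intro poly_mapping_eqI) (auto simp: cscale_single lookup_sum lookup_single when_def coord_space_iff)
  ultimately show ?thesis by (metis subset_refl)
qed

text \<open>The diagonal action of \<open>P\<close> on \<open>U(g) \<otimes> W\<close>, of which the group action on the Verma module is the quotient.\<close>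

definition ind_act where
  "ind_act \<pi> I p x = (\<Sum>i\<in>I. tensor (Ad_uea p (lookup x i)) (\<pi> p (single i 1)))"

lemma tensor_add_left: "tensor (u + v) w = tensor u w + tensor v w"
  by (rule poly_mapping_eqI) (simp add: lookup_add distrib_left)

lemma tensor_add_right: "tensor u (v + w) = tensor u v + tensor u w"
  by (rule poly_mapping_eqI) (simp add: lookup_add uea_const_add distrib_right)

lemma tensor_cscale: "tensor u (cscale c w) = uea_act (uea_const c) (tensor u w)"
  by (rule poly_mapping_eqI) (simp add: uea_const_mult mult.assoc)

lemma ind_act_add: "ind_act \<pi> I p (x + y) = ind_act \<pi> I p x + ind_act \<pi> I p y"
  by (simp add: ind_act_def lookup_add Ad_uea_add tensor_add_left sum.distrib)

lemma uea_act_sum: "uea_act v (sum g S) = (\<Sum>i\<in>S. uea_act v (g i))"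
  by (induction S rule: infinite_finite_induct) (simp_all add: uea_act_add)

lemma ind_act_act: "ind_act \<pi> I p (uea_act u x) = uea_act (Ad_uea p u) (ind_act \<pi> I p x)"
  by (simp add: ind_act_def Ad_uea_mult uea_act_tensor uea_act_sum)

lemma ind_act_tensor:
  assumes "clinear_on (coord_space I) (\<pi> p)" "finite I" "w \<in> coord_space I"
  shows "ind_act \<pi> I p (tensor u w) = tensor (Ad_uea p u) (\<pi> p w)"
proof (rule poly_mapping_eqI)
  fix k
  have s: "uea_const (sum g S) * v = (\<Sum>i\<in>S. uea_const (g i) * v)" for g S and v :: "'c uea"
    by (induction S rule: infinite_finite_induct) (simp_all add: uea_const_add distrib_right)
  show "lookup (ind_act \<pi> I p (tensor u w)) k = lookup (tensor (Ad_uea p u) (\<pi> p w)) k"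
    unfolding clinear_on_expand[OF assms]
    by (simp add: ind_act_def lookup_sum Ad_uea_mult s uea_const_mult mult.assoc)
      (rule sum.cong, rule refl, rule uea_const_left_commute)
qed

lemma ind_act_closed:
  assumes "\<And>i. i \<in> I \<Longrightarrow> \<pi> p (single i 1) \<in> coord_space I"
  shows "ind_act \<pi> I p x \<in> coord_space I"
  unfolding coord_space_iff
proof (intro allI impI)
  fix k assume "lookup (ind_act \<pi> I p x) k \<noteq> 0"
  then have "(\<Sum>i\<in>I. uea_const (lookup (\<pi> p (single i 1)) k) *
      Ad_uea p (lookup x i)) \<noteq> 0"
    by (simp add: ind_act_def lookup_sum)
  then obtain i where i: "i \<in> I" and "uea_const (lookup (\<pi> p (single i 1)) k) *
      Ad_uea p (lookup x i) \<noteq> 0"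
    by (rule sum.not_neutral_contains_not_neutral)
  then have "i \<in> I" "lookup (\<pi> p (single i 1)) k \<noteq> 0"
    by auto
  then show "k \<in> I" using assms by (auto simp: coord_space_iff)
qed

definition coset :: "'b::ab_group_add set \<Rightarrow> 'b \<Rightarrow> 'b set" where
  "coset R x = {x + \<rho> | \<rho>. \<rho> \<in> R}"

definition add_subgroup :: "'b::ab_group_add set \<Rightarrow> bool" where
  "add_subgroup R \<longleftrightarrow> 0 \<in> R \<and> (\<forall>x\<in>R. \<forall>y\<in>R. x + y \<in> R) \<and> (\<forall>x\<in>R. - x \<in> R)"

lemma add_subgroup_balance: "add_subgroup (balance \<pi> I)"
  by (simp add: add_subgroup_def balance_0 balance_add balance_neg)

lemma coset_self: "add_subgroup R \<Longrightarrow> x \<in> coset R x"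
  by (force simp: coset_def add_subgroup_def)

lemma in_coset_iff: "y \<in> coset R x \<longleftrightarrow> y - x \<in> R"
  unfolding coset_def by (auto intro: exI[of _ "y - x"])

lemma coset_eq_iff:
  assumes "add_subgroup R"
  shows "coset R x = coset R y \<longleftrightarrow> x - y \<in> R"
proof
  show "coset R x = coset R y \<Longrightarrow> x - y \<in> R" using coset_self[OF assms, of x] by (simp add: in_coset_iff)
next
  assume xy: "x - y \<in> R"
  have "z - x \<in> R \<longleftrightarrow> z - y \<in> R" for z
  proof
    assume "z - x \<in> R"
    then have "(z - x) + (x - y) \<in> R" using assms xy unfolding add_subgroup_def by blast
    then show "z - y \<in> R" by simp
  next
    assume "z - y \<in> R"
    then have "(z - y) + - (x - y) \<in> R" using assms xy unfolding add_subgroup_def by blast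
    then show "z - x \<in> R" by simp
  qed
  then show "coset R x = coset R y" by (auto simp: in_coset_iff)
qed

lemma coset_zero: "coset R 0 = R"
  by (auto simp: coset_def)

lemma coset_map_coset:
  assumes R: "add_subgroup R'" and F: "\<And>x y. F (x + y) = F x + F y" and FR: "\<And>x. x \<in> R \<Longrightarrow> F x \<in> R'"
    and "0 \<in> R"
  shows "coset_map R' F (coset R x) = coset R' (F x)"
proof (intro equalityI subsetI)
  fix z assume "z \<in> coset_map R' F (coset R x)"
  then obtain \<rho> \<rho>' where "z = F (x + \<rho>) + \<rho>'" "\<rho> \<in> R" "\<rho>' \<in> R'" unfolding coset_map_def coset_def by blast
  then have "z - F x = F \<rho> + \<rho>'" "F \<rho> + \<rho>' \<in> R'" using F FR R by (auto simp: add_subgroup_def)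
  then show "z \<in> coset R' (F x)" by (simp add: in_coset_iff)
next
  fix z assume "z \<in> coset R' (F x)"
  then obtain \<rho>' where "z = F x + \<rho>'" "\<rho>' \<in> R'" unfolding coset_def by blast
  moreover have "x \<in> coset R x" using assms(4) by (simp add: in_coset_iff)
  ultimately show "z \<in> coset_map R' F (coset R x)" unfolding coset_map_def by blast
qed

lemma coset_add:
  assumes "add_subgroup R"
  shows "{a + b | a b. a \<in> coset R x \<and> b \<in> coset R y} = coset R (x + y)"
proof (intro equalityI subsetI)
  fix z assume "z \<in> {a + b | a b. a \<in> coset R x \<and> b \<in> coset R y}"
  then obtain a b where "z = a + b" "a - x \<in> R" "b - y \<in> R" by (auto simp: in_coset_iff)
  moreover then have "(a - x) + (b - y) \<in> R" using assms unfolding add_subgroup_def by blast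
  ultimately show "z \<in> coset R (x + y)" by (simp add: in_coset_iff algebra_simps)
next
  fix z assume "z \<in> coset R (x + y)"
  then have "z - y \<in> coset R x" by (simp add: in_coset_iff algebra_simps)
  moreover have "z = (z - y) + y" by simp
  ultimately show "z \<in> {a + b | a b. a \<in> coset R x \<and> b \<in> coset R y}" using coset_self[OF assms, of y] by blast
qed

lemma verma_simps:
  fixes \<sigma> I \<nu> \<alpha>
  defines "\<pi> \<equiv> P_rep \<alpha> \<sigma> \<nu>"
  defines "R \<equiv> balance \<pi> I"
  shows "carr (verma \<sigma> I \<nu> \<alpha>) = coset R ` coord_space I"
    "mzero (verma \<sigma> I \<nu> \<alpha>) = R"
    "madd (verma \<sigma> I \<nu> \<alpha>) (coset R x) (coset R y) = coset R (x + y)"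
    "mscale (verma \<sigma> I \<nu> \<alpha>) c (coset R x) = coset R (uea_act (uea_const c) x)"
    "lie_act (verma \<sigma> I \<nu> \<alpha>) X (coset R x) = coset R (uea_act (uea_of X) x)"
    "grp_act (verma \<sigma> I \<nu> \<alpha>) p = coset_map R (ind_act \<pi> I p)"
proof -
  have sub: "add_subgroup R" unfolding R_def by (rule add_subgroup_balance)
  have cm: "coset_map R (uea_act u) (coset R x) = coset R (uea_act u x)" for u x
    by (rule coset_map_coset[OF sub uea_act_add]) (simp_all add: R_def balance_uea_act balance_0)
  show "carr (verma \<sigma> I \<nu> \<alpha>) = coset R ` coord_space I"
    by (auto simp: verma_def Let_def coset_def R_def \<pi>_def)
  show "mzero (verma \<sigma> I \<nu> \<alpha>) = R" by (simp add: verma_def Let_def R_def \<pi>_def)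
  show "madd (verma \<sigma> I \<nu> \<alpha>) (coset R x) (coset R y) = coset R (x + y)"
    using coset_add[OF sub, of x y] by (simp add: verma_def Let_def)
  show "mscale (verma \<sigma> I \<nu> \<alpha>) c (coset R x) = coset R (uea_act (uea_const c) x)"
    "lie_act (verma \<sigma> I \<nu> \<alpha>) X (coset R x) = coset R (uea_act (uea_of X) x)"
    using cm by (simp_all add: verma_def Let_def R_def[symmetric] \<pi>_def[symmetric])
  show "grp_act (verma \<sigma> I \<nu> \<alpha>) p = coset_map R (ind_act \<pi> I p)"
    by (simp add: verma_def Let_def R_def \<pi>_def ind_act_def[abs_def])
qed

section \<open>The scalar generalized Verma module as a polynomial ring\<close>

abbreviation triv_ideal :: "int \<Rightarrow> complex \<Rightarrow> (unit \<Rightarrow>\<^sub>0 'm::finite uea) set" where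
  "triv_ideal \<alpha> s \<equiv> balance (P_rep \<alpha> triv_rep s) UNIV"

lemma triv_coset_eq: "coset (triv_ideal \<alpha> s) x = coset (triv_ideal \<alpha> s) y \<longleftrightarrow> Vpol s x = Vpol s y"
  by (simp add: coset_eq_iff add_subgroup_balance balance_triv_iff Vpol_diff)

lemma Vpol_ind_act:
  assumes "p \<in> P_grp"
  shows "Vpol s (ind_act (P_rep \<alpha> triv_rep s) UNIV p x) =
    cscale (sgn_pow \<alpha> s (p $ None $ None)) (uact s (Ad_uea p (lookup x ())) 1)"
proof -
  obtain a b D where p: "p = mk_block a b D" and aD: "a * det D = 1" using assms unfolding P_grp_eq by blast
  show ?thesis
    by (simp add: p ind_act_def P_rep_triv[OF aD] UNIV_unit Vpol_def uact_mult uact_const)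
qed

lemma triv_ind_act:
  assumes "p \<in> P_grp" "x \<in> triv_ideal \<alpha> s"
  shows "ind_act (P_rep \<alpha> triv_rep s) UNIV p x \<in> triv_ideal \<alpha> s"
proof -
  have "lookup x () \<in> vac_ideal s"
    using assms(2) by (simp add: balance_triv_iff Vpol_def vac_ideal_iff)
  then have "uact s (Ad_uea p (lookup x ())) 1 = 0"
    using Ad_vac_ideal[OF _ assms(1)] vac_ideal_iff by blast
  then show ?thesis by (simp add: balance_triv_iff Vpol_ind_act[OF assms(1)])
qed

lemma triv_grp_act:
  assumes "p \<in> P_grp"
  shows "grp_act (verma_triv s \<alpha>) p (coset (triv_ideal \<alpha> s) x) =
    coset (triv_ideal \<alpha> s) (ind_act (P_rep \<alpha> triv_rep s) UNIV p x)"
  unfolding verma_simps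
  by (rule coset_map_coset[OF add_subgroup_balance ind_act_add triv_ind_act[OF assms] balance_0])

lemma coord_space_UNIV [simp]: "coord_space UNIV = UNIV"
  by (simp add: coord_space_def)

text \<open>The value does not depend on the representative, by \<open>balance_triv_iff\<close>; see \<open>valC_coset\<close>.\<close>

definition valC :: "complex \<Rightarrow> (unit \<Rightarrow>\<^sub>0 'm::finite uea) set \<Rightarrow> 'm pol" where
  "valC s C = Vpol s (SOME x. x \<in> C)"

lemma valC_coset [simp]: "valC s (coset (triv_ideal \<alpha> s) x) = Vpol s x"
proof -
  have "(SOME y. y \<in> coset (triv_ideal \<alpha> s) x) \<in> coset (triv_ideal \<alpha> s) x"
    using coset_self[OF add_subgroup_balance] by (rule someI)
  then show ?thesis by (simp add: valC_def in_coset_iff balance_triv_iff Vpol_diff)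
qed

lemma valC_inject:
  assumes "C \<in> carr (verma_triv s \<alpha>)" "D \<in> carr (verma_triv s \<alpha>)" "valC s C = valC s D"
  shows "C = D"
proof -
  obtain x y where "C = coset (triv_ideal \<alpha> s) x" "D = coset (triv_ideal \<alpha> s) y"
    using assms(1,2) by (auto simp: verma_simps)
  then show ?thesis using assms(3) by (simp add: triv_coset_eq)
qed

text \<open>In the group action the representative may be replaced by the element of \<open>S(n\<^sub>-)\<close> with the same
  value, as their difference lies in the \<open>Ad(P)\<close>-stable ideal \<open>vac_ideal\<close>.\<close>

lemma valC_ops:
  assumes C: "C \<in> carr (verma_triv s \<alpha>)" and D: "D \<in> carr (verma_triv s \<alpha>)"
  shows "valC s (madd (verma_triv s \<alpha>) C D) = valC s C + valC s D"
    "valC s (mscale (verma_triv s \<alpha>) c C) = cscale c (valC s C)"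
    "valC s (lie_act (verma_triv s \<alpha>) X C) = rho s (mat_of_sl X) (valC s C)"
    "p \<in> P_grp \<Longrightarrow> valC s (grp_act (verma_triv s \<alpha>) p C) =
      cscale (sgn_pow \<alpha> s (p $ None $ None)) (uact s (Ad_uea p (pol_to_uea (valC s C))) 1)"
proof -
  obtain x where x: "C = coset (triv_ideal \<alpha> s) x" using C by (auto simp: verma_simps)
  obtain y where y: "D = coset (triv_ideal \<alpha> s) y" using D by (auto simp: verma_simps)
  show "valC s (madd (verma_triv s \<alpha>) C D) = valC s C + valC s D"
    "valC s (mscale (verma_triv s \<alpha>) c C) = cscale c (valC s C)"
    "valC s (lie_act (verma_triv s \<alpha>) X C) = rho s (mat_of_sl X) (valC s C)"
    by (simp_all add: x y verma_simps Vpol_add Vpol_act uact_const uact_of)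
  assume p: "p \<in> P_grp"
  have "lookup x () - pol_to_uea (Vpol s x) \<in> vac_ideal s"
    unfolding Vpol_def by (rule uea_reduce)
  from Ad_vac_ideal[OF this p]
  have "uact s (Ad_uea p (lookup x ())) 1 = uact s (Ad_uea p (pol_to_uea (Vpol s x))) 1"
    by (simp add: vac_ideal_iff Ad_uea_diff uact_diff)
  then show "valC s (grp_act (verma_triv s \<alpha>) p C) =
      cscale (sgn_pow \<alpha> s (p $ None $ None)) (uact s (Ad_uea p (pol_to_uea (valC s C))) 1)"
    by (simp add: x triv_grp_act[OF p] Vpol_ind_act[OF p])
qed

section \<open>Smoothness of finite-dimensional representations\<close>

text \<open>Averaging over \<open>[0, \<epsilon>]\<close> produces vectors along whose orbits a continuous one-parameter
  group is differentiable.  Every linear form that kills all differentiable vectors therefore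
  kills the averages, hence, letting \<open>\<epsilon>\<close> tend to 0, every vector.\<close>

lemma one_parameter_group_differentiable:
  fixes G :: "real \<Rightarrow> ('i \<Rightarrow>\<^sub>0 complex) \<Rightarrow> ('i \<Rightarrow>\<^sub>0 complex)"
  assumes I: "finite I"
    and lin: "\<And>t. clinear_on (coord_space I) (G t)"
    and into: "\<And>t w. w \<in> coord_space I \<Longrightarrow> G t w \<in> coord_space I"
    and G0: "\<And>w. w \<in> coord_space I \<Longrightarrow> G 0 w = w"
    and mult: "\<And>s t w. w \<in> coord_space I \<Longrightarrow> G (s + t) w = G s (G t w)"
    and cont: "\<And>w i. w \<in> coord_space I \<Longrightarrow> continuous_on UNIV (\<lambda>t. lookup (G t w) i)"
    and w1: "w1 \<in> coord_space I"
  shows "\<exists>F\<in>coord_space I. \<forall>i. ((\<lambda>t. lookup (G t w1) i) has_vector_derivative lookup F i) (at 0)"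
proof (rule ccontr)
  define D where "D = {w \<in> coord_space I. \<exists>F\<in>coord_space I. \<forall>i.
    ((\<lambda>t. lookup (G t w) i) has_vector_derivative lookup F i) (at 0)}"
  assume "\<not> ?thesis"
  then have w1D: "w1 \<notin> D" by (simp add: D_def)
  interpret vs: vector_space_pair "cscale :: complex \<Rightarrow> ('i \<Rightarrow>\<^sub>0 complex) \<Rightarrow> _" "(*) :: complex \<Rightarrow> complex \<Rightarrow> complex"
    by standard (auto simp: cscale_add cscale_add_left algebra_simps)
  have D0: "0 \<in> D"
  proof -
    have "G t 0 = 0" for t
      using lin[of t] coord_space_closed(1)[of I] unfolding clinear_on_def by (metis cscale_simps(1))
    then show ?thesis unfolding D_def by (auto intro!: bexI[of _ 0] simp: coord_space_closed)
  qed
  have sub: "vs.vs1.subspace D"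
    unfolding vs.vs1.subspace_def
  proof (intro conjI ballI allI D0)
    fix v w assume "v \<in> D" "w \<in> D"
    then obtain E F where "v \<in> coord_space I" "w \<in> coord_space I" "E \<in> coord_space I" "F \<in> coord_space I"
      "\<And>i. ((\<lambda>t. lookup (G t v) i) has_vector_derivative lookup E i) (at 0)"
      "\<And>i. ((\<lambda>t. lookup (G t w) i) has_vector_derivative lookup F i) (at 0)"
      unfolding D_def by blast
    then show "v + w \<in> D"
      using lin unfolding D_def clinear_on_def
      by (auto intro!: bexI[of _ "E + F"] has_vector_derivative_add simp: coord_space_closed lookup_add)
  next
    fix c w assume "w \<in> D"
    then obtain F where "w \<in> coord_space I" "F \<in> coord_space I"
      "\<And>i. ((\<lambda>t. lookup (G t w) i) has_vector_derivative lookup F i) (at 0)"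
      unfolding D_def by blast
    then show "cscale c w \<in> D"
      using lin unfolding D_def clinear_on_def
      by (auto intro!: bexI[of _ "cscale c F"] has_vector_derivative_mult_right simp: coord_space_closed)
  qed
  obtain lf where lf: "Vector_Spaces.linear cscale (*) lf" "\<And>w. w \<in> D \<Longrightarrow> lf w = 0" "lf w1 = 1"
  proof -
    obtain B where B: "B \<subseteq> D" "vs.vs1.independent B" "D \<subseteq> vs.vs1.span B"
      using vs.vs1.maximal_independent_subset by blast
    have "w1 \<notin> vs.vs1.span B" using w1D vs.vs1.span_minimal[OF B(1) sub] by blast
    then have "vs.vs1.independent (insert w1 B)" using B(2) by (rule vs.vs1.independent_insertI)
    from vs.linear_independent_extend[OF this, of "\<lambda>w. if w = w1 then 1 else 0"]
    obtain lf where l: "Vector_Spaces.linear cscale (*) lf" "\<forall>w\<in>insert w1 B. lf w = (if w = w1 then 1 else 0)" by blast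
    have "lf w = 0" if "w \<in> D" for w
    proof (rule vs.linear_eq_0_on_span[OF l(1)])
      show "w \<in> vs.vs1.span B" using that B(3) by blast
      show "lf b = 0" if "b \<in> B" for b using that l(2) B(1) w1D by auto
    qed
    then show ?thesis using that[OF l(1)] l(2) by simp
  qed
  have lf_expand: "lf w = (\<Sum>i\<in>I. lookup w i * lf (single i 1))" if "w \<in> coord_space I" for w
  proof -
    have "w = (\<Sum>i\<in>I. cscale (lookup w i) (single i 1))"
      using clinear_on_expand[of I "\<lambda>w. w" w] I that by (simp add: clinear_on_def)
    then have "lf w = lf (\<Sum>i\<in>I. cscale (lookup w i) (single i 1))" by (rule arg_cong)
    then show ?thesis by (simp only: vs.linear_sum[OF lf(1)] vs.linear_scale[OF lf(1)])
  qed
  let ?c = "\<lambda>w i u. lookup (G u w) i"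
  have int: "?c w i integrable_on {a..b}" if "w \<in> coord_space I" for w i a b
    using continuous_on_subset[OF cont[OF that, of i]] by (intro integrable_continuous_interval) auto
  \<comment> \<open>the average of the orbit of \<open>w1\<close> over \<open>[0, e]\<close>, up to the factor \<open>e\<close>\<close>
  define J where "J e = (\<Sum>i\<in>I. single i (integral {0..e} (?c w1 i)))" for e
  have J: "lookup (J e) i = (if i \<in> I then integral {0..e} (?c w1 i) else 0)" for e i
    using I by (simp add: J_def lookup_sum lookup_single when_def)
  have J_coord: "J e \<in> coord_space I" for e
    by (simp add: coord_space_iff J)
  have J_int: "lookup (G t (J e)) i = integral {t..t + e} (?c w1 i)" for t e i
  proof -
    have "lookup (G t (J e)) i =
        (\<Sum>j\<in>I. integral {0..e} (?c w1 j) * lookup (G t (single j 1)) i)"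
      by (subst clinear_on_expand[OF lin I J_coord]) (simp add: lookup_sum J)
    also have "\<dots> = integral {0..e} (\<lambda>u. \<Sum>j\<in>I. ?c w1 j u * lookup (G t (single j 1)) i)"
      using int[OF w1] by (subst integral_sum[OF I]) (auto intro: integrable_on_mult_left)
    also have "\<dots> = integral {0..e} (\<lambda>u. ?c w1 i (u + t))"
    proof (rule integral_cong)
      fix u
      have "G (u + t) w1 = G t (G u w1)" using mult[OF w1, of t u] by (simp add: add.commute)
      then show "(\<Sum>j\<in>I. ?c w1 j u * lookup (G t (single j 1)) i) = ?c w1 i (u + t)"
        using clinear_on_expand[OF lin I into[OF w1, of u], of t] by (simp add: lookup_sum)
    qed
    also have "\<dots> = integral {t..t + e} (?c w1 i)"
      using integral_shift[where a = 0 and b = e and f = "?c w1 i" and c = t] continuous_on_subset[OF cont[OF w1, of i]] by (simp add: o_def add.commute)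
    finally show ?thesis .
  qed
  have "J e \<in> D" if e: "e > 0" for e
  proof -
    have "((\<lambda>t. lookup (G t (J e)) i) has_vector_derivative lookup (G e w1 - w1) i) (at 0)" for i
    proof -
      let ?A = "\<lambda>x. integral {-1..x} (?c w1 i)"
      have A: "(?A has_vector_derivative ?c w1 i x) (at x)" if "x \<in> {-1<..<e + 1}" for x
      proof -
        have "(?A has_vector_derivative ?c w1 i x) (at x within {-1..e + 1})"
          using that continuous_on_subset[OF cont[OF w1, of i]] by (intro integral_has_vector_derivative) auto
        moreover have "at x within {-1..e + 1} = at x" using that by (intro at_within_interior) (auto simp: interior_atLeastAtMost_real)
        ultimately show ?thesis by simp
      qed
      have "((\<lambda>t. t + e) has_real_derivative 1) (at 0)" by (auto intro!: derivative_eq_intros)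
      then have sh: "((\<lambda>t. t + e) has_vector_derivative 1) (at 0)"
        by (simp add: has_real_derivative_iff_has_vector_derivative)
      have "(?A has_vector_derivative ?c w1 i e) (at (0 + e))" using A[of e] e by simp
      from vector_diff_chain_at[OF sh this]
      have d: "((\<lambda>t. ?A (t + e) - ?A t) has_vector_derivative ?c w1 i e - ?c w1 i 0) (at 0)"
        using A[of 0] e by (intro has_vector_derivative_diff) (simp_all add: o_def)
      have eq: "?A (t + e) - ?A t = lookup (G t (J e)) i" if "t \<in> {-1<..<1}" for t
        using Henstock_Kurzweil_Integration.integral_combine[where a = "-1" and c = t and b = "t + e" and f = "?c w1 i"] int[OF w1, of i "-1" "t + e"] that e by (simp add: J_int algebra_simps)
      have "((\<lambda>t. lookup (G t (J e)) i) has_vector_derivative ?c w1 i e - ?c w1 i 0) (at 0)"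
        by (rule has_vector_derivative_transform_within_open[OF d, of "{-1<..<1}"]) (simp_all add: eq)
      then show ?thesis using G0[OF w1] by (simp add: lookup_minus)
    qed
    then show ?thesis
      unfolding D_def using J_coord into[OF w1, of e] w1 by (auto intro!: bexI[of _ "G e w1 - w1"] coord_space_closed)
  qed
  then have z: "(\<Sum>i\<in>I. integral {0..e} (?c w1 i) * lf (single i 1)) = 0" if "e > 0" for e
    using lf(2) lf_expand[OF J_coord, of e] that by (simp add: J)
  \<comment> \<open>the linear form along the orbit: all its integrals from 0 vanish, so its value at 0 does\<close>
  let ?k = "\<lambda>u. \<Sum>i\<in>I. ?c w1 i u * lf (single i 1)"
  have k0: "integral {0..e} ?k = 0" if "e \<in> {0..1}" for e
  proof (cases "e = 0")
    case False
    then show ?thesis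
      using z[of e] that int[OF w1] by (subst integral_sum[OF I]) (auto intro: integrable_on_mult_left)
  qed simp
  have "continuous_on {0..1} ?k"
    by (intro continuous_intros continuous_on_subset[OF cont[OF w1]]) simp
  then have "((\<lambda>e. integral {0..e} ?k) has_vector_derivative ?k 0) (at 0 within {0..1})"
    by (rule integral_has_vector_derivative) simp
  then have "((\<lambda>e. 0) has_vector_derivative ?k 0) (at 0 within {0..1})"
    by (rule has_vector_derivative_transform[rotated 2]) (use k0 in simp_all)
  then have "?k 0 = 0"
    using vector_derivative_unique_within_closed_interval[of 0 1 0 "\<lambda>_. 0" "?k 0" 0] by (simp add: cbox_interval)
  moreover have "?k 0 = 1" using lf_expand[OF w1] lf(3) G0[OF w1] by simp
  ultimately show False by simp
qed

lemma sgn_pow_mult: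
  assumes "a \<noteq> 0" "b \<noteq> 0"
  shows "sgn_pow \<alpha> s (a * b) = sgn_pow \<alpha> s a * sgn_pow \<alpha> s b"
proof -
  have "exp (s * complex_of_real (ln \<bar>a * b\<bar>)) = exp (s * complex_of_real (ln \<bar>a\<bar>)) * exp (s * complex_of_real (ln \<bar>b\<bar>))"
    using assms by (simp only: exp_add[symmetric]) (simp add: abs_mult ln_mult distrib_left)
  then show ?thesis by (simp add: sgn_pow_def sgn_mult)
qed

lemma P_rep_mult:
  fixes \<sigma> :: "real^'m^'m::finite \<Rightarrow> ('i \<Rightarrow>\<^sub>0 complex) \<Rightarrow> ('i \<Rightarrow>\<^sub>0 complex)"
  assumes fd: "fd_rep SLpm \<sigma> I" and "p \<in> P_grp" "q \<in> P_grp" "w \<in> coord_space I"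
  shows "P_rep \<beta> \<sigma> r (p ** q) w = P_rep \<beta> \<sigma> r p (P_rep \<beta> \<sigma> r q w)"
proof -
  obtain a b D where p: "p = mk_block a b D" and aD: "a * det D = 1" using assms unfolding P_grp_eq by blast
  obtain a' b' D' where q: "q = mk_block a' b' D'" and aD': "a' * det D' = 1" using assms unfolding P_grp_eq by blast
  have nz: "a \<noteq> 0" "a' \<noteq> 0" using aD aD' by auto
  let ?g = "exp (ln \<bar>a\<bar> / real CARD('m)) *\<^sub>R D" and ?g' = "exp (ln \<bar>a'\<bar> / real CARD('m)) *\<^sub>R D'"
  have pq: "(a * a') * det (D ** D') = 1" using aD aD' by (simp add: det_mul algebra_simps)
  have "exp (ln \<bar>a * a'\<bar> / real CARD('m)) = exp (ln \<bar>a\<bar> / real CARD('m)) * exp (ln \<bar>a'\<bar> / real CARD('m))"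
    using nz by (simp only: exp_add[symmetric]) (simp add: abs_mult ln_mult add_divide_distrib)
  then have "exp (ln \<bar>a * a'\<bar> / real CARD('m)) *\<^sub>R (D ** D') = ?g ** ?g'"
    by (simp add: vec_eq_iff matrix_matrix_mult_def sum_distrib_left mult_ac)
  moreover have "\<sigma> (?g ** ?g') w = \<sigma> ?g (\<sigma> ?g' w)" "\<sigma> ?g' w \<in> coord_space I" "clinear_on (coord_space I) (\<sigma> ?g)"
    using fd block_MAN(1)[OF aD] block_MAN(1)[OF aD'] assms(4) unfolding fd_rep_def by blast+
  ultimately show ?thesis
    unfolding p q mk_block_mult P_rep_sgn_pow[OF aD] P_rep_sgn_pow[OF aD'] P_rep_sgn_pow[OF pq]
    using nz by (simp add: clinear_on_def sgn_pow_mult mult.commute)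
qed

lemma P_rep_one: "fd_rep SLpm \<sigma> I \<Longrightarrow> w \<in> coord_space I \<Longrightarrow> P_rep \<beta> \<sigma> r (mat 1) w = w"
  for \<sigma> :: "real^'m^'m::finite \<Rightarrow> _"
proof -
  assume "fd_rep SLpm \<sigma> I" "w \<in> coord_space I"
  moreover have "1 * det (mat 1 :: real^'m^'m) = 1" by simp
  ultimately show ?thesis
    unfolding mk_block_one P_rep_sgn_pow[OF \<open>1 * det (mat 1 :: real^'m^'m) = 1\<close>] by (simp add: fd_repD(2))
qed

text \<open>Along a one-parameter subgroup the upper left entry \<open>a\<close> is positive, being the square of its
  value at half the parameter; this keeps \<open>ln a\<close> continuous.\<close>

lemma P_rep_continuous:
  fixes \<sigma> :: "real^'m^'m::finite \<Rightarrow> ('i \<Rightarrow>\<^sub>0 complex) \<Rightarrow> ('i \<Rightarrow>\<^sub>0 complex)"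
  assumes fd: "fd_rep SLpm \<sigma> I" and Y: "Y \<in> real_lie_P" and w: "w \<in> coord_space I"
  shows "continuous_on UNIV (\<lambda>t. lookup (P_rep \<beta> \<sigma> r (mat_exp (t *\<^sub>R Y)) w) i)"
proof (cases "i \<in> I")
  case True
  obtain a b D where e: "\<And>t. mat_exp (t *\<^sub>R Y) = mk_block (a t) (b t) (D t)" "\<And>t. a t * det (D t) = 1"
    using Y by (rule real_lie_P_curve) blast
  let ?g = "\<lambda>t. exp (ln (a t) / real CARD('m)) *\<^sub>R D t"
  have pos: "a t > 0" for t
  proof -
    have "mat_exp (t *\<^sub>R Y) = mat_exp ((t / 2) *\<^sub>R Y) ** mat_exp ((t / 2) *\<^sub>R Y)"
      by (simp flip: mat_exp_add)
    then have "a t = a (t / 2) * a (t / 2)" by (simp add: e(1) mk_block_mult mk_block_inject)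
    moreover have "a (t / 2) \<noteq> 0" using e(2)[of "t / 2"] by auto
    ultimately show ?thesis by (metis not_real_square_gt_zero)
  qed
  have ca: "continuous_on UNIV a" using mat_exp_continuous[of Y None None] by (simp add: e(1))
  have cD: "continuous_on UNIV (\<lambda>t. D t $ k $ l)" for k l
    using mat_exp_continuous[of Y "Some k" "Some l"] by (simp add: e(1))
  have cln: "continuous_on UNIV (\<lambda>t. ln (a t))"
    by (rule continuous_on_ln[OF ca]) (use pos in \<open>simp add: less_imp_neq[symmetric]\<close>)
  have "?g = (\<lambda>t. \<chi> k l. exp (ln (a t) / real CARD('m)) * D t $ k $ l)"
    by (auto simp: vec_eq_iff fun_eq_iff)
  then have cg: "continuous_on UNIV ?g"
    by (simp only:) (intro continuous_intros cln cD, simp)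
  have cs: "continuous_on UNIV (\<lambda>t. exp (r * complex_of_real (ln (a t))))"
    by (intro continuous_intros cln)
  have "continuous_on SLpm (\<lambda>g. lookup (\<sigma> g w) i)"
    using fd w True by (simp add: fd_rep_def)
  then have "continuous_on UNIV (\<lambda>t. lookup (\<sigma> (?g t) w) i)"
    by (rule continuous_on_compose2[OF _ cg]) (use block_MAN(1)[OF e(2)] pos in \<open>auto simp: abs_of_pos\<close>)
  with cs have "continuous_on UNIV (\<lambda>t. exp (r * complex_of_real (ln (a t))) * lookup (\<sigma> (?g t) w) i)"
    by (rule continuous_on_mult)
  then show ?thesis
    by (simp add: e(1) P_rep_sgn_pow[OF e(2)] sgn_pow_def abs_of_pos[OF pos] sgn_pos[OF pos] cong: if_cong)
next
  case False
  have "mat_exp (t *\<^sub>R Y) \<in> P_grp" for t using Y by (simp add: real_lie_P_def)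
  from P_rep_lin(2)[OF fd this w] False
  have "lookup (P_rep \<beta> \<sigma> r (mat_exp (t *\<^sub>R Y)) w) i = 0" for t
    by (auto simp: coord_space_iff)
  then show ?thesis by simp
qed

text \<open>The representation is differentiable along one-parameter subgroups, so the derivatives in the
  definition of \<open>real_differential\<close> exist and their values are not arbitrary.\<close>

lemma real_differential_P_rep:
  fixes \<sigma> :: "real^'m^'m::finite \<Rightarrow> ('i \<Rightarrow>\<^sub>0 complex) \<Rightarrow> ('i \<Rightarrow>\<^sub>0 complex)" and \<beta> :: int and r :: complex
  assumes fd: "fd_rep SLpm \<sigma> I" and Y: "Y \<in> real_lie_P" and w: "w \<in> coord_space I"
  defines "\<pi> \<equiv> P_rep \<beta> \<sigma> r"
  shows "real_differential \<pi> Y w \<in> coord_space I"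
    "((\<lambda>t. lookup (\<pi> (mat_exp (t *\<^sub>R Y)) w) i) has_vector_derivative
      lookup (real_differential \<pi> Y w) i) (at 0)"
proof -
  have P: "mat_exp (t *\<^sub>R Y) \<in> P_grp" for t using Y by (simp add: real_lie_P_def)
  have "\<exists>F\<in>coord_space I. \<forall>i. ((\<lambda>t. lookup (\<pi> (mat_exp (t *\<^sub>R Y)) w) i)
      has_vector_derivative lookup F i) (at 0)"
    unfolding \<pi>_def
  proof (rule one_parameter_group_differentiable[OF _ _ _ _ _ _ w])
    show "finite I" using fd by (simp add: fd_rep_def)
    show "P_rep \<beta> \<sigma> r (mat_exp (0 *\<^sub>R Y)) v = v" if "v \<in> coord_space I" for v
      using P_rep_one[OF fd that] by simp
    show "P_rep \<beta> \<sigma> r (mat_exp ((s + t) *\<^sub>R Y)) v =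
        P_rep \<beta> \<sigma> r (mat_exp (s *\<^sub>R Y)) (P_rep \<beta> \<sigma> r (mat_exp (t *\<^sub>R Y)) v)" if "v \<in> coord_space I" for s t v
      unfolding mat_exp_add by (rule P_rep_mult[OF fd P P that])
  qed (use P_rep_lin[OF fd P] P_rep_continuous[OF fd Y] in auto)
  then obtain F where F: "F \<in> coord_space I"
    "\<And>i. ((\<lambda>t. lookup (\<pi> (mat_exp (t *\<^sub>R Y)) w) i) has_vector_derivative lookup F i) (at 0)"
    by blast
  have "real_differential \<pi> Y w = F" by (intro real_differentialI F(2))
  then show "real_differential \<pi> Y w \<in> coord_space I"
    "((\<lambda>t. lookup (\<pi> (mat_exp (t *\<^sub>R Y)) w) i) has_vector_derivative
      lookup (real_differential \<pi> Y w) i) (at 0)"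
    using F by simp_all
qed

lemma real_differential_Ad:
  fixes \<sigma> :: "real^'m^'m::finite \<Rightarrow> ('i \<Rightarrow>\<^sub>0 complex) \<Rightarrow> ('i \<Rightarrow>\<^sub>0 complex)" and \<beta> :: int and r :: complex
  assumes fd: "fd_rep SLpm \<sigma> I" and Y: "Y \<in> real_lie_P" and w: "w \<in> coord_space I"
    and p: "p \<in> P_grp" and q: "q \<in> P_grp" "p ** q = mat 1" "q ** p = mat 1"
  defines "\<pi> \<equiv> P_rep \<beta> \<sigma> r"
  shows "real_differential \<pi> (p ** Y ** q) (\<pi> p w) = \<pi> p (real_differential \<pi> Y w)"
proof (rule real_differentialI)
  fix i
  note fin = fd_repD(1)[OF fd]
  note \<pi>lin = P_rep_lin[OF fd p, where \<beta> = \<beta> and r = r, folded \<pi>_def]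
  note rd = real_differential_P_rep[OF fd Y w, where \<beta> = \<beta> and r = r, folded \<pi>_def]
  have P: "mat_exp (t *\<^sub>R Y) \<in> P_grp" for t using Y by (simp add: real_lie_P_def)
  have "\<pi> (mat_exp (t *\<^sub>R (p ** Y ** q))) (\<pi> p w) = \<pi> p (\<pi> (mat_exp (t *\<^sub>R Y)) w)" for t
  proof -
    have "t *\<^sub>R (p ** Y ** q) = p ** (t *\<^sub>R Y) ** q"
      by (simp add: vec_eq_iff matrix_matrix_mult_def sum_distrib_left sum_distrib_right mult_ac)
    then have e: "mat_exp (t *\<^sub>R (p ** Y ** q)) = p ** mat_exp (t *\<^sub>R Y) ** q"
      by (simp add: mat_exp_conj q)
    have "\<pi> (mat_exp (t *\<^sub>R (p ** Y ** q))) (\<pi> p w) = \<pi> (p ** mat_exp (t *\<^sub>R Y) ** q ** p) w"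
      unfolding e \<pi>_def by (rule P_rep_mult[OF fd P_grp_mult[OF P_grp_mult[OF p P] q(1)] p w, symmetric])
    also have "p ** mat_exp (t *\<^sub>R Y) ** q ** p = p ** mat_exp (t *\<^sub>R Y)"
      by (simp add: q(3) flip: matrix_mul_assoc)
    also have "\<pi> \<dots> w = \<pi> p (\<pi> (mat_exp (t *\<^sub>R Y)) w)"
      unfolding \<pi>_def by (rule P_rep_mult[OF fd p P w])
    finally show ?thesis .
  qed
  moreover have "\<pi> (mat_exp (t *\<^sub>R Y)) w \<in> coord_space I" for t
    unfolding \<pi>_def by (rule P_rep_lin(2)[OF fd P w])
  ultimately have "lookup (\<pi> (mat_exp (t *\<^sub>R (p ** Y ** q))) (\<pi> p w)) i =
      (\<Sum>j\<in>I. lookup (\<pi> (mat_exp (t *\<^sub>R Y)) w) j * lookup (\<pi> p (single j 1)) i)" for t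
    using clinear_on_expand[of I "\<pi> p", OF \<pi>lin(1) fin] by (simp add: lookup_sum)
  moreover have "lookup (\<pi> p (real_differential \<pi> Y w)) i =
      (\<Sum>j\<in>I. lookup (real_differential \<pi> Y w) j * lookup (\<pi> p (single j 1)) i)"
    using clinear_on_expand[of I "\<pi> p", OF \<pi>lin(1) fin rd(1)] by (simp add: lookup_sum)
  ultimately show "((\<lambda>t. lookup (\<pi> (mat_exp (t *\<^sub>R (p ** Y ** q))) (\<pi> p w)) i) has_vector_derivative
      lookup (\<pi> p (real_differential \<pi> Y w)) i) (at 0)"
    by (simp only:) (intro has_vector_derivative_sum has_vector_derivative_mult_left rd(2))
qed

lemma differential_Ad:
  fixes \<sigma> :: "real^'m^'m::finite \<Rightarrow> ('i \<Rightarrow>\<^sub>0 complex) \<Rightarrow> ('i \<Rightarrow>\<^sub>0 complex)" and \<beta> :: int and r :: complex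
  assumes fd: "fd_rep SLpm \<sigma> I" and X: "X \<in> lie_p" and w: "w \<in> coord_space I" and p: "p \<in> P_grp"
  defines "\<pi> \<equiv> P_rep \<beta> \<sigma> r"
  shows "differential \<pi> X w \<in> coord_space I"
    "differential \<pi> (Ad_sl p X) (\<pi> p w) = \<pi> p (differential \<pi> X w)"
proof -
  obtain q where q: "q \<in> P_grp" "p ** q = mat 1" "q ** p = mat 1" using P_grp_inverse p by blast
  let ?A = "Re_mat (mat_of_sl X)" and ?B = "Im_mat (mat_of_sl X)"
  have AB: "?A \<in> real_lie_P" "?B \<in> real_lie_P" using X by (simp_all add: lie_p_def)
  note c = real_differential_P_rep(1)[OF fd AB(1) w, where \<beta> = \<beta> and r = r, folded \<pi>_def]
    real_differential_P_rep(1)[OF fd AB(2) w, where \<beta> = \<beta> and r = r, folded \<pi>_def]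
  show "differential \<pi> X w \<in> coord_space I"
    unfolding differential_def by (intro coord_space_closed c)
  have "Re_mat (cmat p ** A ** cmat q) = p ** Re_mat A ** q" "Im_mat (cmat p ** A ** cmat q) = p ** Im_mat A ** q" for A
    by (simp_all add: vec_eq_iff Re_mat_def Im_mat_def cmat_def matrix_matrix_mult_def Re_sum Im_sum)
  then have "differential \<pi> (Ad_sl p X) (\<pi> p w) = \<pi> p (real_differential \<pi> ?A w) + cscale \<i> (\<pi> p (real_differential \<pi> ?B w))"
    unfolding differential_def Ad_sl_mat[OF q(2,3)] \<pi>_def
    by (simp add: real_differential_Ad[OF fd _ w p q] AB)
  also have "\<dots> = \<pi> p (differential \<pi> X w)"
    using P_rep_lin(1)[OF fd p, where \<beta> = \<beta> and r = r, folded \<pi>_def] c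
    unfolding differential_def clinear_on_def by (simp add: coord_space_closed)
  finally show "differential \<pi> (Ad_sl p X) (\<pi> p w) = \<pi> p (differential \<pi> X w)" .
qed

text \<open>The group action is well defined on cosets: \<open>Ad(p)\<close> and \<open>\<pi>(p)\<close> transform the relation between
  \<open>u X \<otimes> w\<close> and \<open>u \<otimes> X w\<close> into the same relation for \<open>Ad(p) X\<close>, which is the compatibility
  \<open>differential_Ad\<close>.\<close>

lemma ind_act_balance:
  fixes \<sigma> :: "real^'m^'m::finite \<Rightarrow> ('i \<Rightarrow>\<^sub>0 complex) \<Rightarrow> ('i \<Rightarrow>\<^sub>0 complex)" and \<beta> :: int and r :: complex
  assumes fd: "fd_rep SLpm \<sigma> I" and p: "p \<in> P_grp"
  defines "\<pi> \<equiv> P_rep \<beta> \<sigma> r"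
  assumes x: "x \<in> balance \<pi> I"
  shows "ind_act \<pi> I p x \<in> balance \<pi> I"
proof -
  note lin = P_rep_lin[OF fd p, where \<beta> = \<beta> and r = r, folded \<pi>_def]
  note fin = fd_repD(1)[OF fd]
  note dAd = differential_Ad[OF fd _ _ p, where \<beta> = \<beta> and r = r, folded \<pi>_def]
  have fold: "foldr (differential \<pi>) Xs w \<in> coord_space I \<and>
      foldr (differential \<pi>) (map (Ad_sl p) Xs) (\<pi> p w) = \<pi> p (foldr (differential \<pi>) Xs w)"
    if "set Xs \<subseteq> lie_p" "w \<in> coord_space I" for Xs w
    using that(1) by (induction Xs) (simp_all add: dAd that(2))
  have diff: "ind_act \<pi> I p (x - y) = ind_act \<pi> I p x - ind_act \<pi> I p y" for x y :: "'i \<Rightarrow>\<^sub>0 'm uea"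
    by (metis ind_act_add add_diff_cancel_right' diff_add_cancel)
  have "balance \<pi> I \<subseteq> {x. ind_act \<pi> I p x \<in> balance \<pi> I}"
  proof (rule balance_subsetI)
    have "ind_act \<pi> I p 0 = 0" using diff[of 0 0] by simp
    then show "uea_mod.subspace {x. ind_act \<pi> I p x \<in> balance \<pi> I}"
      unfolding uea_mod.subspace_def by (simp add: balance_0 ind_act_add balance_add ind_act_act balance_scale)
    fix u :: "'m uea" and Xs and w :: "'i \<Rightarrow>\<^sub>0 complex" assume Xs: "set Xs \<subseteq> (lie_p :: 'm sl set)" and w: "w \<in> coord_space I"
    note f = fold[OF Xs w]
    have "Ad_uea p (prod_list (map uea_of Xs)) = prod_list (map uea_of (map (Ad_sl p) Xs))"
      by (induction Xs) (simp_all add: Ad_uea_mult Ad_uea_of)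
    then have "ind_act \<pi> I p (tensor (u * prod_list (map uea_of Xs)) w - tensor u (foldr (differential \<pi>) Xs w)) =
      tensor (Ad_uea p u * prod_list (map uea_of (map (Ad_sl p) Xs))) (\<pi> p w) -
      tensor (Ad_uea p u) (foldr (differential \<pi>) (map (Ad_sl p) Xs) (\<pi> p w))"
      unfolding diff conjunct2[OF f] ind_act_tensor[of I \<pi> p, OF lin(1) fin w]
        ind_act_tensor[of I \<pi> p, OF lin(1) fin conjunct1[OF f]] Ad_uea_mult by (simp only:)
    also have "\<dots> \<in> balance \<pi> I"
      by (rule balance_gen[OF _ lin(2)[OF w]]) (use Xs Ad_lie_p[OF _ p] in auto)
    finally show "tensor (u * prod_list (map uea_of Xs)) w - tensor u (foldr (differential \<pi>) Xs w) \<in>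
        {x. ind_act \<pi> I p x \<in> balance \<pi> I}" by simp
  qed
  then show ?thesis using x by blast
qed

lemma fd_rep_triv: "fd_rep H triv_rep UNIV"
  by (simp add: fd_rep_def triv_rep_def clinear_on_def)

lemma fd_rep_sym: "fd_rep H (sym_rep :: real^'m^'m::finite \<Rightarrow> _) (Xi k)"
proof -
  have "continuous_on H (\<lambda>g. lookup (sym_rep g w) \<kappa>)" for w :: "'m pol" and \<kappa>
  proof (induction w arbitrary: \<kappa> rule: pol_induct)
    case (xvar j f)
    have "lookup (sym_rep g (xvar j * f)) \<kappa> = (\<Sum>i\<in>UNIV. complex_of_real (g $ i $ j) *
      (if lookup \<kappa> i = 0 then 0 else lookup (sym_rep g f) (\<kappa> - uexp i)))" for g
      by (simp add: sym_rep_xvar lin_form_def sum_distrib_right mult_cscale lookup_sum lookup_xvar_mult)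
    moreover have "continuous_on H (\<lambda>g. if lookup \<kappa> i = 0 then 0 else lookup (sym_rep g f) (\<kappa> - uexp i))" for i
      using xvar by (cases "lookup \<kappa> i = 0") simp_all
    ultimately show ?case by (simp only:) (intro continuous_intros)
  qed (simp_all add: sym_rep_add lookup_add continuous_on_add)
  then show ?thesis
    by (auto simp: fd_rep_def finite_Xi clinear_on_def sym_rep_add sym_rep_cscale sym_rep_Pol sym_rep_comp)
qed

section \<open>Homomorphisms into the scalar module\<close>

lemma single_coord: "i \<in> I \<Longrightarrow> single i (1::complex) \<in> coord_space I"
  by (auto simp: coord_space_iff lookup_single when_def)

lemma tensor_coord: "w \<in> coord_space I \<Longrightarrow> tensor u w \<in> coord_space I"
  by (auto simp: coord_space_iff) (metis uea_const_0 mult_zero_left)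

lemma uea_act_coord: "x \<in> coord_space I \<Longrightarrow> uea_act u x \<in> coord_space I"
  by (auto simp: coord_space_iff) (metis mult_zero_right)

lemma coord_add: "x \<in> coord_space I \<Longrightarrow> y \<in> coord_space I \<Longrightarrow> x + y \<in> coord_space I"
  for x :: "'i \<Rightarrow>\<^sub>0 'm::finite uea"
  by (auto simp: coord_space_iff lookup_add) (metis add.right_neutral)

lemma coord_zero: "0 \<in> coord_space I"
  by (simp add: coord_space_iff)

lemma coord_expand:
  fixes x :: "'i \<Rightarrow>\<^sub>0 'm::finite uea"
  assumes "finite I" "x \<in> coord_space I"
  shows "x = (\<Sum>i\<in>I. tensor (lookup x i) (single i 1))"
proof (rule poly_mapping_eqI)
  fix k
  have "(\<Sum>i\<in>I. uea_const (lookup (single i 1) k) * lookup x i) =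
      (\<Sum>i\<in>I. if i = k then lookup x i else 0)"
    by (rule sum.cong) (auto simp: lookup_single when_def)
  then show "lookup x k = lookup (\<Sum>i\<in>I. tensor (lookup x i) (single i 1)) k"
    using assms by (auto simp: lookup_sum coord_space_iff)
qed

lemma differential_n_plus:
  fixes \<sigma> :: "real^'m^'m \<Rightarrow> ('i \<Rightarrow>\<^sub>0 complex) \<Rightarrow> ('i \<Rightarrow>\<^sub>0 complex)" and j :: "'m::finite"
  assumes "fd_rep SLpm \<sigma> I" "w \<in> coord_space I"
  shows "differential (P_rep \<beta> \<sigma> r) (gen_p None j) w = 0"
proof -
  have \<pi>: "P_rep \<beta> \<sigma> r (mk_block 1 b (mat 1)) w = w" for b
  proof -
    have "1 * det (mat 1 :: real^'m^'m) = 1" by simp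
    show ?thesis
      unfolding P_rep_sgn_pow[OF \<open>1 * det (mat 1 :: real^'m^'m) = 1\<close>] using assms by (simp add: fd_repD(2))
  qed
  have "mat_exp (t *\<^sub>R Re_mat (mat_of_sl (gen_p None j))) = mk_block 1 (\<chi> l. if l = j then t else 0) (mat 1)" for t
  proof -
    let ?Y = "t *\<^sub>R Re_mat (mat_of_sl (gen_p None j))"
    have Y: "?Y = mk_block 0 (\<chi> l. if l = j then t else 0) 0"
      by (rule option_mat_eqI) (auto simp: Re_mat_def gen_p.rep_eq unit_mat_def)
    have "?Y ** ?Y = 0"
      unfolding Y by (rule option_mat_eqI) (simp_all add: matrix_matrix_mult_def sum_option_UNIV)
    then have "mat_exp ?Y = mat 1 + ?Y" by (rule mat_exp_nilpotent)
    then show ?thesis unfolding Y by (simp add: mk_block_one) (rule option_mat_eqI; simp)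
  qed
  then have "real_differential (P_rep \<beta> \<sigma> r) (Re_mat (mat_of_sl (gen_p None j))) w = 0"
    by (intro real_differentialI) (simp add: \<pi>)
  moreover have "Im_mat (mat_of_sl (gen_p None j)) = 0"
    by (auto simp: Im_mat_def gen_p.rep_eq unit_mat_def vec_eq_iff)
  then have "real_differential (P_rep \<beta> \<sigma> r) (Im_mat (mat_of_sl (gen_p None j))) w = 0"
    by (intro real_differentialI) (simp add: \<pi> mk_block_one)
  ultimately show ?thesis by (simp add: differential_def)
qed

lemma rho_n_plus: "rho s (mat_of_sl (gen_p None j)) f = deg_op s (pdiff j f)"
proof -
  have "(\<Sum>l\<in>UNIV. cscale (mat_of_sl (gen_p None j) $ None $ Some l) (deg_op s (pdiff l f))) =
      (\<Sum>l\<in>UNIV. if l = j then deg_op s (pdiff l f) else 0)"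
    by (rule sum.cong) (auto simp: gen_p.rep_eq unit_mat_def)
  then show ?thesis
    by (simp add: rho_expand lin_vf_def) (simp add: gen_p.rep_eq unit_mat_def)
qed

lemma sym_rep_inj:
  fixes h :: "real^'m^'m::finite"
  assumes "det h \<noteq> 0" "sym_rep h f = 0"
  shows "f = 0"
proof -
  obtain h' where "h' ** h = mat 1"
    using assms(1) by (metis invertible_def invertible_det_nz)
  then have "f = sym_rep h' (sym_rep h f)" by (simp add: sym_rep_comp)
  then show ?thesis using assms(2) by simp
qed

text \<open>The restriction of a homomorphism to the inducing space \<open>1 \<otimes> W\<close>, with values in the polynomial
  model.\<close>

definition top_map :: "complex \<Rightarrow> (real^('m option)^('m::finite option) \<Rightarrow> ('i \<Rightarrow>\<^sub>0 complex) \<Rightarrow> ('i \<Rightarrow>\<^sub>0 complex)) \<Rightarrow> 'i set \<Rightarrow>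
    (('i \<Rightarrow>\<^sub>0 'm uea) set \<Rightarrow> (unit \<Rightarrow>\<^sub>0 'm uea) set) \<Rightarrow> ('i \<Rightarrow>\<^sub>0 complex) \<Rightarrow> 'm pol" where
  "top_map s \<pi> I f w = valC s (f (coset (balance \<pi> I) (tensor 1 w)))"

text \<open>The analysis of an arbitrary homomorphism \<open>f\<close> into the scalar module, expressed through its
  restriction \<open>\<phi>\<close>, which determines it (\<open>val_expand\<close>, \<open>f_eqI\<close>).\<close>

locale verma_hom =
  fixes \<alpha> \<beta> :: int and r s :: complex
    and \<sigma> :: "real^'m^'m \<Rightarrow> ('i \<Rightarrow>\<^sub>0 complex) \<Rightarrow> ('i \<Rightarrow>\<^sub>0 complex)" and I :: "'i set"
    and f :: "('i \<Rightarrow>\<^sub>0 'm::finite uea) set \<Rightarrow> (unit \<Rightarrow>\<^sub>0 'm uea) set"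
  assumes fd: "fd_rep SLpm \<sigma> I" and f: "f \<in> Hom_gP (verma \<sigma> I r \<beta>) (verma_triv s \<alpha>)"
begin

abbreviation "\<pi> \<equiv> P_rep \<beta> \<sigma> r"
abbreviation "R \<equiv> balance \<pi> I"
abbreviation "M \<equiv> verma \<sigma> I r \<beta>"
abbreviation "N \<equiv> (verma_triv s \<alpha> :: ('m, _) gP_module)"
abbreviation "\<phi> \<equiv> top_map s \<pi> I f"

definition val :: "('i \<Rightarrow>\<^sub>0 'm uea) \<Rightarrow> 'm pol" where
  "val x = valC s (f (coset R x))"

lemma finite_I: "finite I"
  by (rule fd_repD(1)[OF fd])

lemma carrI: "x \<in> coord_space I \<Longrightarrow> coset R x \<in> carr M"
  by (simp add: verma_simps)

lemma f_carr: "C \<in> carr M \<Longrightarrow> f C \<in> carr N"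
  using f by (auto simp: Hom_gP_def)

lemma val_add: "x \<in> coord_space I \<Longrightarrow> y \<in> coord_space I \<Longrightarrow> val (x + y) = val x + val y"
proof -
  assume x: "x \<in> coord_space I" and y: "y \<in> coord_space I"
  have "f (madd M (coset R x) (coset R y)) = madd N (f (coset R x)) (f (coset R y))"
    using f carrI[OF x] carrI[OF y] by (simp add: Hom_gP_def)
  then show ?thesis
    using valC_ops(1)[OF f_carr[OF carrI[OF x]] f_carr[OF carrI[OF y]]] by (simp add: verma_simps(3) val_def)
qed

lemma val_const: "x \<in> coord_space I \<Longrightarrow> val (uea_act (uea_const c) x) = cscale c (val x)"
proof -
  assume x: "x \<in> coord_space I"
  have "f (mscale M c (coset R x)) = mscale N c (f (coset R x))"
    using f carrI[OF x] by (simp add: Hom_gP_def)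
  then show ?thesis
    using valC_ops(2)[OF f_carr[OF carrI[OF x]] f_carr[OF carrI[OF x]]] by (simp add: verma_simps(4) val_def)
qed

lemma val_lie: "x \<in> coord_space I \<Longrightarrow> val (uea_act (uea_of X) x) = rho s (mat_of_sl X) (val x)"
proof -
  assume x: "x \<in> coord_space I"
  have "f (lie_act M X (coset R x)) = lie_act N X (f (coset R x))"
    using f carrI[OF x] by (simp add: Hom_gP_def)
  then show ?thesis
    using valC_ops(3)[OF f_carr[OF carrI[OF x]] f_carr[OF carrI[OF x]]] by (simp add: verma_simps(5) val_def)
qed

lemma val_act:
  assumes "x \<in> coord_space I"
  shows "val (uea_act u x) = uact s u (val x)"
proof (induction u rule: uea_induct)
  case (of X u)
  then show ?case using assms by (simp add: uea_act_mult val_lie uea_act_coord uact_mult uact_of)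
next
  case (add u v)
  have "uea_act (u + v) x = uea_act u x + uea_act v x"
    by (rule poly_mapping_eqI) (simp add: lookup_add distrib_right)
  then show ?case using add assms by (simp add: val_add uea_act_coord uact_add)
qed (simp add: assms val_const uact_const)

lemma val_zero: "val 0 = 0"
  using val_const[of 0 0] by (simp add: coord_zero)

lemma val_tensor: "w \<in> coord_space I \<Longrightarrow> val (tensor u w) = uact s u (\<phi> w)"
  using val_act[of "tensor 1 w" u] by (simp add: uea_act_tensor tensor_coord top_map_def val_def)

lemma val_expand:
  assumes "x \<in> coord_space I"
  shows "val x = (\<Sum>i\<in>I. uact s (lookup x i) (\<phi> (single i 1)))"
proof -
  have S: "(\<Sum>i\<in>S. tensor (lookup x i) (single i 1)) \<in> coord_space I \<and>
      val (\<Sum>i\<in>S. tensor (lookup x i) (single i 1)) =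
      (\<Sum>i\<in>S. uact s (lookup x i) (\<phi> (single i 1)))" if "S \<subseteq> I" for S
    using finite_subset[OF that finite_I] that
    by (induction S rule: finite_induct)
      (auto simp: val_zero coord_zero coord_add tensor_coord single_coord val_add val_tensor)
  show ?thesis using S[of I] unfolding coord_expand[OF finite_I assms, symmetric] by simp
qed

lemma phi_clinear: "clinear_on (coord_space I) \<phi>"
proof -
  have "\<phi> w = val (tensor 1 w)" for w by (simp add: top_map_def val_def)
  then show ?thesis
    by (simp add: clinear_on_def tensor_add_right val_add tensor_coord tensor_cscale val_const)
qed

text \<open>Elements of \<open>n\<^sub>+\<close> act by zero on \<open>W\<close>, so \<open>N\<^sub>j\<^sup>+ \<otimes> w\<close> is zero in the Verma module.\<close>

lemma phi_n_plus:
  assumes w: "w \<in> coord_space I"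
  shows "deg_op s (pdiff j (\<phi> w)) = 0"
proof -
  have "tensor (1 * prod_list (map uea_of [gen_p None j])) w - tensor 1 (foldr (differential \<pi>) [gen_p None j] w) \<in> R"
    by (rule balance_gen) (simp_all add: gen_p_lie_p w)
  moreover have "tensor (1 :: 'm uea) (0 :: 'i \<Rightarrow>\<^sub>0 complex) = 0" by (rule poly_mapping_eqI) simp
  ultimately have "tensor (uea_of (gen_p None j)) w \<in> R"
    by (simp add: differential_n_plus[OF fd w])
  then have "coset R (tensor (uea_of (gen_p None j)) w) = coset R 0"
    by (simp add: coset_eq_iff add_subgroup_balance)
  then have "val (tensor (uea_of (gen_p None j)) w) = 0"
    using val_zero by (simp add: val_def)
  then show ?thesis by (simp add: val_tensor[OF w] uact_of rho_n_plus)
qed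

lemma phi_levi:
  fixes D :: "real^'m^'m"
  assumes aD: "a * det D = 1" and w: "w \<in> coord_space I"
  shows "\<phi> (\<pi> (mk_block a 0 D) w) = cscale (sgn_pow \<alpha> s a) (sym_rep (inverse a *\<^sub>R D) (\<phi> w))"
proof -
  let ?p = "mk_block a 0 D"
  have p: "?p \<in> P_grp" unfolding P_grp_eq using aD by blast
  note \<pi>lin = P_rep_lin[OF fd p, where \<beta> = \<beta> and r = r]
  have Gam: "valC s (grp_act N ?p (f C)) = cscale (sgn_pow \<alpha> s a) (sym_rep (inverse a *\<^sub>R D) (valC s (f C)))"
    if "C \<in> carr M" for C
    using valC_ops(4)[OF f_carr[OF that] f_carr[OF that] p] by (simp add: uact_Ad_levi[OF aD])
  have hom: "f (grp_act M ?p C) = grp_act N ?p (f C)" if "C \<in> carr M" for C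
    using f p that by (simp add: Hom_gP_def)
  have "grp_act M ?p (coset R (tensor 1 w)) = coset R (tensor 1 (\<pi> ?p w))"
    unfolding verma_simps(6) using ind_act_balance[OF fd p]
    by (subst coset_map_coset[OF add_subgroup_balance ind_act_add])
      (simp_all add: balance_0 ind_act_tensor[of I \<pi> ?p, OF \<pi>lin(1) finite_I w])
  then show ?thesis
    using Gam[OF carrI[OF tensor_coord[OF w, of 1]]] hom[OF carrI[OF tensor_coord[OF w, of 1]]]
    by (simp add: top_map_def)
qed

end

lemma weight_nonzero: "1 + 1 / of_nat CARD('m::finite) \<noteq> (0::complex)"
proof -
  have "0 < 1 + 1 / real CARD('m)" by (intro add_pos_nonneg) simp_all
  then have "complex_of_real (1 + 1 / real CARD('m)) \<noteq> 0" unfolding of_real_eq_0_iff by linarith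
  then show ?thesis by (simp only: of_real_add of_real_1 of_real_divide of_real_of_nat_eq not_False_eq_True)
qed

lemma exp_all_eq:
  fixes a b :: complex
  assumes "\<And>t. exp (a * complex_of_real t) = exp (b * complex_of_real t)"
  shows "a = b"
proof -
  have "((\<lambda>t. exp (c * complex_of_real t)) has_vector_derivative c) (at 0)" for c
  proof -
    have "((\<lambda>z. exp (c * z)) has_field_derivative c) (at (complex_of_real 0))"
      by (auto intro!: derivative_eq_intros)
    then show ?thesis by (rule has_vector_derivative_real_field)
  qed
  from this[of a] this[of b] show ?thesis unfolding assms by (rule vector_derivative_unique_at)
qed

context verma_hom
begin

text \<open>Compare the actions of \<open>A\<close> on \<open>w\<close> and on the monomial \<open>\<kappa>\<close> of \<open>\<phi> w\<close>: the first is \<open>e\<^sup>r\<^sup>t\<close>, the second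
  \<open>e\<^sup>s\<^sup>t\<close> times the \<open>d\<close>-th power, \<open>d\<close> the degree of \<open>\<kappa>\<close>, of \<open>e\<^sup>-\<^sup>(\<^sup>1\<^sup>+\<^sup>1\<^sup>/\<^sup>m\<^sup>)\<^sup>t\<close>.\<close>

lemma phi_weight:
  assumes w: "w \<in> coord_space I" and nz: "lookup (\<phi> w) \<kappa> \<noteq> 0"
  shows "r = s - of_nat (mdeg \<kappa>) * (1 + 1 / of_nat CARD('m))"
proof (rule exp_all_eq)
  fix t :: real
  let ?m = "real CARD('m)"
  let ?D = "exp (- t / ?m) *\<^sub>R (mat 1 :: real^'m^'m)"
  have "exp (- t / ?m) ^ CARD('m) = exp (- t)" by (simp flip: exp_of_nat_mult)
  then have aD: "exp t * det ?D = 1" by (simp add: det_scaleR exp_minus)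
  have "exp (ln \<bar>exp t\<bar> / ?m) *\<^sub>R ?D = (mat 1 :: real^'m^'m)" by (simp add: exp_minus)
  then have "\<pi> (mk_block (exp t) 0 ?D) w = cscale (exp (r * complex_of_real t)) w"
    unfolding P_rep_sgn_pow[OF aD] using fd w by (simp add: sgn_pow_def fd_repD(2))
  then have e: "cscale (exp (r * complex_of_real t)) (\<phi> w) =
      cscale (exp (s * complex_of_real t)) (sym_rep (inverse (exp t) *\<^sub>R ?D) (\<phi> w))"
    using phi_levi[OF aD w] phi_clinear w by (simp add: sgn_pow_def clinear_on_def)
  have "inverse (exp t) *\<^sub>R ?D = diagm (\<lambda>_. exp (- (1 + 1 / ?m) * t))"
    by (simp add: vec_eq_iff diagm_def mat_def algebra_simps exp_diff exp_minus divide_inverse)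
  then have "lookup (sym_rep (inverse (exp t) *\<^sub>R ?D) (\<phi> w)) \<kappa> =
      complex_of_real (exp (- (1 + 1 / ?m) * t)) ^ mdeg \<kappa> * lookup (\<phi> w) \<kappa>"
    by (simp only: sym_rep_diagm wt_const)
  also have "complex_of_real (exp (- (1 + 1 / ?m) * t)) ^ mdeg \<kappa> =
      exp (- of_nat (mdeg \<kappa>) * (1 + 1 / of_nat CARD('m)) * complex_of_real t)"
    by (simp add: algebra_simps flip: exp_of_real exp_of_nat_mult)
  finally have "exp (r * complex_of_real t) = exp (s * complex_of_real t) *
      exp (- of_nat (mdeg \<kappa>) * (1 + 1 / of_nat CARD('m)) * complex_of_real t)"
    using arg_cong[OF e, of "\<lambda>h. lookup h \<kappa>"] nz by simp
  then show "exp (r * complex_of_real t) =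
      exp ((s - of_nat (mdeg \<kappa>) * (1 + 1 / of_nat CARD('m))) * complex_of_real t)"
    by (simp only: exp_add[symmetric]) (simp add: algebra_simps)
qed

text \<open>A variable \<open>x\<^sub>j\<close> that divides \<open>\<kappa>\<close> gives a nonzero coefficient of \<open>\<partial>\<^sub>j (\<phi> w)\<close> at \<open>\<kappa>/x\<^sub>j\<close>, on which
  \<open>s - E\<close> acts by \<open>s - d + 1\<close>, \<open>d\<close> being the degree of \<open>\<kappa>\<close>.\<close>

lemma phi_degree:
  assumes w: "w \<in> coord_space I" and nz: "lookup (\<phi> w) \<kappa> \<noteq> 0" and "mdeg \<kappa> \<noteq> 0"
  shows "s = of_nat (mdeg \<kappa>) - 1"
proof -
  obtain j where j: "lookup \<kappa> j \<noteq> 0"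
    using assms(3) by (metis mdeg_def sum.neutral)
  let ?\<mu> = "\<kappa> - uexp j"
  have "?\<mu> + uexp j = \<kappa>" using unit_exponent_decomp[OF j] by (simp add: add.commute)
  moreover have "lookup (deg_op s (pdiff j (\<phi> w))) ?\<mu> = 0" using phi_n_plus[OF w] by simp
  ultimately have "(s - of_nat (mdeg ?\<mu>)) * (of_nat (lookup ?\<mu> j + 1) * lookup (\<phi> w) \<kappa>) = 0"
    by (simp only: deg_op.rep_eq pdiff.rep_eq)
  then have "s = of_nat (mdeg ?\<mu>)" using nz by (simp del: of_nat_add of_nat_Suc)
  then show ?thesis using mdeg_minus[OF j, symmetric] by simp
qed

text \<open>The factor \<open>det(g)\<^sup>d\<close> appears because \<open>M_elem g\<close> acts on \<open>n\<^sub>-\<close> by \<open>g/det(g)\<^sup>-\<^sup>1\<close>, which differs from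
  \<open>g\<close> by a sign if \<open>det g = -1\<close>.\<close>

lemma phi_M:
  assumes w: "w \<in> coord_space I" and d: "\<phi> w \<in> coord_space (Xi d)" and g: "g \<in> SLpm"
  shows "cscale (sign_char \<beta> g) (\<phi> (\<sigma> g w)) =
    cscale (sign_char \<alpha> g * complex_of_real (det g) ^ d) (sym_rep g (\<phi> w))"
proof -
  have dd: "inverse (det g) = det g" "\<bar>det g\<bar> = 1" "det g * det g = 1"
    using g by (auto simp: SLpm_def)
  have s: "sgn_pow \<epsilon> \<nu> (det g) = sign_char \<epsilon> g" for \<epsilon> \<nu>
    by (simp add: sgn_pow_def sign_char_def dd(2))
  have "\<sigma> g w \<in> coord_space I" by (rule fd_repD(3)[OF fd g w])
  moreover have "\<pi> (mk_block (det g) 0 g) w = cscale (sign_char \<beta> g) (\<sigma> g w)"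
    unfolding P_rep_sgn_pow[OF dd(3)] s dd(2) by simp
  ultimately have "cscale (sign_char \<beta> g) (\<phi> (\<sigma> g w)) = \<phi> (\<pi> (mk_block (det g) 0 g) w)"
    using phi_clinear by (simp only: clinear_on_def)
  also have "\<dots> = cscale (sgn_pow \<alpha> s (det g)) (sym_rep (inverse (det g) *\<^sub>R g) (\<phi> w))"
    by (rule phi_levi[OF dd(3) w])
  finally show ?thesis
    unfolding sym_rep_scaleR[OF d] s dd(1) cscale_cscale .
qed

lemma phi_zero_or_homogeneous:
  obtains "\<forall>w\<in>coord_space I. \<phi> w = 0"
  | d w0 where "\<forall>w\<in>coord_space I. \<phi> w \<in> coord_space (Xi d)" "w0 \<in> coord_space I" "\<phi> w0 \<noteq> 0"
    "r = s - of_nat d * (1 + 1 / of_nat CARD('m))" "d = 0 \<or> s = of_nat d - 1"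
proof (cases "\<forall>w\<in>coord_space I. \<phi> w = 0")
  case False
  then obtain w0 where w0: "w0 \<in> coord_space I" "\<phi> w0 \<noteq> 0" by blast
  then obtain \<kappa> where \<kappa>: "lookup (\<phi> w0) \<kappa> \<noteq> 0"
    by (metis poly_mapping_eqI lookup_zero)
  have "mdeg \<mu> = mdeg \<kappa>" if "w \<in> coord_space I" "lookup (\<phi> w) \<mu> \<noteq> 0" for w \<mu>
  proof -
    have "of_nat (mdeg \<mu>) * (1 + 1 / of_nat CARD('m)) = of_nat (mdeg \<kappa>) * (1 + 1 / of_nat CARD('m) :: complex)"
      using phi_weight[OF that] phi_weight[OF w0(1) \<kappa>] by (simp add: algebra_simps)
    then show ?thesis using weight_nonzero[where 'm = 'm] by simp
  qed
  then have "\<forall>w\<in>coord_space I. \<phi> w \<in> coord_space (Xi (mdeg \<kappa>))"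
    by (simp add: Pol_iff)
  moreover have "mdeg \<kappa> = 0 \<or> s = of_nat (mdeg \<kappa>) - 1" using phi_degree[OF w0(1) \<kappa>] by blast
  ultimately show ?thesis
    by (rule that(2)[OF _ w0 phi_weight[OF w0(1) \<kappa>]])
qed (use that in blast)

lemma f_eqI:
  assumes F: "F \<in> extensional (carr M)" "\<And>x. x \<in> coord_space I \<Longrightarrow> F (coset R x) \<in> carr N"
    and v: "\<And>x. x \<in> coord_space I \<Longrightarrow> valC s (F (coset R x)) =
      (\<Sum>i\<in>I. uact s (lookup x i) (\<phi> (single i 1)))"
  shows "f = F"
proof (rule extensionalityI[of _ "carr M"])
  show "f \<in> extensional (carr M)" using f by (simp add: Hom_gP_def PiE_def)
  fix C assume "C \<in> carr M"
  then obtain x where x: "x \<in> coord_space I" "C = coset R x" by (auto simp: verma_simps)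
  have "valC s (f (coset R x)) = valC s (F (coset R x))"
    unfolding v[OF x(1)] val_def[symmetric] by (rule val_expand[OF x(1)])
  then show "f C = F C"
    unfolding x(2) by (rule valC_inject[OF f_carr[OF carrI[OF x(1)]] F(2)[OF x(1)]])
qed (rule F)

end

text \<open>A \<open>U(g)\<close>-linear map \<open>\<Psi>\<close> between the spaces before taking quotients induces a homomorphism as soon as
  it respects the relations and the action of \<open>P\<close>; both need to be verified for the values in the
  polynomial model only.\<close>

lemma Hom_intro:
  fixes \<Psi> :: "('i \<Rightarrow>\<^sub>0 'm::finite uea) \<Rightarrow> (unit \<Rightarrow>\<^sub>0 'm uea)"
    and \<sigma> :: "real^'m^'m \<Rightarrow> ('i \<Rightarrow>\<^sub>0 complex) \<Rightarrow> ('i \<Rightarrow>\<^sub>0 complex)" and \<beta> :: int and r :: complex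
  defines "\<pi> \<equiv> P_rep \<beta> \<sigma> r"
  assumes fd: "fd_rep SLpm \<sigma> I"
    and add: "\<And>x y. \<Psi> (x + y) = \<Psi> x + \<Psi> y" and act: "\<And>u x. \<Psi> (uea_act u x) = uea_act u (\<Psi> x)"
    and bal: "\<And>x. x \<in> balance \<pi> I \<Longrightarrow> Vpol s (\<Psi> x) = 0"
    and grp: "\<And>p x. p \<in> P_grp \<Longrightarrow> x \<in> coord_space I \<Longrightarrow>
      Vpol s (\<Psi> (ind_act \<pi> I p x)) = Vpol s (ind_act (P_rep \<alpha> triv_rep s) UNIV p (\<Psi> x))"
  shows "(\<lambda>C\<in>carr (verma \<sigma> I r \<beta>). coset_map (triv_ideal \<alpha> s) \<Psi> C) \<in> Hom_gP (verma \<sigma> I r \<beta>) (verma_triv s \<alpha>)"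
proof -
  let ?M = "verma \<sigma> I r \<beta> :: ('m, _) gP_module" and ?N = "verma_triv s \<alpha> :: ('m, _) gP_module"
  let ?R = "balance \<pi> I :: ('i \<Rightarrow>\<^sub>0 'm uea) set" and ?S = "triv_ideal \<alpha> s :: (unit \<Rightarrow>\<^sub>0 'm uea) set"
  define F where "F = (\<lambda>C\<in>carr ?M. coset_map ?S \<Psi> C)"
  have M: "carr ?M = coset ?R ` coord_space I" unfolding \<pi>_def by (rule verma_simps)
  have F: "F (coset ?R x) = coset ?S (\<Psi> x)" if "x \<in> coord_space I" for x
  proof -
    have "coset_map ?S \<Psi> (coset ?R x) = coset ?S (\<Psi> x)"
      by (rule coset_map_coset[OF add_subgroup_balance add])
        (use bal in \<open>simp_all add: balance_triv_iff balance_0\<close>)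
    then show ?thesis using that by (simp add: F_def M)
  qed
  have \<pi>lin: "\<pi> p (single i 1) \<in> coord_space I" if "p \<in> P_grp" "i \<in> I" for p i
    unfolding \<pi>_def by (rule P_rep_lin(2)[OF fd that(1) single_coord[OF that(2)]])
  show ?thesis
    unfolding F_def[symmetric] Hom_gP_def mem_Collect_eq
  proof (intro conjI ballI allI)
    show "F \<in> carr ?M \<rightarrow>\<^sub>E carr ?N"
    proof (rule PiE_I)
      fix C assume "C \<in> carr ?M"
      then show "F C \<in> carr ?N" by (auto simp: M F verma_simps(1)[of triv_rep])
    qed (simp add: F_def)
    fix C assume "C \<in> carr ?M"
    then obtain x where x: "x \<in> coord_space I" "C = coset ?R x" by (auto simp: M)
    show "F (mscale ?M c C) = mscale ?N c (F C)" for c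
    proof -
      have "mscale ?M c (coset ?R x) = coset ?R (uea_act (uea_const c) x)"
        unfolding \<pi>_def by (rule verma_simps)
      moreover have "mscale ?N c (coset ?S y) = coset ?S (uea_act (uea_const c) y)" for y
        by (rule verma_simps)
      ultimately show ?thesis by (simp add: x F uea_act_coord act)
    qed
    show "F (lie_act ?M X C) = lie_act ?N X (F C)" for X
    proof -
      have "lie_act ?M X (coset ?R x) = coset ?R (uea_act (uea_of X) x)"
        unfolding \<pi>_def by (rule verma_simps)
      moreover have "lie_act ?N X (coset ?S y) = coset ?S (uea_act (uea_of X) y)" for y
        by (rule verma_simps)
      ultimately show ?thesis by (simp add: x F uea_act_coord act)
    qed
    show "F (grp_act ?M p C) = grp_act ?N p (F C)" if p: "p \<in> P_grp" for p
    proof -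
      have "grp_act ?M p (coset ?R x) = coset ?R (ind_act \<pi> I p x)"
        unfolding verma_simps(6) unfolding \<pi>_def[symmetric]
        by (rule coset_map_coset[OF add_subgroup_balance ind_act_add ind_act_balance[OF fd p, where \<beta> = \<beta> and r = r, folded \<pi>_def] balance_0])
      then show ?thesis
        unfolding x(2) F[OF x(1)] triv_grp_act[OF p]
        by (simp add: F ind_act_closed \<pi>lin[OF p] triv_coset_eq grp[OF p x(1)])
    qed
    fix D assume "D \<in> carr ?M"
    then obtain y where y: "y \<in> coord_space I" "D = coset ?R y" by (auto simp: M)
    show "F (madd ?M C D) = madd ?N (F C) (F D)"
    proof -
      have "madd ?M (coset ?R x) (coset ?R y) = coset ?R (x + y)"
        unfolding \<pi>_def by (rule verma_simps)
      moreover have "madd ?N (coset ?S v) (coset ?S w) = coset ?S (v + w)" for v w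
        by (rule verma_simps)
      ultimately show ?thesis by (simp add: x y F coord_add add)
    qed
  qed
qed

lemma sum_unit: "(\<Sum>i\<in>UNIV. g i) = g ()"
  by (simp add: UNIV_unit)

lemma sign_char_1: "det g = 1 \<Longrightarrow> sign_char \<epsilon> g = 1"
  by (simp add: sign_char_def)

lemma sign_char_minus_1: "det g = -1 \<Longrightarrow> sign_char \<epsilon> g = (if \<epsilon> = 1 then 1 else -1)"
  by (simp add: sign_char_def)

text \<open>For \<open>r = s\<close> the weight forces degree \<open>d = 0\<close>, so the generator is mapped to a constant.\<close>

lemma Hom_triv:
  "Hom_gP (verma_triv s \<alpha> :: ('m::finite, _) gP_module) (verma_triv s \<alpha>) =
    multiples (verma_triv s \<alpha>) (verma_triv s \<alpha>) (\<lambda>x\<in>carr (verma_triv s \<alpha>). x)"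
proof (intro equalityI subsetI)
  let ?N = "verma_triv s \<alpha> :: ('m, _) gP_module" and ?S = "triv_ideal \<alpha> s :: (unit \<Rightarrow>\<^sub>0 'm uea) set"
  fix f assume f: "f \<in> Hom_gP ?N ?N"
  interpret verma_hom \<alpha> \<alpha> s s triv_rep UNIV f
    by unfold_locales (rule fd_rep_triv, rule f)
  have "\<exists>c. \<phi> (single () 1) = cscale c 1"
  proof (rule phi_zero_or_homogeneous)
    assume "\<forall>w\<in>coord_space UNIV. \<phi> w = 0"
    then show ?thesis by (intro exI[of _ 0]) simp
  next
    fix d w0 assume d: "\<forall>w\<in>coord_space UNIV. \<phi> w \<in> coord_space (Xi d)"
      "s = s - of_nat d * (1 + 1 / of_nat CARD('m))"
    then have d0: "d = 0" using weight_nonzero[where 'm = 'm] by simp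
    have "\<phi> (single () 1) = cscale (lookup (\<phi> (single () 1)) 0) 1"
      using d(1) by (intro poly_mapping_eqI) (auto simp: Pol_iff d0 mdeg_eq_0_iff lookup_one when_def)
    then show ?thesis by blast
  qed
  then obtain c where c: "\<phi> (single () 1) = cscale c 1" by blast
  have "f = (\<lambda>C\<in>carr ?N. mscale ?N c ((\<lambda>x\<in>carr ?N. x) C))"
  proof (rule f_eqI)
    fix x :: "unit \<Rightarrow>\<^sub>0 'm uea"
    have e: "(\<lambda>C\<in>carr ?N. mscale ?N c ((\<lambda>x\<in>carr ?N. x) C)) (coset ?S x) = coset ?S (uea_act (uea_const c) x)"
      by (simp add: verma_simps)
    show "(\<lambda>C\<in>carr ?N. mscale ?N c ((\<lambda>x\<in>carr ?N. x) C)) (coset ?S x) \<in> carr ?N"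
      unfolding e by (simp add: verma_simps)
    show "valC s ((\<lambda>C\<in>carr ?N. mscale ?N c ((\<lambda>x\<in>carr ?N. x) C)) (coset ?S x)) =
        (\<Sum>i\<in>UNIV. uact s (lookup x i) (\<phi> (single i 1)))"
      unfolding e valC_coset by (simp add: sum_unit c Vpol_act uact_const uact_cscale) (simp add: Vpol_def)
  qed simp
  then show "f \<in> multiples ?N ?N (\<lambda>x\<in>carr ?N. x)" unfolding multiples_def by blast
next
  let ?N = "verma_triv s \<alpha> :: ('m, _) gP_module" and ?S = "triv_ideal \<alpha> s :: (unit \<Rightarrow>\<^sub>0 'm uea) set"
  fix f assume "f \<in> multiples ?N ?N (\<lambda>x\<in>carr ?N. x)"
  then obtain c where f: "f = (\<lambda>C\<in>carr ?N. mscale ?N c ((\<lambda>x\<in>carr ?N. x) C))" unfolding multiples_def by blast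
  have cm: "coset_map ?S (uea_act (uea_const c)) (coset ?S x) = coset ?S (uea_act (uea_const c) x)" for x
    by (rule coset_map_coset[OF add_subgroup_balance uea_act_add balance_uea_act balance_0])
  have "f = (\<lambda>C\<in>carr ?N. coset_map ?S (uea_act (uea_const c)) C)"
    unfolding f by (rule restrict_ext) (auto simp: verma_simps cm)
  also have "\<dots> \<in> Hom_gP ?N ?N"
  proof (rule Hom_intro[OF fd_rep_triv uea_act_add])
    show "uea_act (uea_const c) (uea_act u x) = uea_act u (uea_act (uea_const c) x)" for u and x :: "unit \<Rightarrow>\<^sub>0 'm uea"
      by (simp add: uea_act_const)
    show "Vpol s (uea_act (uea_const c) x) = 0" if "x \<in> ?S" for x
      using that by (simp add: balance_triv_iff Vpol_act)
    show "Vpol s (uea_act (uea_const c) (ind_act (P_rep \<alpha> triv_rep s) UNIV p x)) =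
        Vpol s (ind_act (P_rep \<alpha> triv_rep s) UNIV p (uea_act (uea_const c) x))" for p and x :: "unit \<Rightarrow>\<^sub>0 'm uea"
      by (simp add: ind_act_act)
  qed
  finally show "f \<in> Hom_gP ?N ?N" .
qed

section \<open>The homomorphisms \<open>\<phi>\<^sub>k\<close>\<close>

text \<open>The map \<open>\<phi>\<^sub>k\<close> before passing to cosets.  In the polynomial model it sends \<open>u \<otimes> w\<close> to \<open>u \<cdot> w\<close>
  (\<open>Vpol_phi_lift_tensor\<close>).\<close>

definition phi_lift :: "nat \<Rightarrow> (('m::finite \<Rightarrow>\<^sub>0 nat) \<Rightarrow>\<^sub>0 'm uea) \<Rightarrow> (unit \<Rightarrow>\<^sub>0 'm uea)" where
  "phi_lift k x = (\<Sum>\<kappa>\<in>Xi k. tensor (lookup x \<kappa> * N_pow \<kappa>) (single () 1))"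

lemma phi_lift_add: "phi_lift k (x + y) = phi_lift k x + phi_lift k y"
  by (simp add: phi_lift_def lookup_add distrib_right tensor_add_left sum.distrib)

lemma phi_lift_act: "phi_lift k (uea_act u x) = uea_act u (phi_lift k x)"
  by (simp add: phi_lift_def uea_act_sum uea_act_tensor mult.assoc)

lemma phi_lift_diff: "phi_lift k (x - y) = phi_lift k x - phi_lift k y"
  by (metis phi_lift_add add_diff_cancel_right' diff_add_cancel)

lemma uact_N_pow: "uact s (N_pow \<kappa>) 1 = single \<kappa> 1"
  using uact_pol_to_uea[of s "single \<kappa> 1"] by (simp add: pol_to_uea_single)

lemma lookup_phi_lift: "lookup (phi_lift k x) () = (\<Sum>\<kappa>\<in>Xi k. lookup x \<kappa> * N_pow \<kappa>)"
  by (simp add: phi_lift_def lookup_sum)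

lemma Vpol_phi_lift: "Vpol s (phi_lift k x) = (\<Sum>\<kappa>\<in>Xi k. uact s (lookup x \<kappa>) (single \<kappa> 1))"
  by (simp add: Vpol_def lookup_phi_lift uact_sum uact_mult uact_N_pow)

lemma uact_sum_right: "uact s u (sum g S) = (\<Sum>x\<in>S. uact s u (g x))"
  by (induction S rule: infinite_finite_induct) (simp_all add: uact_add_right)

lemma Vpol_phi_lift_tensor:
  assumes "w \<in> coord_space (Xi k)"
  shows "Vpol s (phi_lift k (tensor u w)) = uact s u w"
proof -
  have "w = (\<Sum>\<kappa>\<in>Xi k. cscale (lookup w \<kappa>) (single \<kappa> 1))"
    using clinear_on_expand[of "Xi k" "\<lambda>w. w" w] finite_Xi[of k] assms
    by (simp add: clinear_on_def)
  then have "uact s u w = (\<Sum>\<kappa>\<in>Xi k. cscale (lookup w \<kappa>) (uact s u (single \<kappa> 1)))"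
    by (metis (no_types, lifting) sum.cong uact_cscale uact_sum_right)
  then show ?thesis by (simp add: Vpol_phi_lift uact_mult uact_const)
qed

lemma foldr_differential_sym:
  fixes Xs :: "'m::finite sl list"
  assumes "set Xs \<subseteq> lie_p" "w \<in> coord_space (Xi k)" "r = - (1 + of_nat k / of_nat CARD('m))"
  shows "foldr (differential (P_rep \<beta> sym_rep r)) Xs w = uact (of_nat k - 1) (prod_list (map uea_of Xs)) w \<and>
    foldr (differential (P_rep \<beta> sym_rep r)) Xs w \<in> coord_space (Xi k)"
  using assms(1)
proof (induction Xs)
  case (Cons X Xs)
  then have X: "X \<in> lie_p"
    and IH: "foldr (differential (P_rep \<beta> sym_rep r)) Xs w = uact (of_nat k - 1) (prod_list (map uea_of Xs)) w"
      "foldr (differential (P_rep \<beta> sym_rep r)) Xs w \<in> coord_space (Xi k)"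
    by auto
  have "foldr (differential (P_rep \<beta> sym_rep r)) (X # Xs) w =
      rho (of_nat k - 1) (mat_of_sl X) (foldr (differential (P_rep \<beta> sym_rep r)) Xs w)"
    using differential_sym[OF X IH(2) assms(3)] by simp
  then show ?case
    using rho_Pol_closed[OF IH(2) lie_p_block_up[OF X]] by (simp only: IH(1)) (simp add: uact_mult uact_of)
qed (simp add: assms)

text \<open>On polynomials of degree \<open>k\<close>, words in \<open>p\<close> act through the differential of the inducing
  representation in the same way as inside the scalar module.\<close>

lemma phi_lift_balance:
  fixes x :: "('m::finite \<Rightarrow>\<^sub>0 nat) \<Rightarrow>\<^sub>0 'm uea"
  assumes r: "r = - (1 + of_nat k / of_nat CARD('m))"
    and x: "x \<in> balance (P_rep \<beta> sym_rep r) (Xi k)"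
  shows "Vpol (of_nat k - 1) (phi_lift k x) = 0"
proof -
  let ?\<pi> = "P_rep \<beta> sym_rep r :: real^('m option)^('m option) \<Rightarrow> _"
  have "balance ?\<pi> (Xi k) \<subseteq> {x. Vpol (of_nat k - 1) (phi_lift k x) = 0}"
  proof (rule balance_subsetI)
    have "phi_lift k (0 :: ('m \<Rightarrow>\<^sub>0 nat) \<Rightarrow>\<^sub>0 'm uea) = 0" using phi_lift_add[of k 0 0] by simp
    then show "uea_mod.subspace {x :: ('m \<Rightarrow>\<^sub>0 nat) \<Rightarrow>\<^sub>0 'm uea. Vpol (of_nat k - 1) (phi_lift k x) = 0}"
      unfolding uea_mod.subspace_def by (simp add: phi_lift_add Vpol_add phi_lift_act Vpol_act)
    fix u :: "'m uea" and Xs and w :: "('m \<Rightarrow>\<^sub>0 nat) \<Rightarrow>\<^sub>0 complex" assume Xs: "set Xs \<subseteq> (lie_p :: 'm sl set)" and w: "w \<in> coord_space (Xi k :: ('m \<Rightarrow>\<^sub>0 nat) set)"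
    note f = foldr_differential_sym[OF Xs w r, of \<beta>]
    show "tensor (u * prod_list (map uea_of Xs)) w - tensor u (foldr (differential ?\<pi>) Xs w) \<in>
        {x. Vpol (of_nat k - 1) (phi_lift k x) = 0}"
      unfolding mem_Collect_eq phi_lift_diff Vpol_diff Vpol_phi_lift_tensor[OF w] Vpol_phi_lift_tensor[OF conjunct2[OF f]]
      by (simp add: conjunct1[OF f] uact_mult)
  qed
  then show ?thesis using x by blast
qed

lemma phi_lift_equivariant:
  fixes p :: "real^('m::finite option)^('m option)"
  assumes \<alpha>: "\<alpha> \<in> {1, -1}" and p: "p \<in> P_grp" and r: "r = - (1 + of_nat k / of_nat CARD('m))"
  defines "s \<equiv> of_nat k - 1" and "\<pi> \<equiv> P_rep (sign_add \<alpha> k) sym_rep r"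
  shows "Vpol s (phi_lift k (ind_act \<pi> (Xi k) p x)) = Vpol s (ind_act (P_rep \<alpha> triv_rep s) UNIV p (phi_lift k x))"
proof -
  let ?c = "sgn_pow \<alpha> s (p $ None $ None)"
  have N: "N_pow \<kappa> = pol_to_uea (single \<kappa> 1)" for \<kappa> :: "'m \<Rightarrow>\<^sub>0 nat"
    by (simp add: pol_to_uea_single)
  have sum1: "phi_lift k (sum g S) = (\<Sum>i\<in>S. phi_lift k (g i))" for g :: "_ \<Rightarrow> ('m \<Rightarrow>\<^sub>0 nat) \<Rightarrow>\<^sub>0 'm uea" and S
    using phi_lift_add[of k 0 0]
    by (induction S rule: infinite_finite_induct) (simp_all add: phi_lift_add)
  have sum2: "Vpol s (sum g S) = (\<Sum>i\<in>S. Vpol s (g i))" for g :: "_ \<Rightarrow> unit \<Rightarrow>\<^sub>0 'm uea" and S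
    by (induction S rule: infinite_finite_induct) (simp_all add: Vpol_add)
  have sum3: "Ad_uea p (sum g S) = (\<Sum>i\<in>S. Ad_uea p (g i))" for g :: "_ \<Rightarrow> 'm uea" and S
    by (induction S rule: infinite_finite_induct) (simp_all add: Ad_uea_add)
  have "Vpol s (phi_lift k (ind_act \<pi> (Xi k) p x)) =
      (\<Sum>\<kappa>\<in>Xi k. uact s (Ad_uea p (lookup x \<kappa>)) (\<pi> p (single \<kappa> 1)))"
    unfolding ind_act_def sum1 sum2
  proof (rule sum.cong)
    fix \<kappa> :: "'m \<Rightarrow>\<^sub>0 nat" assume "\<kappa> \<in> Xi k"
    then show "Vpol s (phi_lift k (tensor (Ad_uea p (lookup x \<kappa>)) (\<pi> p (single \<kappa> 1)))) =
        uact s (Ad_uea p (lookup x \<kappa>)) (\<pi> p (single \<kappa> 1))"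
      unfolding \<pi>_def by (intro Vpol_phi_lift_tensor P_rep_lin(2)[OF fd_rep_sym p] single_coord)
  qed simp
  also have "\<dots> = (\<Sum>\<kappa>\<in>Xi k. cscale ?c (uact s (Ad_uea p (lookup x \<kappa> * N_pow \<kappa>)) 1))"
  proof (rule sum.cong)
    fix \<kappa> :: "'m \<Rightarrow>\<^sub>0 nat" assume \<kappa>: "\<kappa> \<in> Xi k"
    show "uact s (Ad_uea p (lookup x \<kappa>)) (\<pi> p (single \<kappa> 1)) =
        cscale ?c (uact s (Ad_uea p (lookup x \<kappa> * N_pow \<kappa>)) 1)"
      unfolding \<pi>_def phi_equivariant[OF \<alpha> p single_coord[OF \<kappa>] r, symmetric] N s_def
      by (simp only: uact_cscale Ad_uea_mult uact_mult)
  qed simp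
  also have "\<dots> = cscale ?c (uact s (Ad_uea p (\<Sum>\<kappa>\<in>Xi k. lookup x \<kappa> * N_pow \<kappa>)) 1)"
    unfolding sum3 uact_sum cscale_sum ..
  finally show ?thesis unfolding Vpol_ind_act[OF p] lookup_phi_lift .
qed

text \<open>The weight \<open>r\<close> forces the degree \<open>d = k\<close>, and then the restriction of a homomorphism is an
  \<open>SL\<close>-endomorphism of \<open>sym\<^sup>k\<close>, hence a scalar.\<close>

lemma Hom_sym:
  fixes \<alpha> :: int and k :: nat
  assumes \<alpha>: "\<alpha> \<in> {1, -1}"
  defines "r \<equiv> - (1 + of_nat k / of_nat CARD('m::finite)) :: complex" and "s \<equiv> of_nat k - 1 :: complex"
    and "\<beta> \<equiv> sign_add \<alpha> k"
  shows "Hom_gP (verma_sym k r \<beta> :: ('m, _) gP_module) (verma_triv s \<alpha>) =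
    multiples (verma_sym k r \<beta>) (verma_triv s \<alpha>) (phi k \<alpha>)"
proof (intro equalityI subsetI)
  let ?M = "verma_sym k r \<beta> :: ('m, _) gP_module" and ?N = "verma_triv s \<alpha> :: ('m, _) gP_module"
  let ?S = "triv_ideal \<alpha> s :: (unit \<Rightarrow>\<^sub>0 'm uea) set" and ?\<pi> = "P_rep \<beta> sym_rep r :: real^('m option)^('m option) \<Rightarrow> _"
  let ?R = "balance ?\<pi> (Xi k)"
  have phi_coset: "phi k \<alpha> (coset ?R x) = coset ?S (phi_lift k x)" if "x \<in> coord_space (Xi k)" for x
  proof -
    have "phi k \<alpha> (coset ?R x) = coset_map ?S (phi_lift k) (coset ?R x)"
      using that unfolding phi_def r_def[symmetric] s_def[symmetric] \<beta>_def[symmetric]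
      by (simp add: verma_simps phi_lift_def[abs_def])
    also have "\<dots> = coset ?S (phi_lift k x)"
      by (rule coset_map_coset[OF add_subgroup_balance phi_lift_add])
        (use phi_lift_balance[of r k _ \<beta>] in \<open>auto simp: balance_triv_iff r_def s_def balance_0\<close>)
    finally show ?thesis .
  qed
  have mult_coset: "mscale ?N c (phi k \<alpha> (coset ?R x)) = coset ?S (uea_act (uea_const c) (phi_lift k x))"
    if "x \<in> coord_space (Xi k)" for c x
    using that by (simp add: phi_coset verma_simps)
  {
    fix f assume f: "f \<in> Hom_gP ?M ?N"
    interpret verma_hom \<alpha> \<beta> r s sym_rep "Xi k" f
      by unfold_locales (rule fd_rep_sym, rule f)
    have "\<exists>c. \<forall>w\<in>coord_space (Xi k). \<phi> w = cscale c w"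
    proof (rule phi_zero_or_homogeneous)
      assume "\<forall>w\<in>coord_space (Xi k). \<phi> w = 0"
      then show ?thesis by (intro exI[of _ 0]) simp
    next
      fix d w0 assume d: "\<forall>w\<in>coord_space (Xi k). \<phi> w \<in> coord_space (Xi d)"
        "r = s - of_nat d * (1 + 1 / of_nat CARD('m))"
      have "of_nat d * (1 + 1 / of_nat CARD('m)) = of_nat k * (1 + 1 / of_nat CARD('m) :: complex)"
        using d(2) unfolding r_def s_def by (simp add: algebra_simps)
      then have dk: "d = k" using weight_nonzero[where 'm = 'm] by simp
      have "\<phi> (sym_rep g w) = sym_rep g (\<phi> w)" if "g \<in> SL" "w \<in> coord_space (Xi k)" for g w
        using phi_M[OF that(2), of d g] d(1) that by (simp add: SL_def SLpm_def sign_char_1)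
      with sym_schur[OF phi_clinear] d(1) dk show ?thesis by metis
    qed
    then obtain c where c: "\<And>w. w \<in> coord_space (Xi k) \<Longrightarrow> \<phi> w = cscale c w" by blast
    have "f = (\<lambda>C\<in>carr ?M. mscale ?N c (phi k \<alpha> C))"
    proof (rule f_eqI)
      fix x :: "('m \<Rightarrow>\<^sub>0 nat) \<Rightarrow>\<^sub>0 'm uea" assume x: "x \<in> coord_space (Xi k)"
      have e: "(\<lambda>C\<in>carr ?M. mscale ?N c (phi k \<alpha> C)) (coset ?R x) = coset ?S (uea_act (uea_const c) (phi_lift k x))"
        using mult_coset[OF x] carrI[OF x] by simp
      show "(\<lambda>C\<in>carr ?M. mscale ?N c (phi k \<alpha> C)) (coset ?R x) \<in> carr ?N"
        unfolding e by (simp add: verma_simps)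
      show "valC s ((\<lambda>C\<in>carr ?M. mscale ?N c (phi k \<alpha> C)) (coset ?R x)) =
          (\<Sum>\<kappa>\<in>Xi k. uact s (lookup x \<kappa>) (\<phi> (single \<kappa> 1)))"
        unfolding e by (simp add: Vpol_act uact_const Vpol_phi_lift cscale_sum c single_coord uact_cscale cong: sum.cong)
    qed simp
    then show "f \<in> multiples ?M ?N (phi k \<alpha>)" unfolding multiples_def by blast
  }
  fix f assume "f \<in> multiples ?M ?N (phi k \<alpha>)"
  then obtain c where f: "f = (\<lambda>C\<in>carr ?M. mscale ?N c (phi k \<alpha> C))" unfolding multiples_def by blast
  let ?\<Psi> = "\<lambda>x. uea_act (uea_const c) (phi_lift k x)"
  have bal: "Vpol s (?\<Psi> x) = 0" if "x \<in> ?R" for x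
    using phi_lift_balance[of r k x \<beta>] that by (simp add: r_def s_def Vpol_act)
  have cm: "coset_map ?S ?\<Psi> (coset ?R x) = coset ?S (?\<Psi> x)" for x
    by (rule coset_map_coset[OF add_subgroup_balance])
      (use bal in \<open>simp_all add: phi_lift_add uea_act_add balance_triv_iff balance_0\<close>)
  have "f = (\<lambda>C\<in>carr ?M. coset_map ?S ?\<Psi> C)"
    unfolding f
  proof (rule restrict_ext)
    fix C assume "C \<in> carr ?M"
    then obtain x where "x \<in> coord_space (Xi k)" "C = coset ?R x" by (auto simp: verma_simps)
    then show "mscale ?N c (phi k \<alpha> C) = coset_map ?S ?\<Psi> C" by (simp add: mult_coset cm)
  qed
  also have "\<dots> \<in> Hom_gP ?M ?N"
  proof (rule Hom_intro[OF fd_rep_sym])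
    show "?\<Psi> (x + y) = ?\<Psi> x + ?\<Psi> y" for x y by (simp add: phi_lift_add uea_act_add)
    show "?\<Psi> (uea_act u x) = uea_act u (?\<Psi> x)" for u x by (simp add: phi_lift_act uea_act_const)
    show "Vpol s (?\<Psi> x) = 0" if "x \<in> ?R" for x by (rule bal[OF that])
    show "Vpol s (?\<Psi> (ind_act ?\<pi> (Xi k) p x)) = Vpol s (ind_act (P_rep \<alpha> triv_rep s) UNIV p (?\<Psi> x))"
      if "p \<in> P_grp" for p x
      using phi_lift_equivariant[OF \<alpha> that, of r k x] by (simp add: ind_act_act Vpol_act r_def s_def \<beta>_def)
  qed
  finally show "f \<in> Hom_gP ?M ?N" .
qed

section \<open>Vanishing for all other parameters\<close>

lemma SLpm_det_minus_1: obtains g :: "real^'m^'m::finite" where "g \<in> SLpm" "det g = -1"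
proof -
  let ?g = "diagm (\<lambda>i::'m. if i = undefined then -1 else 1)"
  have "det ?g = -1" by (simp add: det_diagm)
  then show ?thesis using that by (simp add: SLpm_def)
qed

lemma rep_equiv_sym_0_triv:
  fixes \<sigma> :: "real^'m^'m::finite \<Rightarrow> ('i \<Rightarrow>\<^sub>0 complex) \<Rightarrow> ('i \<Rightarrow>\<^sub>0 complex)"
  assumes "rep_equiv H \<sigma> I (sym_rep :: real^'m^'m \<Rightarrow> _) (Xi 0)"
  shows "rep_equiv H \<sigma> I triv_rep UNIV"
proof -
  obtain T where T: "clinear_on (coord_space I) T" "bij_betw T (coord_space I) (coord_space (Xi 0 :: ('m \<Rightarrow>\<^sub>0 nat) set))"
    "\<forall>g\<in>H. \<forall>w\<in>coord_space I. T (\<sigma> g w) = sym_rep g (T w)"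
    using assms unfolding rep_equiv_def by blast
  define L where "L = (\<lambda>f :: 'm pol. single () (lookup f 0))"
  have P0: "f = single 0 (lookup f 0)" if "f \<in> coord_space (Xi 0)" for f :: "'m pol"
    using that by (intro poly_mapping_eqI) (auto simp: Pol_iff mdeg_eq_0_iff lookup_single when_def)
  have L: "bij_betw L (coord_space (Xi 0)) (coord_space UNIV)"
  proof (rule bij_betwI[where g = "\<lambda>w. single 0 (lookup w ())"])
    show "(\<lambda>w. single 0 (lookup w ())) \<in> coord_space UNIV \<rightarrow> coord_space (Xi 0)"
      by (auto simp: Pol_iff lookup_single when_def)
    show "single 0 (lookup (L f) ()) = f" if "f \<in> coord_space (Xi 0)" for f
      using P0[OF that] by (simp add: L_def)
    show "L (single 0 (lookup w ())) = w" for w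
      by (rule poly_mapping_eqI) (simp add: L_def)
  qed simp
  show ?thesis
    unfolding rep_equiv_def
  proof (intro exI[of _ "L \<circ> T"] conjI ballI)
    show "clinear_on (coord_space I) (L \<circ> T)"
      using T(1) by (simp add: clinear_on_def L_def lookup_add single_add cscale_single)
    show "bij_betw (L \<circ> T) (coord_space I) (coord_space UNIV)"
      using T(2) L by (rule bij_betw_trans)
    fix g and w :: "'i \<Rightarrow>\<^sub>0 complex" assume "g \<in> H" "w \<in> coord_space I"
    moreover have "T w \<in> coord_space (Xi 0)" using T(2) \<open>w \<in> _\<close> by (auto simp: bij_betw_def)
    from P0[OF this] obtain c where "T w = single 0 c" by (rule that)
    then have "sym_rep g (T w) = T w" by simp
    ultimately show "(L \<circ> T) (\<sigma> g w) = triv_rep g ((L \<circ> T) w)"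
      using T(3) by (simp add: triv_rep_def)
  qed
qed

context verma_hom
begin

lemma phi_SL:
  assumes "\<forall>w\<in>coord_space I. \<phi> w \<in> coord_space (Xi d)" "g \<in> SL" "w \<in> coord_space I"
  shows "\<phi> (\<sigma> g w) = sym_rep g (\<phi> w)"
  using phi_M[OF assms(3), of d g] assms by (simp add: SL_def SLpm_def sign_char_1)

lemma phi_zero: "\<phi> 0 = 0"
proof -
  have "\<phi> (cscale 0 0) = cscale 0 (\<phi> 0)"
    using phi_clinear coord_space_closed(1)[of I] by (simp only: clinear_on_def)
  then show ?thesis by simp
qed

text \<open>The kernel of \<open>\<phi>\<close> is an invariant subspace of \<open>\<sigma>\<close>, and its image is one of the
  polynomials of degree \<open>d\<close>; both representations are irreducible.\<close>

lemma phi_equiv: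
  assumes irr: "irreducible_rep SL \<sigma> I" and d: "\<forall>w\<in>coord_space I. \<phi> w \<in> coord_space (Xi d)"
    and w0: "w0 \<in> coord_space I" "\<phi> w0 \<noteq> 0"
  shows "rep_equiv SL \<sigma> I (sym_rep :: real^'m^'m \<Rightarrow> _) (Xi d)"
proof -
  interpret mi: module "cscale :: complex \<Rightarrow> ('i \<Rightarrow>\<^sub>0 complex) \<Rightarrow> _"
    by standard (auto simp: cscale_add cscale_add_left)
  interpret mp: module "cscale :: complex \<Rightarrow> 'm pol \<Rightarrow> _"
    by standard (auto simp: cscale_add cscale_add_left)
  have closed: "\<sigma> g w \<in> coord_space I" if "g \<in> SL" "w \<in> coord_space I" for g w
    using fd_repD(3)[OF fd _ that(2)] that(1) by (simp add: SL_def SLpm_def)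
  have add: "\<phi> (v + w) = \<phi> v + \<phi> w" if "v \<in> coord_space I" "w \<in> coord_space I" for v w
    using phi_clinear that by (simp add: clinear_on_def)
  have scale: "\<phi> (cscale c w) = cscale c (\<phi> w)" if "w \<in> coord_space I" for c w
    using phi_clinear that by (simp add: clinear_on_def)
  let ?K = "{w \<in> coord_space I. \<phi> w = 0}"
  have "mi.subspace ?K"
    unfolding mi.subspace_def by (simp add: add scale phi_zero coord_space_closed)
  moreover have "\<forall>g\<in>SL. \<sigma> g ` ?K \<subseteq> ?K"
    by (auto simp: phi_SL[OF d] closed)
  moreover have "?K \<subseteq> coord_space I" by blast
  ultimately have "?K = {0} \<or> ?K = coord_space I"
    using irr[unfolded irreducible_rep_def, THEN conjunct2, THEN conjunct2, rule_format, of ?K] by (simp only: simp_thms)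
  then have K: "?K = {0}" using w0 by blast
  have inj: "inj_on \<phi> (coord_space I)"
  proof (rule inj_onI)
    fix v w assume vw: "v \<in> coord_space I" "w \<in> coord_space I" "\<phi> v = \<phi> w"
    have "\<phi> ((v - w) + w) = \<phi> (v - w) + \<phi> w"
      by (rule add[OF coord_space_closed(3)[OF vw(1,2)] vw(2)])
    then have "v - w \<in> ?K" using vw coord_space_closed(3)[OF vw(1,2)] by simp
    then show "v = w" using K by auto
  qed
  let ?S = "\<phi> ` coord_space I"
  have "mp.subspace ?S"
  proof -
    have 0: "0 \<in> ?S" by (rule image_eqI[of _ _ 0]) (simp_all add: phi_zero coord_space_closed)
    have 1: "\<phi> v + \<phi> w \<in> ?S" if "v \<in> coord_space I" "w \<in> coord_space I" for v w
      by (rule image_eqI[of _ _ "v + w"]) (simp_all add: add that coord_space_closed)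
    have 2: "cscale c (\<phi> w) \<in> ?S" if "w \<in> coord_space I" for c w
      by (rule image_eqI[of _ _ "cscale c w"]) (simp_all add: scale that coord_space_closed)
    show ?thesis unfolding mp.subspace_def using 0 1 2 by blast
  qed
  then have "?S = coord_space (Xi d)"
  proof (rule sym_irreducible)
    show "sym_rep g h \<in> ?S" if gh: "g \<in> SL" "h \<in> ?S" for g h
    proof -
      obtain w where w: "w \<in> coord_space I" "h = \<phi> w" using gh(2) by blast
      show ?thesis
        by (rule image_eqI[of _ _ "\<sigma> g w"]) (simp_all add: w phi_SL[OF d gh(1)] closed[OF gh(1)])
    qed
  qed (use d w0 in auto)
  then have "bij_betw \<phi> (coord_space I) (coord_space (Xi d))" using inj by (simp add: bij_betw_def)
  then show "rep_equiv SL \<sigma> I (sym_rep :: real^'m^'m \<Rightarrow> _) (Xi d)"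
    unfolding rep_equiv_def using phi_clinear phi_SL[OF d] by (intro exI[of _ \<phi>] conjI ballI)
qed

text \<open>By Schur's lemma \<open>\<phi>\<close> is a multiple of the given equivalence, so it commutes with an element
  of determinant \<open>-1\<close>.  On the other hand, by \<open>phi_M\<close>, it does so up to the sign \<open>\<alpha> \<beta> (-1)\<^sup>d\<close>.\<close>

lemma phi_sign:
  assumes d: "\<forall>w\<in>coord_space I. \<phi> w \<in> coord_space (Xi d)" and w0: "w0 \<in> coord_space I" "\<phi> w0 \<noteq> 0"
    and equiv: "rep_equiv SLpm \<sigma> I (sym_rep :: real^'m^'m \<Rightarrow> _) (Xi d)"
    and signs: "\<alpha> \<in> {1, -1}" "\<beta> \<in> {1, -1}"
  shows "\<beta> = sign_add \<alpha> d"
proof -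
  obtain T where T: "clinear_on (coord_space I) T" "bij_betw T (coord_space I) (coord_space (Xi d :: ('m \<Rightarrow>\<^sub>0 nat) set))"
    "\<And>g w. g \<in> SLpm \<Longrightarrow> w \<in> coord_space I \<Longrightarrow> T (\<sigma> g w) = sym_rep g (T w)"
    using equiv unfolding rep_equiv_def by blast
  let ?U = "inv_into (coord_space I) T"
  have U: "?U h \<in> coord_space I" "T (?U h) = h" if "h \<in> coord_space (Xi d)" for h
    using T(2) that by (auto simp: bij_betw_def intro: inv_into_into f_inv_into_f)
  have UT: "?U (T w) = w" if "w \<in> coord_space I" for w
    using T(2) that by (simp add: bij_betw_def)
  have SLpm: "g \<in> SLpm" if "g \<in> SL" for g :: "real^'m^'m" using that by (simp add: SL_def SLpm_def)
  have closed: "\<sigma> g w \<in> coord_space I" if "g \<in> SLpm" "w \<in> coord_space I" for g w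
    by (rule fd_repD(3)[OF fd that])
  have Ulin: "clinear_on (coord_space (Xi d)) ?U"
    unfolding clinear_on_def
  proof (intro conjI ballI allI)
    fix v w :: "'m pol" and c assume w: "w \<in> coord_space (Xi d)"
    have "T (cscale c (?U w)) = cscale c w" using T(1) U[OF w] by (simp add: clinear_on_def)
    then show "?U (cscale c w) = cscale c (?U w)" using UT coord_space_closed(4)[OF U(1)[OF w]] by metis
    assume v: "v \<in> coord_space (Xi d)"
    have "T (?U v + ?U w) = v + w" using T(1) U[OF w] U[OF v] by (simp add: clinear_on_def)
    then show "?U (v + w) = ?U v + ?U w" using UT coord_space_closed(2)[OF U(1)[OF v] U(1)[OF w]] by metis
  qed
  obtain c where c: "\<And>h. h \<in> coord_space (Xi d) \<Longrightarrow> \<phi> (?U h) = cscale c h"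
  proof (rule sym_schur[of d "\<lambda>h. \<phi> (?U h)"])
    show "clinear_on (coord_space (Xi d)) (\<lambda>h. \<phi> (?U h))"
      using Ulin phi_clinear U(1) by (simp add: clinear_on_def)
    show "\<phi> (?U h) \<in> coord_space (Xi d)" if "h \<in> coord_space (Xi d)" for h
      using d U(1)[OF that] by blast
    show "\<phi> (?U (sym_rep g h)) = sym_rep g (\<phi> (?U h))" if "g \<in> SL" "h \<in> coord_space (Xi d)" for g h
    proof -
      have "T (\<sigma> g (?U h)) = sym_rep g h" using T(3)[OF SLpm[OF that(1)] U(1)[OF that(2)]] U(2)[OF that(2)] by simp
      then have "?U (sym_rep g h) = \<sigma> g (?U h)" using UT closed[OF SLpm[OF that(1)] U(1)[OF that(2)]] by metis
      then show ?thesis using phi_SL[OF d that(1) U(1)[OF that(2)]] by simp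
    qed
  qed blast
  have Tc: "\<phi> w = cscale c (T w)" if "w \<in> coord_space I" for w
    using c[of "T w"] UT[OF that] T(2) that by (auto simp: bij_betw_def)
  have cT: "c \<noteq> 0" "T w0 \<noteq> 0" using w0 Tc[OF w0(1)] by auto
  obtain g :: "real^'m^'m" where g: "g \<in> SLpm" "det g = -1" by (rule SLpm_det_minus_1)
  define h where "h = sym_rep g (\<phi> w0)"
  have "h \<noteq> 0" unfolding h_def using sym_rep_inj[of g "\<phi> w0"] g w0 by auto
  then obtain \<kappa> where \<kappa>: "lookup h \<kappa> \<noteq> 0" by (metis poly_mapping_eqI lookup_zero)
  have "\<phi> (\<sigma> g w0) = h"
    using Tc[OF closed[OF g(1) w0(1)]] T(3)[OF g(1) w0(1)] Tc[OF w0(1)] by (simp add: h_def sym_rep_cscale)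
  then have "cscale (if \<beta> = 1 then 1 else - 1) h = cscale ((if \<alpha> = 1 then 1 else - 1) * (- 1) ^ d) h"
    using phi_M[OF w0(1), of d g] d w0 g by (simp add: h_def sign_char_minus_1)
  from arg_cong[OF this, of "\<lambda>f. lookup f \<kappa>"] \<kappa>
  have "(if \<beta> = 1 then 1 else - 1) = ((if \<alpha> = 1 then 1 else - 1) * (- 1) ^ d :: complex)" by simp
  then show ?thesis using signs by (cases "even d") (auto simp: sign_add_def split: if_splits)
qed

text \<open>A nonzero \<open>\<phi>\<close> of degree \<open>d\<close> is an equivalence with \<open>sym\<^sup>d\<close> on \<open>SL\<close>, and the convention on
  extensions makes it available on \<open>SLpm\<close>: through \<open>triv\<close> if \<open>d = 0\<close>, where \<open>r = s\<close>, and through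
  \<open>sym\<^sup>d\<close> otherwise, where \<open>s\<close> and \<open>r\<close> have the values in \<open>\<Lambda>\<close>.  The signs then put the parameters
  into one of the two excluded cases.\<close>

lemma phi_vanishes:
  assumes signs: "\<alpha> \<in> {1, -1}" "\<beta> \<in> {1, -1}"
    and irr: "irreducible_rep SL \<sigma> I" and conv: "extension_convention \<sigma> I s r"
    and not_id: "\<not> (\<beta> = \<alpha> \<and> rep_equiv SL \<sigma> I triv_rep UNIV \<and> r = s)"
    and not_Lambda: "\<not> (\<exists>k. in_Lambda k \<alpha> \<beta> \<sigma> I s r)"
  shows "\<forall>w\<in>coord_space I. \<phi> w = 0"
proof (rule phi_zero_or_homogeneous)
  fix d w0
  assume d: "\<forall>w\<in>coord_space I. \<phi> w \<in> coord_space (Xi d)" and w0: "w0 \<in> coord_space I" "\<phi> w0 \<noteq> 0"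
    and r: "r = s - of_nat d * (1 + 1 / of_nat CARD('m))" and sd: "d = 0 \<or> s = of_nat d - 1"
  note equiv = phi_equiv[OF irr d w0]
  show ?thesis
  proof (cases "d = 0")
    case True
    then have rs: "r = s" using r by simp
    have triv: "rep_equiv SL \<sigma> I triv_rep UNIV" using equiv True rep_equiv_sym_0_triv by blast
    then have "rep_equiv SLpm \<sigma> I triv_rep UNIV" using conv rs by (simp add: extension_convention_def)
    then obtain T where T: "bij_betw T (coord_space I) (coord_space UNIV :: (unit \<Rightarrow>\<^sub>0 complex) set)"
      "\<forall>g\<in>SLpm. \<forall>w\<in>coord_space I. T (\<sigma> g w) = T w"
      unfolding rep_equiv_def triv_rep_def by blast
    obtain g :: "real^'m^'m" where g: "g \<in> SLpm" "det g = -1" by (rule SLpm_det_minus_1)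
    have "\<sigma> g w0 \<in> coord_space I" by (rule fd_repD(3)[OF fd g(1) w0(1)])
    then have \<sigma>: "\<sigma> g w0 = w0" using T(2)[rule_format, OF g(1) w0(1)] T(1) w0(1) by (auto simp: bij_betw_def inj_on_def)
    have c: "\<phi> w0 = single 0 (lookup (\<phi> w0) 0)"
      using d w0 True by (intro poly_mapping_eqI) (auto simp: Pol_iff mdeg_eq_0_iff lookup_single when_def)
    then have sym: "sym_rep g (\<phi> w0) = \<phi> w0" by (metis sym_rep_const)
    have nz: "lookup (\<phi> w0) 0 \<noteq> 0" using c w0(2) by (metis single_zero)
    have "cscale (if \<beta> = 1 then 1 else - 1) (\<phi> w0) = cscale (if \<alpha> = 1 then 1 else - 1) (\<phi> w0)"
      using phi_M[OF w0(1), of d g] d w0 g True by (simp add: \<sigma> sym sign_char_minus_1)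
    from arg_cong[OF this, of "\<lambda>f. lookup f 0"] nz
    have "(if \<beta> = 1 then 1 else - 1 :: complex) = (if \<alpha> = 1 then 1 else - 1)" by simp
    then have "\<beta> = \<alpha>" using signs by (auto split: if_splits)
    then show ?thesis using not_id triv rs by blast
  next
    case False
    then have s: "s = of_nat d - 1" using sd by blast
    have r': "r = - (1 + of_nat d / of_nat CARD('m))" unfolding r s by (simp add: algebra_simps)
    have "rep_equiv SLpm \<sigma> I (sym_rep :: real^'m^'m \<Rightarrow> _) (Xi d)"
      using conv equiv s r' by (simp add: extension_convention_def)
    from phi_sign[OF d w0 this signs] have "in_Lambda d \<alpha> \<beta> \<sigma> I s r"
      unfolding in_Lambda_def using equiv s r' by blast
    then show ?thesis using not_Lambda by blast
  qed
qed

end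

text \<open>That the zero map is itself a homomorphism depends on the action of \<open>P\<close> on \<open>M(\<sigma>, r)\<close> being well
  defined, which is part of \<open>Hom_intro\<close>.\<close>

lemma Hom_zero:
  fixes \<sigma> :: "real^'m^'m::finite \<Rightarrow> ('i \<Rightarrow>\<^sub>0 complex) \<Rightarrow> ('i \<Rightarrow>\<^sub>0 complex)"
  assumes signs: "\<alpha> \<in> {1, -1}" "\<beta> \<in> {1, -1}" and fd: "fd_rep SLpm \<sigma> I"
    and irr: "irreducible_rep SL \<sigma> I" and conv: "extension_convention \<sigma> I s r"
    and not_id: "\<not> (\<beta> = \<alpha> \<and> rep_equiv SL \<sigma> I triv_rep UNIV \<and> r = s)"
    and not_Lambda: "\<not> (\<exists>k. in_Lambda k \<alpha> \<beta> \<sigma> I s r)"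
  shows "Hom_gP (verma \<sigma> I r \<beta>) (verma_triv s \<alpha>) = {zero_map (verma \<sigma> I r \<beta>) (verma_triv s \<alpha>)}"
proof (intro equalityI subsetI)
  let ?M = "verma \<sigma> I r \<beta> :: ('m, _) gP_module" and ?N = "verma_triv s \<alpha> :: ('m, _) gP_module"
  let ?S = "triv_ideal \<alpha> s :: (unit \<Rightarrow>\<^sub>0 'm uea) set" and ?\<pi> = "P_rep \<beta> \<sigma> r"
  {
    fix f assume f: "f \<in> Hom_gP ?M ?N"
    interpret verma_hom \<alpha> \<beta> r s \<sigma> I f
      by unfold_locales (rule fd, rule f)
    note z = phi_vanishes[OF signs irr conv not_id not_Lambda]
    have "f = zero_map ?M ?N"
    proof (rule f_eqI)
      show "zero_map ?M ?N \<in> extensional (carr ?M)" by (simp add: zero_map_def)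
      fix x :: "'i \<Rightarrow>\<^sub>0 'm uea" assume x: "x \<in> coord_space I"
      have e: "zero_map ?M ?N (coset (balance ?\<pi> I) x) = coset ?S 0"
        using carrI[OF x] by (simp add: zero_map_def verma_simps(2) coset_zero)
      show "zero_map ?M ?N (coset (balance ?\<pi> I) x) \<in> carr ?N"
        unfolding e by (simp add: verma_simps)
      show "valC s (zero_map ?M ?N (coset (balance ?\<pi> I) x)) =
          (\<Sum>i\<in>I. uact s (lookup x i) (\<phi> (single i 1)))"
        unfolding e using z by (simp add: single_coord cong: sum.cong)
    qed
    then show "f \<in> {zero_map ?M ?N}" by simp
  }
  have "coset_map ?S (\<lambda>x :: 'i \<Rightarrow>\<^sub>0 'm uea. 0) (coset (balance ?\<pi> I) x) = coset ?S 0" for x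
    by (rule coset_map_coset[OF add_subgroup_balance]) (simp_all add: balance_0)
  then have "zero_map ?M ?N = (\<lambda>C\<in>carr ?M. coset_map ?S (\<lambda>x. 0) C)"
    unfolding zero_map_def by (intro restrict_ext) (auto simp: verma_simps coset_zero)
  also have "\<dots> \<in> Hom_gP ?M ?N"
  proof (rule Hom_intro[OF fd])
    show "Vpol s 0 = Vpol s (ind_act (P_rep \<alpha> triv_rep s) UNIV p 0)" for p :: "real^('m option)^('m option)"
      using ind_act_add[of "P_rep \<alpha> triv_rep s" UNIV p 0 0] by simp
  qed simp_all
  finally show "f \<in> {zero_map ?M ?N} \<Longrightarrow> f \<in> Hom_gP ?M ?N" for f by simp
qed

section \<open>The classification\<close>

theorem theorem4p8:
  fixes \<alpha> \<beta> :: int and s r :: complex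
    and \<sigma> :: "real^'m^'m \<Rightarrow> ('i \<Rightarrow>\<^sub>0 complex) \<Rightarrow> ('i \<Rightarrow>\<^sub>0 complex)"
    and I :: "'i set"
  assumes "\<alpha> \<in> {1, -1}" and "\<beta> \<in> {1, -1}"
  shows "let M_triv = (verma_triv :: complex \<Rightarrow> int \<Rightarrow> ('m::finite, _) gP_module) in
    (\<beta> = \<alpha> \<and> r = s \<longrightarrow>
      Hom_gP (M_triv r \<beta>) (M_triv s \<alpha>) =
        multiples (M_triv r \<beta>) (M_triv s \<alpha>) (\<lambda>x\<in>carr (M_triv r \<beta>). x)) \<and>
    (\<forall>k. in_Lambda k \<alpha> \<beta> (sym_rep :: real^'m^'m \<Rightarrow> _) (Xi k) s r \<longrightarrow>
      Hom_gP (verma_sym k r \<beta>) (M_triv s \<alpha>) =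
        multiples (verma_sym k r \<beta>) (M_triv s \<alpha>) (phi k \<alpha>)) \<and>
    (fd_rep SLpm \<sigma> I \<and> irreducible_rep SL \<sigma> I \<and> extension_convention \<sigma> I s r \<and>
      \<not> (\<beta> = \<alpha> \<and> rep_equiv SL \<sigma> I triv_rep UNIV \<and> r = s) \<and>
      \<not> (\<exists>k. in_Lambda k \<alpha> \<beta> \<sigma> I s r) \<longrightarrow>
      Hom_gP (verma \<sigma> I r \<beta>) (M_triv s \<alpha>) = {zero_map (verma \<sigma> I r \<beta>) (M_triv s \<alpha>)})"
proof -
  have 1: "Hom_gP (verma_triv r \<beta> :: ('m, _) gP_module) (verma_triv s \<alpha>) =
      multiples (verma_triv r \<beta>) (verma_triv s \<alpha>) (\<lambda>x\<in>carr (verma_triv r \<beta>). x)" if "\<beta> = \<alpha>" "r = s"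
    unfolding that by (rule Hom_triv)
  have 2: "Hom_gP (verma_sym k r \<beta> :: ('m, _) gP_module) (verma_triv s \<alpha>) =
      multiples (verma_sym k r \<beta>) (verma_triv s \<alpha>) (phi k \<alpha>)"
    if "in_Lambda k \<alpha> \<beta> (sym_rep :: real^'m^'m \<Rightarrow> _) (Xi k) s r" for k
  proof -
    have p: "\<beta> = sign_add \<alpha> k" "s = of_nat k - 1" "r = - (1 + of_nat k / of_nat CARD('m))"
      using that by (simp_all add: in_Lambda_def)
    show ?thesis unfolding p by (rule Hom_sym[OF assms(1)])
  qed
  show ?thesis
    unfolding Let_def
  proof (intro conjI impI allI)
    show "Hom_gP (verma_triv r \<beta> :: ('m, _) gP_module) (verma_triv s \<alpha>) =
        multiples (verma_triv r \<beta>) (verma_triv s \<alpha>) (\<lambda>x\<in>carr (verma_triv r \<beta>). x)" if "\<beta> = \<alpha> \<and> r = s"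
      by (rule 1) (simp_all add: that)
    show "Hom_gP (verma_sym k r \<beta> :: ('m, _) gP_module) (verma_triv s \<alpha>) =
        multiples (verma_sym k r \<beta>) (verma_triv s \<alpha>) (phi k \<alpha>)"
      if "in_Lambda k \<alpha> \<beta> (sym_rep :: real^'m^'m \<Rightarrow> _) (Xi k) s r" for k
      by (rule 2[OF that])
    assume h: "fd_rep SLpm \<sigma> I \<and> irreducible_rep SL \<sigma> I \<and> extension_convention \<sigma> I s r \<and>
      \<not> (\<beta> = \<alpha> \<and> rep_equiv SL \<sigma> I triv_rep UNIV \<and> r = s) \<and>
      \<not> (\<exists>k. in_Lambda k \<alpha> \<beta> \<sigma> I s r)"
    note h = h[THEN conjunct1] h[THEN conjunct2, THEN conjunct1] h[THEN conjunct2, THEN conjunct2, THEN conjunct1]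
      h[THEN conjunct2, THEN conjunct2, THEN conjunct2, THEN conjunct1]
      h[THEN conjunct2, THEN conjunct2, THEN conjunct2, THEN conjunct2]
    show "Hom_gP (verma \<sigma> I r \<beta>) (verma_triv s \<alpha>) = {zero_map (verma \<sigma> I r \<beta>) (verma_triv s \<alpha>)}"
      by (rule Hom_zero[OF assms h])
  qed
qed

end
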